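(* Let $K$ be an infinite field, let $r\ge1$, $t=n+r$, and let $$\mathcal{F}=\{F_1,\ldots,F_t\}=\{x_1,\ldots,x_n,L_1,\ldots,L_r\}\subseteq R=K[x_1,\ldots,x_n],\qquad L_i=\sum_{j=1}^n u_{ij}x_j,\ u_{ij}\in K,$$ be such that any three elements of $\mathcal{F}$ form a regular sequence (so that $I_{2,\mathcal{F}}=\bigcap_{i<j}(F_i,F_j)$ is the ideal of a linear star configuration of height two). Let $B$, $m_\Theta$, $\mathcal{P}$ be as in the context. Let $\Lambda$ be the set of all monomial prime ideals of $K[T_1,\ldots,T_t]$ of the form $\mathfrak{p}_\chi=(T_k : k\in\chi)$ with $\chi\subseteq\{1,\ldots,t\}$, $|\chi|\le r$ and $I_n(B)\subseteq\mathfrak{p}_\chi$, and let $Q=\bigcap_{\mathfrak{p}\in\Lambda}\mathfrak{p}$. Suppose that $m_\Theta\ne0$ for every $\Theta\subseteq\{1,\ldots,t\}$ with $|\Theta|=r-1$. Then $I_n(B)$ is radical and its primary decomposition is $$I_n(B)=Q\cap\mathcal{P}.$$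
   Context: $B$ is the $n\times(t-1)$ matrix over $K[T_1,\ldots,T_t]$ with columns $A_1,\ldots,A_{n-1},C_1,\ldots,C_r$, where $A_j$ has entry $T_j$ in row $j$, $-T_{j+1}$ in row $j+1$ and $0$ elsewhere, and $C_i$ has entry $u_{ik}T_{n+i}$ in row $k$ for $k<n$ and entry $u_{in}T_{n+i}-T_n$ in row $n$ (this is a Jacobian dual matrix of $I_{2,\mathcal{F}}$). $I_n(B)\subseteq K[T_1,\ldots,T_t]$ is the ideal generated by the $n\times n$ minors of $B$. An intersection over the empty set of primes is the whole ring. $U$ is the $n\times r$ matrix whose entry in row $k$ and column $i$ is $u_{ik}$. For $\chi\subseteq\{1,\ldots,t\}$ with $|\chi|=r$, $U_\chi$ is the minor of $U$ with rows the elements of $\chi\cap\{1,\ldots,n\}$ and columns those $i\in\{1,\ldots,r\}$ with $n+i\notin\chi$ ($U_\chi=1$ if $\chi\cap\{1,\ldots,n\}=\emptyset$). For $\Theta\subseteq\{1,\ldots,t\}$ with $|\Theta|=r-1$, write $\{1,\ldots,t\}\setminus\Theta=\{k_1<\cdots<k_{n+1}\}$, let $h$ be the number of $i$ with $k_i\le n$, and set $$m_\Theta=\sum_{i=1}^{n+1}(-1)^{\alpha(\Theta,k_i)}\,\frac{T_{k_1}\cdots T_{k_{n+1}}}{T_{k_i}}\;U_{\Theta\cup\{k_i\}},\qquad \alpha(\Theta,k_i)=\begin{cases}n-h+i-k_i & i\le h,\\ n+i & i>h.\end{cases}$$ If $m_\Theta\neq0$, let $h_\Theta$ be the quotient of $m_\Theta$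 by the product of all variables $T_k$ with $k\notin\Theta$ and $U_{\Theta\cup\{k\}}=0$. $\mathcal{P}\subseteq K[T_1,\ldots,T_t]$ is the ideal generated by all $h_\Theta$, $|\Theta|=r-1$. *)

theory Defs
  imports
    "HOL-Algebra.QuotRing"
    "HOL-Library.Poly_Mapping"
    "Jordan_Normal_Form.Determinant"
    "Jordan_Normal_Form.DL_Submatrix"
begin

section \<open>Polynomial rings\<close>

text \<open>A polynomial is a finitely supported map from exponent vectors to coefficients.
  The ring \<open>K[X\<^sub>i : i \<in> V]\<close> is the subring of those polynomials all of whose monomials
  only involve variables with index in \<open>V\<close>; ideals are always taken in this ring, not in the
  polynomial ring in all variables \<open>X\<^sub>0, X\<^sub>1, \<dots>\<close>.\<close>

type_synonym 'a mpol = "(nat \<Rightarrow>\<^sub>0 nat) \<Rightarrow>\<^sub>0 'a"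

definition Var :: "nat \<Rightarrow> 'a::field mpol" where
  "Var i = Poly_Mapping.single (Poly_Mapping.single i 1) 1"

definition Const :: "'a::field \<Rightarrow> 'a mpol" where
  "Const c = Poly_Mapping.single 0 c"

definition mpol_ring :: "nat set \<Rightarrow> 'a::field mpol ring" where
  "mpol_ring V = \<lparr>carrier = {p. \<forall>e\<in>Poly_Mapping.keys p. Poly_Mapping.keys e \<subseteq> V},
     monoid.mult = (*), one = 1, zero = 0, add = (+)\<rparr>"

lemma cring_mpol_ring: "cring (mpol_ring V :: 'a::field mpol ring)"
proof (intro cringI abelian_groupI comm_monoidI)
  fix x :: "'a mpol"
  assume "x \<in> carrier (mpol_ring V)"
  then show "\<exists>y\<in>carrier (mpol_ring V). y \<oplus>\<^bsub>mpol_ring V\<^esub> x = \<zero>\<^bsub>mpol_ring V\<^esub>"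
    by (intro bexI[of _ "- x"]) (auto simp: mpol_ring_def)
next
  fix x y :: "'a mpol"
  assume xy: "x \<in> carrier (mpol_ring V)" "y \<in> carrier (mpol_ring V)"
  show "x \<oplus>\<^bsub>mpol_ring V\<^esub> y \<in> carrier (mpol_ring V)"
    using xy keys_add[of x y] by (fastforce simp: mpol_ring_def)
  show "x \<otimes>\<^bsub>mpol_ring V\<^esub> y \<in> carrier (mpol_ring V)"
  proof -
    have "Poly_Mapping.keys e \<subseteq> V" if e_in: "e \<in> Poly_Mapping.keys (x * y)" for e
    proof -
      obtain a b where e: "e = a + b" and "a \<in> Poly_Mapping.keys x" "b \<in> Poly_Mapping.keys y"
        using e_in keys_mult[of x y] by blast
      with xy have "Poly_Mapping.keys a \<subseteq> V" "Poly_Mapping.keys b \<subseteq> V"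
        by (auto simp: mpol_ring_def)
      with keys_add[of a b] e show ?thesis by blast
    qed
    then show ?thesis by (auto simp: mpol_ring_def)
  qed
qed (auto simp: mpol_ring_def algebra_simps)

section \<open>Commutative algebra\<close>

definition regular_sequence :: "('a, 'b) ring_scheme \<Rightarrow> 'a list \<Rightarrow> bool" where
  "regular_sequence R as \<longleftrightarrow>
     set as \<subseteq> carrier R \<and> Idl\<^bsub>R\<^esub> (set as) \<noteq> carrier R \<and>
     (\<forall>i<length as. \<forall>y\<in>carrier R.
        as ! i \<otimes>\<^bsub>R\<^esub> y \<in> Idl\<^bsub>R\<^esub> (set (take i as)) \<longrightarrow> y \<in> Idl\<^bsub>R\<^esub> (set (take i as)))"

definition radical :: "('a, 'b) ring_scheme \<Rightarrow> 'a set \<Rightarrow> 'a set" where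
  "radical R I = {a \<in> carrier R. \<exists>m::nat. a [^]\<^bsub>R\<^esub> m \<in> I}"

definition radical_ideal :: "('a, 'b) ring_scheme \<Rightarrow> 'a set \<Rightarrow> bool" where
  "radical_ideal R I \<longleftrightarrow> ideal I R \<and> radical R I = I"

definition primary_ideal :: "('a, 'b) ring_scheme \<Rightarrow> 'a set \<Rightarrow> bool" where
  "primary_ideal R I \<longleftrightarrow> ideal I R \<and> I \<noteq> carrier R \<and>
     (\<forall>a\<in>carrier R. \<forall>b\<in>carrier R. a \<otimes>\<^bsub>R\<^esub> b \<in> I \<longrightarrow> a \<in> I \<or> b \<in> radical R I)"

definition primary_decomposition :: "('a, 'b) ring_scheme \<Rightarrow> 'a set \<Rightarrow> 'a set set \<Rightarrow> bool" where
  "primary_decomposition R I S \<longleftrightarrow>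
     finite S \<and> (\<forall>J\<in>S. primary_ideal R J) \<and> I = carrier R \<inter> \<Inter>S"

section \<open>The linear forms and the Jacobian dual matrix\<close>

text \<open>The scalar \<open>u i k\<close>, for \<open>1 \<le> i \<le> r\<close> and \<open>1 \<le> k \<le> n\<close>, is the coefficient of \<open>x\<^sub>k\<close> in \<open>L\<^sub>i\<close>.
  Both \<open>x\<^sub>k\<close> and \<open>T\<^sub>k\<close> are written \<open>Var k\<close>; the ring decides which one is meant.
  Variables, linear forms and subsets of \<open>{1,\<dots>,t}\<close> are indexed from 1 on; the entries of
  vectors and matrices are indexed from 0 on.\<close>

definition F_elt :: "nat \<Rightarrow> (nat \<Rightarrow> nat \<Rightarrow> 'a::field) \<Rightarrow> nat \<Rightarrow> 'a mpol" where
  "F_elt n u j = (if j \<le> n then Var j else \<Sum>k=1..n. Const (u (j - n) k) * Var k)"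

abbreviation T_ring :: "nat \<Rightarrow> nat \<Rightarrow> 'a::field mpol ring" where
  "T_ring n r \<equiv> mpol_ring {1..n + r}"

definition A_col :: "nat \<Rightarrow> nat \<Rightarrow> 'a::field mpol vec" where
  "A_col n j = vec n (\<lambda>k. if Suc k = j then Var j else if Suc k = j + 1 then - Var (j + 1) else 0)"

definition C_col :: "nat \<Rightarrow> (nat \<Rightarrow> nat \<Rightarrow> 'a::field) \<Rightarrow> nat \<Rightarrow> 'a mpol vec" where
  "C_col n u i = vec n (\<lambda>k. if Suc k < n then Const (u i (Suc k)) * Var (n + i)
                            else Const (u i n) * Var (n + i) - Var n)"

definition B_mat :: "nat \<Rightarrow> nat \<Rightarrow> (nat \<Rightarrow> nat \<Rightarrow> 'a::field) \<Rightarrow> 'a mpol mat" where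
  "B_mat n r u = mat_of_cols n (map (A_col n) [1..<n] @ map (C_col n u) [1..<r + 1])"

definition I_n_B :: "nat \<Rightarrow> nat \<Rightarrow> (nat \<Rightarrow> nat \<Rightarrow> 'a::field) \<Rightarrow> 'a mpol set" where
  "I_n_B n r u = Idl\<^bsub>T_ring n r\<^esub>
     {det (submatrix (B_mat n r u) {..<n} J) | J. J \<subseteq> {..<dim_col (B_mat n r u)} \<and> card J = n}"

section \<open>The ideals \<open>P\<close> and \<open>Q\<close>\<close>

definition U_mat :: "nat \<Rightarrow> nat \<Rightarrow> (nat \<Rightarrow> nat \<Rightarrow> 'a::field) \<Rightarrow> 'a mat" where
  "U_mat n r u = mat n r (\<lambda>(k, i). u (Suc i) (Suc k))"

text \<open>If \<open>\<chi> \<inter> {1,\<dots>,n} = {}\<close> and \<open>card \<chi> = r\<close>, this is the determinant of the empty matrix,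
  that is, 1.\<close>

definition U_minor :: "nat \<Rightarrow> nat \<Rightarrow> (nat \<Rightarrow> nat \<Rightarrow> 'a::field) \<Rightarrow> nat set \<Rightarrow> 'a" where
  "U_minor n r u \<chi> =
     det (submatrix (U_mat n r u) {k. k < n \<and> Suc k \<in> \<chi>} {i. i < r \<and> n + Suc i \<notin> \<chi>})"

text \<open>In the first case of \<open>sign_exp\<close>, \<open>k \<le> n - (h - i)\<close> for the \<open>i\<close>-th element \<open>k\<close> of the
  complement of \<open>\<Theta>\<close>, so the truncated subtraction is exact.\<close>

definition sign_exp :: "nat \<Rightarrow> nat \<Rightarrow> nat \<Rightarrow> nat \<Rightarrow> nat" where
  "sign_exp n h i k = (if i \<le> h then (n + i) - (h + k) else n + i)"

definition m_poly :: "nat \<Rightarrow> nat \<Rightarrow> (nat \<Rightarrow> nat \<Rightarrow> 'a::field) \<Rightarrow> nat set \<Rightarrow> 'a mpol" where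
  "m_poly n r u \<Theta> =
     (let D = {1..n + r} - \<Theta>;
          k = (\<lambda>i. sorted_list_of_set D ! (i - 1));
          h = card {i \<in> {1..n + 1}. k i \<le> n}
      in \<Sum>i=1..n + 1. (- 1) ^ sign_exp n h i (k i) * (\<Prod>l\<in>D - {k i}. Var l)
                        * Const (U_minor n r u (\<Theta> \<union> {k i})))"

definition h_poly :: "nat \<Rightarrow> nat \<Rightarrow> (nat \<Rightarrow> nat \<Rightarrow> 'a::field) \<Rightarrow> nat set \<Rightarrow> 'a mpol" where
  "h_poly n r u \<Theta> =
     (THE q. q * (\<Prod>k | k \<in> {1..n + r} - \<Theta> \<and> U_minor n r u (\<Theta> \<union> {k}) = 0. Var k)
             = m_poly n r u \<Theta>)"

lemma h_poly_eqI:
  assumes "q * (\<Prod>k | k \<in> {1..n + r} - \<Theta> \<and> U_minor n r u (\<Theta> \<union> {k}) = 0. Var k) = m_poly n r u \<Theta>"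
  shows "h_poly n r u \<Theta> = q"
proof -
  define d :: "'a mpol" where
    "d = (\<Prod>k | k \<in> {1..n + r} - \<Theta> \<and> U_minor n r u (\<Theta> \<union> {k}) = 0. Var k)"
  have "(Var k :: 'a mpol) \<noteq> 0" for k
    unfolding Var_def by (metis lookup_single_eq lookup_zero one_neq_zero)
  then have "d \<noteq> 0"
    unfolding d_def by simp
  have "q * d = m_poly n r u \<Theta>"
    using assms unfolding d_def .
  moreover have "p = q" if "p * d = m_poly n r u \<Theta>" for p
  proof -
    have "p * d = q * d"
      using that calculation by (rule trans[OF _ sym])
    with \<open>d \<noteq> 0\<close> show ?thesis
      by simp
  qed
  ultimately show ?thesis
    unfolding h_poly_def d_def[symmetric] by (rule the_equality)
qed

definition P_ideal :: "nat \<Rightarrow> nat \<Rightarrow> (nat \<Rightarrow> nat \<Rightarrow> 'a::field) \<Rightarrow> 'a mpol set" where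
  "P_ideal n r u = Idl\<^bsub>T_ring n r\<^esub>
     {h_poly n r u \<Theta> | \<Theta>. \<Theta> \<subseteq> {1..n + r} \<and> card \<Theta> = r - 1 \<and> m_poly n r u \<Theta> \<noteq> 0}"

definition Lambda_set :: "nat \<Rightarrow> nat \<Rightarrow> (nat \<Rightarrow> nat \<Rightarrow> 'a::field) \<Rightarrow> 'a mpol set set" where
  "Lambda_set n r u = {\<pp>. \<exists>\<chi>. \<chi> \<subseteq> {1..n + r} \<and> card \<chi> \<le> r \<and> \<pp> = Idl\<^bsub>T_ring n r\<^esub> (Var ` \<chi>)
                    \<and> I_n_B n r u \<subseteq> \<pp>}"

definition Q_ideal :: "nat \<Rightarrow> nat \<Rightarrow> (nat \<Rightarrow> nat \<Rightarrow> 'a::field) \<Rightarrow> 'a mpol set" where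
  "Q_ideal n r u = carrier (T_ring n r) \<inter> \<Inter>(Lambda_set n r u)"

end

theory Submission
  imports Defs "HOL-Library.Function_Algebras"
begin

text \<open>Let \<open>f\<^sub>j\<close> be the coefficient vector of \<open>F\<^sub>j\<close> and \<open>v\<^sub>j = T\<^sub>j f\<^sub>j\<close>. The columns of \<open>B\<close> are differences
  of the \<open>v\<^sub>j\<close> along a spanning tree, so \<open>I\<^sub>n(B)\<close> contains every determinant
  \<open>det (v\<^sub>j - v\<^sub>i : j \<in> X)\<close>. If \<open>X\<close> is a basis and \<open>f\<^sub>i = \<Sum> c\<^sub>j f\<^sub>j\<close>, then by a rank one update this is a
  nonzero scalar times \<open>T\<^sup>X - \<Sum> c\<^sub>j T\<^sup>X T\<^sub>i / T\<^sub>j\<close>. It rewrites a monomial whose support contains \<open>X\<close>;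
  when \<open>i < j\<close> for all \<open>j\<close> with \<open>c\<^sub>j \<noteq> 0\<close>, the weight \<open>\<Sum> k e\<^sub>k\<close> decreases. The \<open>h\<^sub>\<Theta>\<close>, which are circuit
  polynomials, rewrite in the same way every monomial whose support contains a broken circuit.

  The other monomials have linearly independent values at the points \<open>(1 / F\<^sub>j(x))\<^sub>j\<close>: look at the
  highest order pole along the last hyperplane and restrict to it. Hence \<open>\<P>\<close> is the vanishing ideal of
  these points, and it is prime. As \<open>n + 1\<close> of the \<open>F\<^sub>j\<close> always span (this is \<open>m\<^sub>\<Theta> \<noteq> 0\<close>), a monomial of
  \<open>Q\<close> whose support contains a broken circuit can be rewritten modulo \<open>I\<^sub>n(B)\<close>. An element of
  \<open>Q \<inter> \<P>\<close> is thus congruent modulo \<open>I\<^sub>n(B)\<close> to an element of \<open>\<P>\<close> without such monomials, which is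
  zero. So \<open>I\<^sub>n(B) = Q \<inter> \<P>\<close> is an intersection of primes.\<close>

section \<open>Independence of monomials avoiding broken circuits\<close>

text \<open>The points and the primes have one source. A row vector \<open>x\<close> sends
  \<open>v\<^sub>j\<close> to \<open>F\<^sub>j(x) T\<^sub>j\<close>, so it annihilates every column
  of \<open>B\<close> as soon as this product has the same value for all \<open>j\<close>. The value
  1 gives the points \<open>(1 / F\<^sub>j(x))\<^sub>j\<close>; the value 0 gives the subspaces
  where \<open>T\<^sub>k = 0\<close> for \<open>k\<close> in \<chi>, with \<chi> containing every
  \<open>k\<close> such that \<open>F\<^sub>k(x)\<close> is nonzero. The obstacle is that the minors
  of \<open>B\<close> give relations only for bases \<open>X\<close> with \<open>n\<close> elements,
  while a broken circuit may be shorter. A monomial can be rewritten modulo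
  \<open>I\<^sub>n(B)\<close> if the broken circuit extends to a basis inside the support, and
  membership in \<open>Q\<close> is what ensures this. In \<P> the problem disappears, because
  passing from \<open>m\<^sub>\<Theta>\<close> to \<open>h\<^sub>\<Theta>\<close> divides out the
  variables outside the circuit. Rewriting yields only the existence of a reduced representative.
  Its uniqueness modulo \<P> comes from the independence of the unbroken monomials as functions on
  the points.\<close>

definition line_poly :: "((nat \<Rightarrow> 'a::comm_semiring_0) \<Rightarrow> 'a) \<Rightarrow> bool" where
  "line_poly g \<longleftrightarrow> (\<forall>x d. \<exists>p. \<forall>s. g (\<lambda>i. x i + s * d i) = poly p s)"

lemma line_poly_const [intro]: "line_poly (\<lambda>_. c)"
  unfolding line_poly_def by (auto intro!: exI[of _ "[:c:]"])

lemma line_poly_coord [intro]: "line_poly (\<lambda>y. y i :: 'a::comm_semiring_1)"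
  unfolding line_poly_def
proof (intro allI)
  fix x d :: "nat \<Rightarrow> 'a"
  show "\<exists>p. \<forall>s. x i + s * d i = poly p s"
    by (intro exI[of _ "[:x i, d i:]"]) simp
qed

lemma line_poly_add [intro]: "line_poly f \<Longrightarrow> line_poly g \<Longrightarrow> line_poly (\<lambda>y. f y + g y)"
  unfolding line_poly_def by (metis poly_add)

lemma line_poly_mult [intro]:
  fixes f g :: "(nat \<Rightarrow> 'a::comm_semiring_1) \<Rightarrow> 'a"
  shows "line_poly f \<Longrightarrow> line_poly g \<Longrightarrow> line_poly (\<lambda>y. f y * g y)"
  unfolding line_poly_def by (metis poly_mult)

lemma line_poly_power [intro]:
  fixes f :: "(nat \<Rightarrow> 'a::comm_semiring_1) \<Rightarrow> 'a"
  shows "line_poly f \<Longrightarrow> line_poly (\<lambda>y. f y ^ k)"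
  by (induction k) auto

lemma line_poly_sum [intro]: "(\<And>a. a \<in> A \<Longrightarrow> line_poly (f a)) \<Longrightarrow> line_poly (\<lambda>y. \<Sum>a\<in>A. f a y)"
  by (induction A rule: infinite_finite_induct) auto

lemma line_poly_prod [intro]:
  fixes f :: "'b \<Rightarrow> (nat \<Rightarrow> 'a::comm_semiring_1) \<Rightarrow> 'a"
  shows "(\<And>a. a \<in> A \<Longrightarrow> line_poly (f a)) \<Longrightarrow> line_poly (\<lambda>y. \<Prod>a\<in>A. f a y)"
  by (induction A rule: infinite_finite_induct) auto

definition lin_sub :: "(nat \<Rightarrow> 'a::comm_ring_1) set \<Rightarrow> bool" where
  "lin_sub L \<longleftrightarrow> (\<lambda>_. 0) \<in> L \<and> (\<forall>x\<in>L. \<forall>y\<in>L. \<forall>s. (\<lambda>i. x i + s * y i) \<in> L)"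

lemma lin_subD: "lin_sub L \<Longrightarrow> x \<in> L \<Longrightarrow> y \<in> L \<Longrightarrow> (\<lambda>i. x i + s * y i) \<in> L"
  unfolding lin_sub_def by blast

text \<open>Stands in for the irreducibility of a linear space. On the line joining the two
  witnesses both functions are nonzero univariate polynomials, so together they have finitely many
  zeros, and an infinite field has a parameter left. \<open>line_poly\<close> records restrictions
  to lines because this argument works on a single line.\<close>

lemma line_poly_mult_nonzero:
  fixes g h :: "(nat \<Rightarrow> 'a::idom) \<Rightarrow> 'a"
  assumes inf: "infinite (UNIV :: 'a set)" and "lin_sub L" "line_poly g" "line_poly h"
    and "x \<in> L" "g x \<noteq> 0" "y \<in> L" "h y \<noteq> 0"
  shows "\<exists>z\<in>L. g z \<noteq> 0 \<and> h z \<noteq> 0"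
proof -
  define d where "d = (\<lambda>i. y i + (-1) * x i)"
  have "d \<in> L" unfolding d_def using assms by (intro lin_subD)
  obtain p q where p: "\<And>s. g (\<lambda>i. x i + s * d i) = poly p s"
    and q: "\<And>s. h (\<lambda>i. x i + s * d i) = poly q s"
    using assms(3,4) unfolding line_poly_def by meson
  from p[of 0] have "p \<noteq> 0" using assms by auto
  have "(\<lambda>i. x i + 1 * d i) = y" by (auto simp: d_def)
  with q[of 1] have "q \<noteq> 0" using assms by auto
  with \<open>p \<noteq> 0\<close> have "finite {s. poly (p * q) s = 0}" by (intro poly_roots_finite) simp
  with inf obtain s where "poly (p * q) s \<noteq> 0"
    by (metis (mono_tags, lifting) UNIV_I finite_subset mem_Collect_eq subsetI)
  then show ?thesis
    using p[of s] q[of s] lin_subD[OF assms(2,5) \<open>d \<in> L\<close>, of s]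
    by (intro bexI[of _ "\<lambda>i. x i + s * d i"]) auto
qed

text \<open>The complement of the coordinate hyperplanes is dense in \<open>L\<close>. This carries
  identities known at points with invertible coordinates over to all of \<open>L\<close>.\<close>

lemma coords_nonzero:
  fixes L :: "(nat \<Rightarrow> 'a::idom) set"
  assumes inf: "infinite (UNIV :: 'a set)" and "lin_sub L" "line_poly g" "x \<in> L" "g x \<noteq> 0"
    and "finite N" "\<And>i. i \<in> N \<Longrightarrow> \<exists>y\<in>L. y i \<noteq> 0"
  shows "\<exists>z\<in>L. g z \<noteq> 0 \<and> (\<forall>i\<in>N. z i \<noteq> 0)"
  using assms(6,7)
proof (induction N)
  case empty
  then show ?case using assms by auto
next
  case (insert i N)
  then obtain z where z: "z \<in> L" "g z \<noteq> 0" "\<forall>i\<in>N. z i \<noteq> 0" by auto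
  obtain y where y: "y \<in> L" "y i \<noteq> 0" using insert by auto
  have "\<exists>w\<in>L. g w * (\<Prod>i\<in>N. w i) \<noteq> 0 \<and> w i \<noteq> 0"
  proof (rule line_poly_mult_nonzero[OF inf assms(2) _ line_poly_coord z(1) _ y])
    show "line_poly (\<lambda>w. g w * (\<Prod>i\<in>N. w i))"
      by (intro line_poly_mult line_poly_prod line_poly_coord assms(3))
  qed (use z insert.hyps in auto)
  then show ?case using insert.hyps by auto
qed

text \<open>The coordinates on \<open>L\<close> play the part of the linear forms. A broken circuit
  is a circuit without its smallest element, and a set contains one exactly when some coordinate is
  a combination of larger coordinates from the set. The empty combination covers coordinates that
  vanish on \<open>L\<close>.\<close>

definition broken :: "nat set \<Rightarrow> (nat \<Rightarrow> 'a::comm_ring_1) set \<Rightarrow> nat set \<Rightarrow> bool" where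
  "broken N L E \<longleftrightarrow> (\<exists>i\<in>N. \<exists>c. \<forall>y\<in>L. y i = (\<Sum>j | j \<in> E \<and> i < j. c j * y j))"

lemma broken_if_zero: "i \<in> N \<Longrightarrow> \<forall>y\<in>L. y i = 0 \<Longrightarrow> broken N L E"
  unfolding broken_def by (intro bexI[of _ i] exI[of _ "\<lambda>_. 0"]) auto

lemma clear_denominators:
  fixes y :: "nat \<Rightarrow> 'a::field"
  assumes "finite N" "\<And>i. i \<in> N \<Longrightarrow> y i \<noteq> 0" "\<And>a i. a \<in> A \<Longrightarrow> i \<in> N \<Longrightarrow> e a i \<le> M i"
  shows "(\<Sum>a\<in>A. c a * (\<Prod>i\<in>N. y i ^ (M i - e a i))) =
    (\<Prod>i\<in>N. y i ^ M i) * (\<Sum>a\<in>A. c a * (\<Prod>i\<in>N. inverse (y i) ^ e a i))"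
proof -
  have "(\<Prod>i\<in>N. y i ^ (M i - e a i)) = (\<Prod>i\<in>N. y i ^ M i) * (\<Prod>i\<in>N. inverse (y i) ^ e a i)"
    if "a \<in> A" for a
    unfolding prod.distrib[symmetric] using assms that
    by (intro prod.cong refl) (simp add: power_diff power_inverse divide_inverse)
  then show ?thesis by (simp add: sum_distrib_left mult_ac)
qed

lemma lin_sub_restrict: "lin_sub L \<Longrightarrow> lin_sub {y \<in> L. y t = 0}"
  unfolding lin_sub_def by auto

text \<open>A relation on the hyperplane \<open>y t = 0\<close> lifts to \<open>L\<close>: move
  \<open>y\<close> along a vector \<open>w\<close> with \<open>w t \<noteq> 0\<close> until its
  coordinate \<open>t\<close> vanishes. The correction is a multiple of \<open>y t\<close>, which is
  admissible because \<open>t\<close> lies in \<open>E\<close> and exceeds every index in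
  \<open>N\<close>. If there is no such \<open>w\<close>, coordinate \<open>t\<close> itself
  vanishes on \<open>L\<close>.\<close>

lemma broken_restrict:
  fixes L :: "(nat \<Rightarrow> 'a::field) set"
  assumes L: "lin_sub L" and "finite E" "t \<in> E" "\<And>i. i \<in> N \<Longrightarrow> i < t"
    and "broken N {y \<in> L. y t = 0} (E - {t})"
  shows "broken (insert t N) L E"
proof (cases "\<exists>w\<in>L. w t \<noteq> 0")
  case False
  then show ?thesis by (intro broken_if_zero[of t]) auto
next
  case True
  then obtain w where w: "w \<in> L" "w t \<noteq> 0" by auto
  obtain i c where i: "i \<in> N"
    and c: "\<And>y. y \<in> L \<Longrightarrow> y t = 0 \<Longrightarrow> y i = (\<Sum>j | j \<in> E - {t} \<and> i < j. c j * y j)"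
    using assms(5) unfolding broken_def by auto
  define S where "S = {j. j \<in> E - {t} \<and> i < j}"
  have S: "{j. j \<in> E \<and> i < j} = insert t S" "t \<notin> S" "finite S"
    using assms i by (auto simp: S_def)
  \<comment> \<open>The defect of the hyperplane relation at \<open>w\<close>, divided by
    \<open>w t\<close>: the coefficient of \<open>y t\<close> that makes the relation hold at
    \<open>w\<close> too.\<close>
  define d where "d = (w i - (\<Sum>j\<in>S. c j * w j)) / w t"
  have "y i = (\<Sum>j\<in>insert t S. (c(t := d)) j * y j)" if y: "y \<in> L" for y
  proof -
    define s where "s = - (y t / w t)"
    have "(\<lambda>i. y i + s * w i) \<in> L" using lin_subD[OF L y w(1)] .
    from c[OF this] have *: "y i + s * w i = (\<Sum>j\<in>S. c j * (y j + s * w j))"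
      using w by (simp add: s_def S_def)
    define X where "X = (\<Sum>j\<in>S. c j * w j)"
    have "(\<Sum>j\<in>S. c j * (y j + s * w j)) = (\<Sum>j\<in>S. c j * y j) + s * X"
      unfolding X_def by (simp add: distrib_left sum.distrib sum_distrib_left mult.left_commute)
    with * have "y i = (\<Sum>j\<in>S. c j * y j) + (s * X - s * w i)"
      by (metis add_diff_cancel_right' add_diff_eq)
    also have "s * X - s * w i = d * y t"
    proof -
      have "d * y t = (w i - X) * (y t / w t)" by (simp add: d_def X_def)
      then show ?thesis by (simp add: s_def diff_divide_distrib left_diff_distrib right_diff_distrib mult.commute)
    qed
    also have "(\<Sum>j\<in>S. c j * y j) = (\<Sum>j\<in>S. (c(t := d)) j * y j)"
      using S(2) by (intro sum.cong) auto
    also have "\<dots> + d * y t = (\<Sum>j\<in>insert t S. (c(t := d)) j * y j)"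
      using S(2,3) by simp
    finally show ?thesis .
  qed
  then show ?thesis
    unfolding broken_def using i
    by (intro bexI[of _ i] exI[of _ "c(t := d)"] ballI) (simp_all only: S(1) insertI2)
qed

text \<open>Induction on the largest index \<open>t\<close>. After multiplication by the
  \<open>m\<close>-th power of \<open>y t\<close>, where \<open>m\<close> is the maximal pole order,
  only the terms of order \<open>m\<close> survive on \<open>y t = 0\<close>, and
  \<open>broken_restrict\<close> keeps their supports unbroken there. Since the space is cut down on
  the way, \<open>L\<close> has to vary in the induction.\<close>

lemma nbc_independent:
  fixes L :: "(nat \<Rightarrow> 'a::field) set" and c :: "'b \<Rightarrow> 'a"
  assumes inf: "infinite (UNIV :: 'a set)" and "finite N" "lin_sub L" "finite A"
    and "\<And>a b. a \<in> A \<Longrightarrow> b \<in> A \<Longrightarrow> (\<And>i. i \<in> N \<Longrightarrow> e a i = e b i) \<Longrightarrow> a = b"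
    and "\<And>a. a \<in> A \<Longrightarrow> \<not> broken N L {i \<in> N. e a i > (0::nat)}"
    and "\<And>y. y \<in> L \<Longrightarrow> (\<And>i. i \<in> N \<Longrightarrow> y i \<noteq> 0) \<Longrightarrow>
           (\<Sum>a\<in>A. c a * (\<Prod>i\<in>N. inverse (y i) ^ e a i)) = 0"
    and "a \<in> A"
  shows "c a = 0"
  using assms(2-)
proof (induction N arbitrary: L A a rule: finite_linorder_max_induct)
  case empty
  have "b = a" if "b \<in> A" for b
    by (rule empty.prems(3)[OF that empty.prems(6)]) simp
  then have "A = {a}" using empty.prems(6) by blast
  moreover have "\<exists>y. y \<in> L"
    using empty.prems(1) unfolding lin_sub_def by auto
  ultimately show ?case using empty.prems(5) by fastforce
next
  case (insert t N)
  note ts = insert.hyps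
  have "t \<notin> N" using ts by auto
  show ?case
  proof (rule ccontr)
    assume "c a \<noteq> 0"
    define A1 where "A1 = {a \<in> A. c a \<noteq> 0}"
    define m where "m = Max ((\<lambda>a. e a t) ` A1)"
    define A2 where "A2 = {a \<in> A1. e a t = m}"
    have A1: "a \<in> A1" "finite A1" "A1 \<subseteq> A" using \<open>c a \<noteq> 0\<close> insert.prems by (auto simp: A1_def)
    have le_m: "e b t \<le> m" if "b \<in> A1" for b using that A1 by (auto simp: m_def)
    have "m \<in> (\<lambda>a. e a t) ` A1" unfolding m_def using A1 by (intro Max_in) auto
    then obtain b where b: "b \<in> A2" by (auto simp: A2_def)
    \<comment> \<open>For \<open>m = 0\<close> the index \<open>t\<close> lies in no support, so
      \<open>broken_restrict\<close> would not apply to the hyperplane; the space then stays as it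
      is, and \<open>t\<close> merely disappears from the sum.\<close>
    define L2 where "L2 = (if m = 0 then L else {y \<in> L. y t = 0})"
    have "L2 \<subseteq> L" by (auto simp: L2_def)
    have L2: "lin_sub L2" using lin_sub_restrict[OF insert.prems(1)] insert.prems(1) by (simp add: L2_def)
    define M where "M = (\<lambda>i. if i = t then m else Max ((\<lambda>a. e a i) ` A1))"
    have le_M: "e b i \<le> M i" if "b \<in> A1" for b i
      using that le_m A1 by (auto simp: M_def)
    define G where "G = (\<lambda>y. \<Sum>a\<in>A1. c a * (\<Prod>i\<in>insert t N. y i ^ (M i - e a i)))"
    have lpG: "line_poly G" unfolding G_def
      by (intro line_poly_sum line_poly_mult line_poly_prod line_poly_power line_poly_coord line_poly_const)
    \<comment> \<open>A coordinate vanishing on \<open>L\<close> would make every support broken,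
      even the empty one.\<close>
    have nz: "\<exists>y\<in>L. y i \<noteq> 0" if "i \<in> insert t N" for i
      using insert.prems(4)[OF insert.prems(6)] broken_if_zero that by blast
    \<comment> \<open>The hypothesis speaks only of points with invertible coordinates; density
      extends the vanishing of the numerator to all of \<open>L\<close>, in particular to
      \<open>y t = 0\<close>.\<close>
    have G0: "G y = 0" if y: "y \<in> L" for y
    proof (rule ccontr)
      assume "G y \<noteq> 0"
      from coords_nonzero[OF inf insert.prems(1) lpG y this _ nz, of "insert t N"] ts
      obtain z where z: "z \<in> L" "G z \<noteq> 0" "\<forall>i\<in>insert t N. z i \<noteq> 0" by auto
      have "(\<Sum>a\<in>A. c a * (\<Prod>i\<in>insert t N. inverse (z i) ^ e a i)) = 0"
        using z by (intro insert.prems(5)) auto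
      moreover have "(\<Sum>a\<in>A. c a * (\<Prod>i\<in>insert t N. inverse (z i) ^ e a i)) =
        (\<Sum>a\<in>A1. c a * (\<Prod>i\<in>insert t N. inverse (z i) ^ e a i))"
        using insert.prems(2) by (intro sum.mono_neutral_right) (auto simp: A1_def)
      moreover have "G z = (\<Prod>i\<in>insert t N. z i ^ M i) *
          (\<Sum>a\<in>A1. c a * (\<Prod>i\<in>insert t N. inverse (z i) ^ e a i))"
        unfolding G_def using ts z le_M by (intro clear_denominators) auto
      ultimately show False using z(2) by simp
    qed
    have van: "(\<Sum>a\<in>A2. c a * (\<Prod>i\<in>N. inverse (y i) ^ e a i)) = 0"
      if y: "y \<in> L2" "\<And>i. i \<in> N \<Longrightarrow> y i \<noteq> 0" for y
    proof -
      have "0 = G y" using G0 y \<open>L2 \<subseteq> L\<close> by auto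
      also have "\<dots> = (\<Sum>a\<in>A2. c a * (\<Prod>i\<in>insert t N. y i ^ (M i - e a i)))"
        unfolding G_def
      proof (rule sum.mono_neutral_right, goal_cases)
        case 3
        show ?case
        proof
          fix a assume a: "a \<in> A1 - A2"
          then have "e a t < m" using le_m[of a] by (auto simp: A2_def)
          then have "y t = 0" using y by (auto simp: L2_def split: if_splits)
          then have "y t ^ (M t - e a t) = 0" using \<open>e a t < m\<close> by (simp add: M_def)
          then show "c a * (\<Prod>i\<in>insert t N. y i ^ (M i - e a i)) = 0"
            using ts \<open>t \<notin> N\<close> by simp
        qed
      qed (use A1 in \<open>auto simp: A2_def\<close>)
      also have "\<dots> = (\<Sum>a\<in>A2. c a * (\<Prod>i\<in>N. y i ^ (M i - e a i)))"
        using ts \<open>t \<notin> N\<close> by (intro sum.cong) (auto simp: A2_def M_def)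
      also have "\<dots> = (\<Prod>i\<in>N. y i ^ M i) * (\<Sum>a\<in>A2. c a * (\<Prod>i\<in>N. inverse (y i) ^ e a i))"
        using ts y le_M by (intro clear_denominators) (auto simp: A2_def)
      finally show ?thesis using y(2) ts by simp
    qed
    have nb: "\<not> broken N L2 {i \<in> N. e a i > 0}" if a: "a \<in> A2" for a
    proof
      assume br: "broken N L2 {i \<in> N. e a i > 0}"
      have "\<not> broken (insert t N) L {i \<in> insert t N. e a i > 0}"
        using insert.prems(4) a A1 by (auto simp: A2_def)
      moreover have "broken (insert t N) L {i \<in> insert t N. e a i > 0}"
      proof (cases "m = 0")
        case True
        then have "{i \<in> insert t N. e a i > 0} = {i \<in> N. e a i > 0}" using a by (auto simp: A2_def)
        then show ?thesis using br True unfolding L2_def broken_def by auto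
      next
        case False
        then have "{i \<in> insert t N. e a i > 0} - {t} = {i \<in> N. e a i > 0}"
          using \<open>t \<notin> N\<close> by auto
        then show ?thesis
          using br False a ts insert.prems(1) by (intro broken_restrict) (auto simp: L2_def A2_def)
      qed
      ultimately show False by blast
    qed
    have "c b = 0"
    proof (rule insert.IH[OF L2, of A2])
      fix x y assume xy: "x \<in> A2" "y \<in> A2" "\<And>i. i \<in> N \<Longrightarrow> e x i = e y i"
      then show "x = y" using A1 by (intro insert.prems(3)) (auto simp: A2_def)
    qed (use van nb b A1 in \<open>auto simp: A2_def\<close>)
    then show False using b by (auto simp: A2_def A1_def)
  qed
qed

section \<open>Polynomials: evaluation, ideals, reduction\<close>

definition mon_eval :: "(nat \<Rightarrow> 'a::field) \<Rightarrow> (nat \<Rightarrow>\<^sub>0 nat) \<Rightarrow> 'a" where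
  "mon_eval z e = (\<Prod>i\<in>Poly_Mapping.keys e. z i ^ Poly_Mapping.lookup e i)"

definition meval :: "(nat \<Rightarrow> 'a::field) \<Rightarrow> 'a mpol \<Rightarrow> 'a" where
  "meval z p = (\<Sum>e\<in>Poly_Mapping.keys p. Poly_Mapping.lookup p e * mon_eval z e)"

lemma mon_eval_superset:
  "finite N \<Longrightarrow> Poly_Mapping.keys e \<subseteq> N \<Longrightarrow> mon_eval z e = (\<Prod>i\<in>N. z i ^ Poly_Mapping.lookup e i)"
  unfolding mon_eval_def by (rule prod.mono_neutral_left) (auto simp: in_keys_iff)

lemma mon_eval_add: "mon_eval z (a + b) = mon_eval z a * mon_eval z b"
proof -
  define N where "N = Poly_Mapping.keys a \<union> Poly_Mapping.keys b"
  have N: "finite N" "Poly_Mapping.keys a \<subseteq> N" "Poly_Mapping.keys b \<subseteq> N"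
    "Poly_Mapping.keys (a + b) \<subseteq> N"
    using keys_add[of a b] by (auto simp: N_def)
  show ?thesis
    by (simp add: mon_eval_superset[OF N(1)] N lookup_add power_add prod.distrib)
qed

lemma meval_superset:
  "finite A \<Longrightarrow> Poly_Mapping.keys p \<subseteq> A \<Longrightarrow>
    meval z p = (\<Sum>e\<in>A. Poly_Mapping.lookup p e * mon_eval z e)"
  unfolding meval_def by (rule sum.mono_neutral_left) (auto simp: in_keys_iff)

lemma meval_add: "meval z (p + q) = meval z p + meval z q"
proof -
  define N where "N = Poly_Mapping.keys p \<union> Poly_Mapping.keys q"
  have N: "finite N" "Poly_Mapping.keys p \<subseteq> N" "Poly_Mapping.keys q \<subseteq> N"
    "Poly_Mapping.keys (p + q) \<subseteq> N"
    using keys_add[of p q] by (auto simp: N_def)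
  show ?thesis
    by (simp add: meval_superset[OF N(1)] N lookup_add distrib_right sum.distrib)
qed

lemma meval_zero [simp]: "meval z 0 = 0"
  by (simp add: meval_def)

lemma meval_sum: "meval z (\<Sum>a\<in>A. f a) = (\<Sum>a\<in>A. meval z (f a))"
  by (induction A rule: infinite_finite_induct) (auto simp: meval_add)

lemma meval_single [simp]: "meval z (Poly_Mapping.single e c) = c * mon_eval z e"
  by (subst meval_superset[of "{e}"]) auto

lemma mpol_sum_singles:
  "p = (\<Sum>e\<in>Poly_Mapping.keys p. Poly_Mapping.single e (Poly_Mapping.lookup p e))"
proof (rule poly_mapping_eqI)
  fix e
  show "Poly_Mapping.lookup p e = Poly_Mapping.lookup (\<Sum>e\<in>Poly_Mapping.keys p.
      Poly_Mapping.single e (Poly_Mapping.lookup p e)) e"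
    by (auto simp: lookup_sum lookup_single when_def in_keys_iff)
qed

lemma meval_mult: "meval z (p * q) = meval z p * meval z q"
proof -
  have "p * q = (\<Sum>a\<in>Poly_Mapping.keys p. \<Sum>b\<in>Poly_Mapping.keys q.
      Poly_Mapping.single (a + b) (Poly_Mapping.lookup p a * Poly_Mapping.lookup q b))"
    by (subst mpol_sum_singles[of p], subst mpol_sum_singles[of q])
      (simp only: sum_product mult_single)
  then have "meval z (p * q) = (\<Sum>a\<in>Poly_Mapping.keys p. \<Sum>b\<in>Poly_Mapping.keys q.
      (Poly_Mapping.lookup p a * mon_eval z a) * (Poly_Mapping.lookup q b * mon_eval z b))"
    by (simp add: meval_sum mon_eval_add mult_ac)
  then show ?thesis by (simp add: meval_def sum_product)
qed

lemma mon_eval_zero [simp]: "mon_eval z 0 = 1"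
  by (simp add: mon_eval_def)

lemma meval_Const [simp]: "meval z (Const c) = c"
  by (simp add: Const_def)

lemma meval_Var [simp]: "meval z (Var i) = z i"
  by (simp add: Var_def mon_eval_def)

lemma meval_one [simp]: "meval z 1 = 1"
  using meval_single[of z 0 1] by simp

interpretation meval: comm_ring_hom "meval z" for z :: "nat \<Rightarrow> 'a::field"
  by unfold_locales (auto simp: meval_add meval_mult)

interpretation Const: comm_ring_hom "Const :: 'a::field \<Rightarrow> 'a mpol"
  by unfold_locales (auto simp: Const_def single_add mult_single)

section \<open>Closure properties and ideals of the polynomial ring\<close>

lemma carrier_mpol_ring:
  "carrier (mpol_ring V) = {p. \<forall>e\<in>Poly_Mapping.keys p. Poly_Mapping.keys e \<subseteq> V}"
  by (simp add: mpol_ring_def)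

lemma mpol_ring_simps [simp]:
  "x \<otimes>\<^bsub>mpol_ring V\<^esub> y = x * y" "x \<oplus>\<^bsub>mpol_ring V\<^esub> y = x + y"
  "\<zero>\<^bsub>mpol_ring V\<^esub> = 0" "\<one>\<^bsub>mpol_ring V\<^esub> = 1"
  by (simp_all add: mpol_ring_def)

lemma mpol_closed_zero [simp]: "0 \<in> carrier (mpol_ring V)"
  and mpol_closed_one [simp]: "1 \<in> carrier (mpol_ring V)"
  and mpol_closed_single: "Poly_Mapping.keys e \<subseteq> V \<Longrightarrow> Poly_Mapping.single e c \<in> carrier (mpol_ring V)"
  and mpol_closed_Const [simp]: "Const c \<in> carrier (mpol_ring V)"
  and mpol_closed_Var: "i \<in> V \<Longrightarrow> Var i \<in> carrier (mpol_ring V)"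
  and mpol_closed_uminus: "p \<in> carrier (mpol_ring V) \<Longrightarrow> - p \<in> carrier (mpol_ring V)"
  by (auto simp: carrier_mpol_ring Const_def Var_def in_keys_iff lookup_single)

lemma mpol_closed_add:
    "p \<in> carrier (mpol_ring V) \<Longrightarrow> q \<in> carrier (mpol_ring V) \<Longrightarrow> p + q \<in> carrier (mpol_ring V)"
  and mpol_closed_mult:
    "p \<in> carrier (mpol_ring V) \<Longrightarrow> q \<in> carrier (mpol_ring V) \<Longrightarrow> p * q \<in> carrier (mpol_ring V)"
proof -
  interpret cring "mpol_ring V :: 'a mpol ring" by (rule cring_mpol_ring)
  show "p \<in> carrier (mpol_ring V) \<Longrightarrow> q \<in> carrier (mpol_ring V) \<Longrightarrow> p + q \<in> carrier (mpol_ring V)"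
    using a_closed[of p q] by simp
  show "p \<in> carrier (mpol_ring V) \<Longrightarrow> q \<in> carrier (mpol_ring V) \<Longrightarrow> p * q \<in> carrier (mpol_ring V)"
    using m_closed[of p q] by simp
qed

lemma mpol_closed_diff:
  "p \<in> carrier (mpol_ring V) \<Longrightarrow> q \<in> carrier (mpol_ring V) \<Longrightarrow> p - q \<in> carrier (mpol_ring V)"
  using mpol_closed_add[of p V "- q"] mpol_closed_uminus[of q V] by simp

lemma mpol_closed_sum:
  "(\<And>a. a \<in> A \<Longrightarrow> f a \<in> carrier (mpol_ring V)) \<Longrightarrow> (\<Sum>a\<in>A. f a) \<in> carrier (mpol_ring V)"
  by (induction A rule: infinite_finite_induct) (auto intro: mpol_closed_add)

lemma mpol_closed_prod:
  "(\<And>a. a \<in> A \<Longrightarrow> f a \<in> carrier (mpol_ring V)) \<Longrightarrow> (\<Prod>a\<in>A. f a) \<in> carrier (mpol_ring V)"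
  by (induction A rule: infinite_finite_induct) (auto intro: mpol_closed_mult)

lemma mpol_closed_sign: "(of_int (sign p) :: 'a::field mpol) \<in> carrier (mpol_ring V)"
  by (cases p rule: sign_cases) (auto intro: mpol_closed_uminus)

lemma mpol_closed_det:
  assumes "\<And>i j. i < dim_row M \<Longrightarrow> j < dim_col M \<Longrightarrow> M $$ (i, j) \<in> carrier (mpol_ring V)"
  shows "det M \<in> carrier (mpol_ring V)"
proof (cases "dim_row M = dim_col M")
  case True
  have "(\<Prod>i = 0..<dim_row M. M $$ (i, p i)) \<in> carrier (mpol_ring V)" if "p permutes {0..<dim_row M}" for p
    using True permutes_in_image[OF that] by (intro mpol_closed_prod assms) auto
  then show ?thesis
    unfolding det_def using True
    by (auto intro!: mpol_closed_sum mpol_closed_mult mpol_closed_sign)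
qed (simp add: det_def)

lemma mpol_idealI:
  assumes "I \<subseteq> carrier (mpol_ring V)" "0 \<in> I" "\<And>p q. p \<in> I \<Longrightarrow> q \<in> I \<Longrightarrow> p + q \<in> I"
    and "\<And>p q. p \<in> I \<Longrightarrow> q \<in> carrier (mpol_ring V) \<Longrightarrow> q * p \<in> I"
  shows "ideal I (mpol_ring V :: 'a::field mpol ring)"
proof -
  interpret cring "mpol_ring V :: 'a mpol ring" by (rule cring_mpol_ring)
  have neg: "- p \<in> I" if "p \<in> I" for p
    using assms(4)[OF that mpol_closed_uminus[OF mpol_closed_one]] by simp
  show ?thesis
  proof (rule idealI)
    show "subgroup I (add_monoid (mpol_ring V))"
    proof (rule add.subgroupI)
      fix p assume p: "p \<in> I"
      then have "\<ominus>\<^bsub>mpol_ring V\<^esub> p = - p"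
        using assms(1) neg[OF p] by (intro minus_equality) auto
      then show "\<ominus>\<^bsub>mpol_ring V\<^esub> p \<in> I" using neg[OF p] by simp
    qed (use assms in auto)
  qed (use assms ring_axioms in \<open>auto simp: mult.commute\<close>)
qed

context
  fixes I :: "'a::field mpol set" and V
  assumes I: "ideal I (mpol_ring V)"
begin

lemma mpol_ideal_carrier: "p \<in> I \<Longrightarrow> p \<in> carrier (mpol_ring V)"
  using ideal.Icarr[OF I] .

lemma mpol_ideal_zero: "0 \<in> I"
  using additive_subgroup.zero_closed[OF ideal.axioms(1)[OF I]] by simp

lemma mpol_ideal_add: "p \<in> I \<Longrightarrow> q \<in> I \<Longrightarrow> p + q \<in> I"
  using additive_subgroup.a_closed[OF ideal.axioms(1)[OF I], of p q] by simp

lemma mpol_ideal_mult: "p \<in> I \<Longrightarrow> q \<in> carrier (mpol_ring V) \<Longrightarrow> q * p \<in> I"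
  using ideal.I_l_closed[OF I, of p q] by simp

lemma mpol_ideal_diff: "p \<in> I \<Longrightarrow> q \<in> I \<Longrightarrow> p - q \<in> I"
  using mpol_ideal_add[OF _ mpol_ideal_mult[OF _ mpol_closed_uminus[OF mpol_closed_one]], of p q]
  by simp

lemma mpol_ideal_sum: "(\<And>a. a \<in> A \<Longrightarrow> f a \<in> I) \<Longrightarrow> (\<Sum>a\<in>A. f a) \<in> I"
  by (induction A rule: infinite_finite_induct) (auto intro: mpol_ideal_add mpol_ideal_zero)

lemma mpol_genideal_subset: "S \<subseteq> I \<Longrightarrow> Idl\<^bsub>mpol_ring V\<^esub> S \<subseteq> I"
  by (rule ring.genideal_minimal[OF cring.axioms(1)[OF cring_mpol_ring] I])

end

lemma mpol_genideal_ideal: "S \<subseteq> carrier (mpol_ring V) \<Longrightarrow> ideal (Idl\<^bsub>mpol_ring V\<^esub> S) (mpol_ring V)"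
  by (rule ring.genideal_ideal[OF cring.axioms(1)[OF cring_mpol_ring]])

lemma mpol_genideal_self: "S \<subseteq> carrier (mpol_ring V) \<Longrightarrow> S \<subseteq> Idl\<^bsub>mpol_ring V\<^esub> S"
  by (rule ring.genideal_self[OF cring.axioms(1)[OF cring_mpol_ring]])

section \<open>Vanishing ideals, prime ideals and radicals\<close>

definition vanishing_ideal :: "nat set \<Rightarrow> (nat \<Rightarrow> 'a::field) set \<Rightarrow> 'a mpol set" where
  "vanishing_ideal V Z = {p \<in> carrier (mpol_ring V). \<forall>z\<in>Z. meval z p = 0}"

lemma ideal_vanishing_ideal: "ideal (vanishing_ideal V Z) (mpol_ring V)"
  by (rule mpol_idealI)
    (auto simp: vanishing_ideal_def meval_add meval_mult intro: mpol_closed_add mpol_closed_mult)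

text \<open>The second hypothesis is the irreducibility of \<open>Z\<close>, phrased as the meeting
  of two nonempty open sets.\<close>

lemma primeideal_vanishing_ideal:
  assumes "Z \<noteq> {}"
    and "\<And>p q. \<lbrakk>p \<in> carrier (mpol_ring V); q \<in> carrier (mpol_ring V);
      \<exists>z\<in>Z. meval z p \<noteq> 0; \<exists>z\<in>Z. meval z q \<noteq> 0\<rbrakk> \<Longrightarrow> \<exists>z\<in>Z. meval z p \<noteq> 0 \<and> meval z q \<noteq> 0"
  shows "primeideal (vanishing_ideal V Z) (mpol_ring V)"
proof (rule primeidealI[OF ideal_vanishing_ideal cring_mpol_ring])
  have "1 \<notin> vanishing_ideal V Z" using assms(1) by (auto simp: vanishing_ideal_def)
  then show "carrier (mpol_ring V) \<noteq> vanishing_ideal V Z" using mpol_closed_one by metis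
next
  fix p q assume *: "p \<in> carrier (mpol_ring V)" "q \<in> carrier (mpol_ring V)"
    "p \<otimes>\<^bsub>mpol_ring V\<^esub> q \<in> vanishing_ideal V Z"
  then have "\<forall>z\<in>Z. meval z p = 0 \<or> meval z q = 0"
    by (auto simp: vanishing_ideal_def meval_mult)
  with assms(2)[OF *(1,2)] * show "p \<in> vanishing_ideal V Z \<or> q \<in> vanishing_ideal V Z"
    unfolding vanishing_ideal_def by blast
qed

lemma (in primeideal) pow_mem_imp_mem:
  "a \<in> carrier R \<Longrightarrow> a [^] (k::nat) \<in> I \<Longrightarrow> a \<in> I"
proof (induction k)
  case 0
  then have "\<one> \<in> I" by simp
  then show ?case using I_notcarr one_imp_carrier by blast
next
  case (Suc k)
  then show ?case using I_prime[of "a [^] k" a] by auto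
qed

lemma primary_ideal_if_primeideal:
  assumes "primeideal I R"
  shows "primary_ideal R I"
proof -
  interpret primeideal I R by fact
  have "b \<in> radical R I" if "b \<in> I" for b
    unfolding radical_def using that Icarr by (auto intro!: exI[of _ "1::nat"])
  then show ?thesis
    unfolding primary_ideal_def using I_prime I_notcarr is_ideal by metis
qed

lemma radical_ideal_Inter:
  assumes "ideal I R" "I = carrier R \<inter> \<Inter>S" "\<And>J. J \<in> S \<Longrightarrow> primeideal J R"
  shows "radical_ideal R I"
proof -
  interpret ideal I R by fact
  have "a \<in> I" if a: "a \<in> carrier R" "a [^]\<^bsub>R\<^esub> (m::nat) \<in> I" for a m
    using a assms(2) primeideal.pow_mem_imp_mem[OF assms(3) a(1)] by blast
  moreover have "a \<in> radical R I" if "a \<in> I" for a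
    unfolding radical_def using that Icarr by (auto intro!: exI[of _ "1::nat"])
  ultimately have "radical R I = I" unfolding radical_def by blast
  then show ?thesis using assms(1) unfolding radical_ideal_def by blast
qed

section \<open>Rewriting modulo an ideal along a weight\<close>

definition wt :: "(nat \<Rightarrow>\<^sub>0 nat) \<Rightarrow> nat" where
  "wt e = (\<Sum>k\<in>Poly_Mapping.keys e. k * Poly_Mapping.lookup e k)"

lemma wt_superset:
  "finite N \<Longrightarrow> Poly_Mapping.keys e \<subseteq> N \<Longrightarrow> wt e = (\<Sum>k\<in>N. k * Poly_Mapping.lookup e k)"
  unfolding wt_def by (rule sum.mono_neutral_left) (auto simp: in_keys_iff)

lemma wt_add: "wt (a + b) = wt a + wt b"
proof -
  define N where "N = Poly_Mapping.keys a \<union> Poly_Mapping.keys b"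
  have N: "finite N" "Poly_Mapping.keys a \<subseteq> N" "Poly_Mapping.keys b \<subseteq> N"
    "Poly_Mapping.keys (a + b) \<subseteq> N"
    using keys_add[of a b] by (auto simp: N_def)
  show ?thesis
    by (simp add: wt_superset[OF N(1)] N lookup_add distrib_left sum.distrib)
qed

lemma wt_single [simp]: "wt (Poly_Mapping.single i k) = i * k"
  by (simp add: wt_def)

text \<open>Division without a monomial order. Distinct monomials may have equal weight, but a
  relation for \<open>a\<close> has only strictly lighter monomials besides \<open>a\<close>, so
  rewriting one monomial at a time terminates by induction on the weight.\<close>

lemma reduce_mod_ideal:
  fixes I :: "'a::field mpol set"
  assumes I: "ideal I (mpol_ring V)"
    and lead: "\<And>a. bad a \<Longrightarrow> Poly_Mapping.keys a \<subseteq> V \<Longrightarrow>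
      \<exists>p\<in>I. Poly_Mapping.lookup p a = 1 \<and> (\<forall>e\<in>Poly_Mapping.keys p. e \<noteq> a \<longrightarrow> wt e < wt a)"
    and f: "f \<in> carrier (mpol_ring V)"
  shows "\<exists>g\<in>carrier (mpol_ring V). f - g \<in> I \<and> (\<forall>e\<in>Poly_Mapping.keys g. \<not> bad e)"
proof -
  define P where "P = (\<lambda>f. \<exists>g\<in>carrier (mpol_ring V). f - g \<in> I \<and> (\<forall>e\<in>Poly_Mapping.keys g. \<not> bad e))"
  have P0: "P 0" unfolding P_def using mpol_ideal_zero[OF I] by (intro bexI[of _ 0]) auto
  have Padd: "P (f1 + f2)" if "P f1" "P f2" for f1 f2
  proof -
    obtain g1 g2 where g: "g1 \<in> carrier (mpol_ring V)" "f1 - g1 \<in> I" "\<forall>e\<in>Poly_Mapping.keys g1. \<not> bad e"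
      "g2 \<in> carrier (mpol_ring V)" "f2 - g2 \<in> I" "\<forall>e\<in>Poly_Mapping.keys g2. \<not> bad e"
      using \<open>P f1\<close> \<open>P f2\<close> unfolding P_def by blast
    have "(f1 + f2) - (g1 + g2) \<in> I"
      using mpol_ideal_add[OF I g(2,5)] by (simp add: algebra_simps)
    then show ?thesis unfolding P_def using g keys_add[of g1 g2]
      by (intro bexI[of _ "g1 + g2"]) (auto intro: mpol_closed_add)
  qed
  have Psum: "(\<And>a. a \<in> A \<Longrightarrow> P (h a)) \<Longrightarrow> P (sum h A)" for A :: "(nat \<Rightarrow>\<^sub>0 nat) set" and h
    by (induction A rule: infinite_finite_induct) (auto intro: P0 Padd)
  have mono: "P (Poly_Mapping.single a c)" if "Poly_Mapping.keys a \<subseteq> V" for a c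
    using that
  proof (induction "wt a" arbitrary: a c rule: less_induct)
    case less
    show ?case
    proof (cases "bad a")
      case False
      then show ?thesis unfolding P_def using less.prems mpol_ideal_zero[OF I]
        by (intro bexI[of _ "Poly_Mapping.single a c"] mpol_closed_single) auto
    next
      case True
      from lead[OF this less.prems] obtain p where p: "p \<in> I" "Poly_Mapping.lookup p a = 1"
        "\<And>e. e \<in> Poly_Mapping.keys p \<Longrightarrow> e \<noteq> a \<Longrightarrow> wt e < wt a" by auto
      have cp: "Const c * p \<in> I" using mpol_ideal_mult[OF I p(1)] by simp
      \<comment> \<open>The subtraction cancels \<open>a\<close> exactly, so only monomials of
        smaller weight remain for the induction hypothesis.\<close>
      define q where "q = Poly_Mapping.single a c - Const c * p"
      have lq: "Poly_Mapping.lookup q e = (if e = a then 0 else - c * Poly_Mapping.lookup p e)" for e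
      proof -
        have "Poly_Mapping.lookup (Const c * p) e = c * Poly_Mapping.lookup p e"
          unfolding Const_def mult_map_scale_conv_mult[symmetric]
          by transfer (auto simp: when_def)
        then show ?thesis by (auto simp: q_def lookup_minus lookup_single p(2))
      qed
      have "P (Poly_Mapping.single e (Poly_Mapping.lookup q e))" if e: "e \<in> Poly_Mapping.keys q" for e
      proof -
        have "e \<noteq> a" "e \<in> Poly_Mapping.keys p" using e by (auto simp: in_keys_iff lq split: if_splits)
        then show ?thesis using p(3) mpol_ideal_carrier[OF I p(1)]
          by (intro less.hyps) (auto simp: carrier_mpol_ring)
      qed
      then have "P q" by (subst mpol_sum_singles[of q]) (rule Psum)
      moreover have "P (Const c * p)"
        unfolding P_def using cp by (intro bexI[of _ 0]) auto
      ultimately have "P (q + Const c * p)" by (rule Padd)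
      then show ?thesis by (simp add: q_def)
    qed
  qed
  have "P f"
    using f by (subst mpol_sum_singles[of f]) (auto intro!: Psum mono simp: carrier_mpol_ring)
  then show ?thesis by (simp add: P_def)
qed

section \<open>Determinants\<close>

text \<open>An element is recovered from its rank, so a finite set has only one increasing
  enumeration. This serves to compute \<open>pick\<close> on sets obtained by inserting or deleting
  an element.\<close>

lemma pick_eqI:
  assumes "\<And>a b. a < b \<Longrightarrow> b < m \<Longrightarrow> f a < f b" and "f ` {..<m} = S" and "a < (m::nat)"
  shows "pick S a = f a"
proof -
  have "{x \<in> S. x < f a} = f ` {..<a}"
  proof
    show "{x \<in> S. x < f a} \<subseteq> f ` {..<a}"
    proof
      fix x assume "x \<in> {x \<in> S. x < f a}"
      then obtain b where b: "b < m" "x = f b" "f b < f a" using assms(2) by auto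
      then have "b < a" using assms(1)[of a b] by (metis less_asym' not_less_iff_gr_or_eq)
      then show "x \<in> f ` {..<a}" using b by auto
    qed
    show "f ` {..<a} \<subseteq> {x \<in> S. x < f a}" using assms by auto
  qed
  moreover have "inj_on f {..<a}"
  proof (rule inj_onI)
    fix x y assume "x \<in> {..<a}" "y \<in> {..<a}" "f x = f y"
    then show "x = y" using assms(1)[of x y] assms(1)[of y x] assms(3)
      by (cases x y rule: linorder_cases) auto
  qed
  ultimately have "card {x \<in> S. x < f a} = a" by (simp add: card_image)
  moreover have "f a \<in> S" using assms by auto
  ultimately show ?thesis using pick_card_in_set[of "f a" S] by simp
qed

lemma pick_lessThan: "a < n \<Longrightarrow> pick {..<n} a = a"
  by (rule pick_eqI[of n "\<lambda>x. x"]) auto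

lemma bij_betw_pick: "finite S \<Longrightarrow> bij_betw (pick S) {..<card S} S"
proof -
  assume "finite S"
  have "inj_on (pick S) {..<card S}"
    by (rule inj_onI) (metis card_pick_le lessThan_iff)
  moreover have "pick S ` {..<card S} \<subseteq> S" using pick_in_set_le by auto
  ultimately show ?thesis
    using \<open>finite S\<close> by (simp add: bij_betw_def card_image card_subset_eq)
qed

lemma sorted_list_of_set_nth:
  assumes "finite S" "a < card S"
  shows "sorted_list_of_set S ! a = pick S a"
proof (rule pick_eqI[symmetric])
  show "sorted_list_of_set S ! i < sorted_list_of_set S ! j" if "i < j" "j < card S" for i j
    using sorted_wrt_nth_less[OF strict_sorted_list_of_set] that by simp
  have "(!) (sorted_list_of_set S) ` {..<length (sorted_list_of_set S)} = set (sorted_list_of_set S)"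
    by (auto simp: set_conv_nth)
  then show "(!) (sorted_list_of_set S) ` {..<card S} = S" using assms by simp
qed fact

lemma submatrix_eq_mat:
  assumes "I \<subseteq> {..<dim_row A}" "J \<subseteq> {..<dim_col A}"
  shows "submatrix A I J = mat (card I) (card J) (\<lambda>(a, b). A $$ (pick I a, pick J b))"
proof -
  have "{i. i < dim_row A \<and> i \<in> I} = I" "{j. j < dim_col A \<and> j \<in> J} = J" using assms by auto
  then show ?thesis by (simp add: submatrix_def)
qed

text \<open>A repeated column gives determinant 0. Otherwise \<open>f\<close> is the increasing
  enumeration of its image up to a permutation, which changes the minor by a sign. The columns are
  written as rows of the transpose to fit the row expansion of the next lemma.\<close>

lemma det_selected_columns_in_ideal:
  fixes B :: "'a::field mpol mat"
  assumes I: "ideal I (mpol_ring V)" and B: "B \<in> carrier_mat n m"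
    and minors: "\<And>J. J \<subseteq> {..<m} \<Longrightarrow> card J = n \<Longrightarrow> det (submatrix B {..<n} J) \<in> I"
    and f: "\<And>i. i < n \<Longrightarrow> f i < m"
  shows "det (mat\<^sub>r n n (\<lambda>i. row B\<^sup>T (f i))) \<in> I"
proof (cases "inj_on f {..<n}")
  case False
  then obtain i j where ij: "i < n" "j < n" "i \<noteq> j" "f i = f j" by (auto simp: inj_on_def)
  have "det (mat\<^sub>r n n (\<lambda>i. row B\<^sup>T (f i))) = 0"
    by (rule det_identical_rows[of _ n i j]) (use ij B f in auto)
  then show ?thesis using mpol_ideal_zero[OF I] by simp
next
  case True
  define J where "J = f ` {..<n}"
  have J: "J \<subseteq> {..<m}" "card J = n" "finite J" using f True by (auto simp: J_def card_image)
  \<comment> \<open>The rank of \<open>f i\<close> in \<open>J\<close>, so that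
    \<open>pick J\<close> undoes it; outside the index range \<open>p\<close> is the identity, as
    \<open>permutes\<close> demands.\<close>
  define p where "p = (\<lambda>i. if i < n then card {a \<in> J. a < f i} else i)"
  have pick_p: "pick J (p i) = f i" if "i < n" for i
    unfolding p_def using that by (auto simp: J_def intro!: pick_card_in_set)
  have p_less: "p i < n" if "i < n" for i
  proof -
    have "{a \<in> J. a < f i} \<subset> J" using that by (auto simp: J_def)
    then show ?thesis using psubset_card_mono[OF J(3)] J(2) that by (auto simp: p_def)
  qed
  have "inj_on p {..<n}"
    using True pick_p unfolding inj_on_def by (metis lessThan_iff)
  moreover have "p ` {..<n} \<subseteq> {..<n}" using p_less by auto
  ultimately have "bij_betw p {..<n} {..<n}"
    by (simp add: bij_betw_def endo_inj_surj)
  then have p: "p permutes {0..<n}"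
    by (intro bij_imp_permutes) (auto simp: p_def lessThan_atLeast0)
  define M where "M = (submatrix B {..<n} J)\<^sup>T"
  have sub: "submatrix B {..<n} J = mat n n (\<lambda>(a, b). B $$ (pick {..<n} a, pick J b))"
    using B J by (subst submatrix_eq_mat) auto
  then have M: "M \<in> carrier_mat n n" by (simp add: M_def)
  have "mat\<^sub>r n n (\<lambda>i. row B\<^sup>T (f i)) = mat n n (\<lambda>(i, j). M $$ (p i, j))"
    by (rule eq_matI) (use B f pick_p p_less in \<open>auto simp: M_def sub pick_lessThan\<close>)
  then have "det (mat\<^sub>r n n (\<lambda>i. row B\<^sup>T (f i))) = signof p * det M"
    using det_permute_rows[OF M p] by simp
  also have "det M = det (submatrix B {..<n} J)"
    unfolding M_def by (rule det_transpose[of _ n]) (simp add: sub)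
  finally show ?thesis
    using mpol_ideal_mult[OF I minors[OF J(1,2)]] mpol_closed_sign by auto
qed

text \<open>Half of the Cauchy-Binet formula: expanding every column of the product multilinearly
  gives a combination of determinants of selected columns of \<open>B\<close>, where
  \<open>f\<close> runs over all selections, including those with repetitions.\<close>

lemma det_column_combination_in_ideal:
  fixes B X :: "'a::field mpol mat"
  assumes I: "ideal I (mpol_ring V)" and B: "B \<in> carrier_mat n m" and X: "X \<in> carrier_mat m n"
    and minors: "\<And>J. J \<subseteq> {..<m} \<Longrightarrow> card J = n \<Longrightarrow> det (submatrix B {..<n} J) \<in> I"
    and X_carrier: "\<And>i j. i < m \<Longrightarrow> j < n \<Longrightarrow> X $$ (i, j) \<in> carrier (mpol_ring V)"
  shows "det (B * X) \<in> I"
proof -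
  let ?F = "{f. (\<forall>i\<in>{0..<n}. f i \<in> {0..<m}) \<and> (\<forall>i. i \<notin> {0..<n} \<longrightarrow> f i = i)}"
  have "det (B * X) = det ((B * X)\<^sup>T)" using B X by (intro det_transpose[symmetric]) auto
  also have "(B * X)\<^sup>T = X\<^sup>T * B\<^sup>T" using B X by (rule transpose_mult)
  also have "\<dots> = mat\<^sub>r n n (\<lambda>i. finsum_vec TYPE('a mpol) n (\<lambda>k. X\<^sup>T $$ (i, k) \<cdot>\<^sub>v row B\<^sup>T k) {0..<m})"
    using B X by (intro mat_mul_finsum_alt) auto
  also have "det \<dots> = (\<Sum>f\<in>?F. det (mat\<^sub>r n n (\<lambda>i. X\<^sup>T $$ (i, f i) \<cdot>\<^sub>v row B\<^sup>T (f i))))"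
    using B by (intro det_linear_rows_sum) auto
  also have "\<dots> = (\<Sum>f\<in>?F. (\<Prod>i\<in>{0..<n}. X\<^sup>T $$ (i, f i)) * det (mat\<^sub>r n n (\<lambda>i. row B\<^sup>T (f i))))"
    using B by (intro sum.cong refl det_rows_mul) auto
  also have "\<dots> \<in> I"
    using X_carrier X det_selected_columns_in_ideal[OF I B minors]
    by (intro mpol_ideal_sum[OF I] mpol_ideal_mult[OF I] mpol_closed_prod) auto
  finally show ?thesis .
qed

text \<open>The matrix determinant lemma, carried out over an integral domain without inverting the
  diagonal. The bordered matrix \<open>N\<close> is evaluated once by a row operation, which gives
  \<open>det W\<close>, and once by a column operation.\<close>

lemma det_diag_minus_rank_one:
  fixes T c :: "nat \<Rightarrow> 'a::idom"
  assumes T: "\<And>i. i < n \<Longrightarrow> T i \<noteq> 0"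
  shows "det (mat n n (\<lambda>(i, j). (if i = j then T i else 0) - s * c i)) =
    (\<Prod>i<n. T i) - s * (\<Sum>i<n. c i * (\<Prod>k\<in>{..<n} - {i}. T k))"
proof -
  define W where "W = mat n n (\<lambda>(i, j). (if i = j then T i else 0) - s * c i)"
  define D where "D = mat n n (\<lambda>(i, j). if i = j then T i else 0)"
  define one_row where "one_row = mat 1 n (\<lambda>_. 1 :: 'a)"
  define c_col where "c_col = mat n 1 (\<lambda>(i, j). s * c i)"
  define P where "P = (\<Prod>i<n. T i)"
  define Q where "Q = (\<lambda>i. \<Prod>k\<in>{..<n} - {i}. T k)"
  define d_col where "d_col = mat n 1 (\<lambda>(i, j). - (s * c i * Q i))"
  have TQ: "T i * Q i = P" if "i < n" for i
    unfolding P_def Q_def using that by (simp add: prod.remove)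
  have [simp]: "W \<in> carrier_mat n n" "D \<in> carrier_mat n n" "one_row \<in> carrier_mat 1 n"
    "c_col \<in> carrier_mat n 1" "d_col \<in> carrier_mat n 1"
    "one_row \<in> carrier_mat (Suc 0) n" "c_col \<in> carrier_mat n (Suc 0)" "d_col \<in> carrier_mat n (Suc 0)"
    by (auto simp: W_def D_def one_row_def c_col_def d_col_def)
  define N where "N = four_block_mat (1\<^sub>m 1) one_row c_col D"
  have "four_block_mat (1\<^sub>m 1) (0\<^sub>m 1 n) c_col (1\<^sub>m n) * four_block_mat (1\<^sub>m 1) one_row (0\<^sub>m n 1) W
    = four_block_mat (1\<^sub>m 1 * 1\<^sub>m 1 + 0\<^sub>m 1 n * 0\<^sub>m n 1) (1\<^sub>m 1 * one_row + 0\<^sub>m 1 n * W)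
        (c_col * 1\<^sub>m 1 + 1\<^sub>m n * 0\<^sub>m n 1) (c_col * one_row + 1\<^sub>m n * W)"
    by (rule mult_four_block_mat[where ?nr1.0 = 1 and ?n1.0 = 1 and ?n2.0 = n and ?nr2.0 = n and ?nc1.0 = 1 and ?nc2.0 = n]) auto
  also have "c_col * one_row + 1\<^sub>m n * W = D"
    by (rule eq_matI) (auto simp: c_col_def one_row_def W_def D_def scalar_prod_def)
  also have "1\<^sub>m 1 * 1\<^sub>m 1 + 0\<^sub>m 1 n * 0\<^sub>m n 1 = (1\<^sub>m 1 :: 'a mat)"
    by (rule eq_matI) auto
  also have "1\<^sub>m 1 * one_row + 0\<^sub>m 1 n * W = one_row"
    by (rule eq_matI) (auto simp: one_row_def W_def)
  also have "c_col * 1\<^sub>m 1 + 1\<^sub>m n * 0\<^sub>m n 1 = c_col"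
    by (rule eq_matI) (auto simp: c_col_def)
  finally have "N = four_block_mat (1\<^sub>m 1) (0\<^sub>m 1 n) c_col (1\<^sub>m n) * four_block_mat (1\<^sub>m 1) one_row (0\<^sub>m n 1) W"
    by (simp add: N_def)
  also have "det \<dots> = det (four_block_mat (1\<^sub>m 1) (0\<^sub>m 1 n) c_col (1\<^sub>m n)) *
      det (four_block_mat (1\<^sub>m 1) one_row (0\<^sub>m n 1) W)"
    by (intro det_mult[of _ "1 + n"] four_block_carrier_mat) auto
  also have "\<dots> = det W"
    by (simp add: det_four_block_mat_upper_right_zero[of _ 1 _ n] det_four_block_mat_lower_left_zero[of _ 1 _ n])
  finally have detN: "det N = det W" .
  \<comment> \<open>Clearing \<open>c_col\<close> below the corner would require dividing by each
    \<open>T i\<close>. Scaling the first column by \<open>P\<close> avoids this, since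
    \<open>P\<close> is \<open>T i * Q i\<close>. The price is a factor \<open>P\<close> on both
    sides, which is cancelled at the end.\<close>
  have "N * four_block_mat (P \<cdot>\<^sub>m 1\<^sub>m 1) (0\<^sub>m 1 n) d_col (1\<^sub>m n) =
    four_block_mat (1\<^sub>m 1 * (P \<cdot>\<^sub>m 1\<^sub>m 1) + one_row * d_col) (1\<^sub>m 1 * 0\<^sub>m 1 n + one_row * 1\<^sub>m n)
        (c_col * (P \<cdot>\<^sub>m 1\<^sub>m 1) + D * d_col) (c_col * 0\<^sub>m 1 n + D * 1\<^sub>m n)"
    unfolding N_def by (rule mult_four_block_mat[where ?nr1.0 = 1 and ?n1.0 = 1 and ?n2.0 = n and ?nr2.0 = n and ?nc1.0 = 1 and ?nc2.0 = n]) auto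
  also have "c_col * (P \<cdot>\<^sub>m 1\<^sub>m 1) + D * d_col = 0\<^sub>m n 1"
  proof (rule eq_matI)
    fix i j assume "i < dim_row (0\<^sub>m n 1 :: 'a mat)" "j < dim_col (0\<^sub>m n 1 :: 'a mat)"
    then have ij: "i < n" "j = 0" by auto
    have "(D * d_col) $$ (i, 0) = (\<Sum>k = 0..<n. (if i = k then T i else 0) * - (s * c k * Q k))"
      using ij by (simp add: D_def d_col_def scalar_prod_def)
    also have "\<dots> = (\<Sum>k = 0..<n. if i = k then - (T i * (s * c i * Q i)) else 0)"
      by (intro sum.cong) auto
    also have "\<dots> = - (s * c i * (T i * Q i))" using ij by (simp add: mult_ac)
    also have "\<dots> = - (s * c i * P)" using TQ ij by simp
    finally have "(D * d_col) $$ (i, 0) = - (s * c i * P)" .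
    moreover have "(c_col * (P \<cdot>\<^sub>m 1\<^sub>m 1)) $$ (i, 0) = s * c i * P"
      using ij by (simp add: c_col_def scalar_prod_def)
    ultimately show "(c_col * (P \<cdot>\<^sub>m 1\<^sub>m 1) + D * d_col) $$ (i, j) = 0\<^sub>m n 1 $$ (i, j)"
      using ij by (simp add: D_def d_col_def)
  qed (auto simp: D_def d_col_def c_col_def)
  also have "det (four_block_mat (1\<^sub>m 1 * (P \<cdot>\<^sub>m 1\<^sub>m 1) + one_row * d_col) (1\<^sub>m 1 * 0\<^sub>m 1 n + one_row * 1\<^sub>m n)
        (0\<^sub>m n 1) (c_col * 0\<^sub>m 1 n + D * 1\<^sub>m n)) =
      det (1\<^sub>m 1 * (P \<cdot>\<^sub>m 1\<^sub>m 1) + one_row * d_col) * det (c_col * 0\<^sub>m 1 n + D * 1\<^sub>m n)"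
    by (rule det_four_block_mat_lower_left_zero)
      (auto simp: D_def one_row_def c_col_def d_col_def)
  also have "det (1\<^sub>m 1 * (P \<cdot>\<^sub>m 1\<^sub>m 1) + one_row * d_col) = P - s * (\<Sum>i<n. c i * Q i)"
    by (subst det_single) (auto simp: one_row_def d_col_def scalar_prod_def sum_negf sum_distrib_left
        mult.assoc lessThan_atLeast0)
  also have "c_col * 0\<^sub>m 1 n + D * 1\<^sub>m n = D" by (rule eq_matI) (auto simp: c_col_def D_def)
  also have "det D = P"
  proof -
    have "det D = prod_list (diag_mat D)"
      by (rule det_upper_triangular[of _ n]) (auto simp: D_def)
    also have "diag_mat D = map T [0..<n]" by (auto simp: diag_mat_def D_def)
    also have "prod_list (map T [0..<n]) = P"
      by (subst prod.distinct_set_conv_list[symmetric]) (auto simp: P_def lessThan_atLeast0)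
    finally show ?thesis .
  qed
  finally have "det (N * four_block_mat (P \<cdot>\<^sub>m 1\<^sub>m 1) (0\<^sub>m 1 n) d_col (1\<^sub>m n)) =
    (P - s * (\<Sum>i<n. c i * Q i)) * P" .
  moreover have "det (N * four_block_mat (P \<cdot>\<^sub>m 1\<^sub>m 1) (0\<^sub>m 1 n) d_col (1\<^sub>m n)) =
      det N * det (four_block_mat (P \<cdot>\<^sub>m 1\<^sub>m 1) (0\<^sub>m 1 n) d_col (1\<^sub>m n))"
    unfolding N_def by (intro det_mult[of _ "1 + n"] four_block_carrier_mat) auto
  moreover have "det (four_block_mat (P \<cdot>\<^sub>m 1\<^sub>m 1) (0\<^sub>m 1 n) d_col (1\<^sub>m n)) = P"
    by (simp add: det_four_block_mat_upper_right_zero[of _ 1 _ n])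
  ultimately have "det W * P = (P - s * (\<Sum>i<n. c i * Q i)) * P" using detN by metis
  moreover have "P \<noteq> 0" using T by (simp add: P_def)
  ultimately show ?thesis by (simp add: W_def P_def Q_def)
qed

section \<open>Circuit polynomials\<close>

text \<open>Coefficients outside \<open>{1..n}\<close> are set to 0, so that the vectors
  \<open>f\<^sub>j\<close> live in one space of functions on \<open>nat\<close>, and equal forms
  among the \<open>F\<^sub>j\<close> have equal vectors.\<close>

definition F_coeff :: "nat \<Rightarrow> (nat \<Rightarrow> nat \<Rightarrow> 'a::field) \<Rightarrow> nat \<Rightarrow> nat \<Rightarrow> 'a" where
  "F_coeff n u j k = (if k \<in> {1..n} then if j \<le> n then if k = j then 1 else 0 else u (j - n) k else 0)"

lemma F_elt_eq: "j \<in> {1..n + r} \<Longrightarrow> F_elt n u j = (\<Sum>k=1..n. Const (F_coeff n u j k) * Var k)"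
proof (cases "j \<le> n")
  case True
  assume "j \<in> {1..n + r}"
  have "(\<Sum>k=1..n. Const (F_coeff n u j k) * Var k) = (\<Sum>k=1..n. if k = j then Var j else 0)"
    using True by (intro sum.cong) (auto simp: F_coeff_def)
  then show ?thesis using True \<open>j \<in> {1..n + r}\<close> by (simp add: F_elt_def)
qed (auto simp: F_elt_def F_coeff_def intro!: sum.cong)

text \<open>In \<open>m_poly\<close> the sign depends on the position of \<open>k\<close> in the
  complement of \<Theta>. Here that position is recovered as the rank of \<open>k\<close>, so that
  the coefficient is attached to \<open>k\<close> and the sum can run over elements instead of
  positions.\<close>

definition m_coeff :: "nat \<Rightarrow> nat \<Rightarrow> (nat \<Rightarrow> nat \<Rightarrow> 'a::field) \<Rightarrow> nat set \<Rightarrow> nat \<Rightarrow> 'a" where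
  "m_coeff n r u \<Theta> k =
     (let D = {1..n + r} - \<Theta> in
       (- 1) ^ sign_exp n (card {l \<in> D. l \<le> n}) (card {l \<in> D. l \<le> k}) k * U_minor n r u (\<Theta> \<union> {k}))"

lemma card_pick_le_Suc: "i < card S \<Longrightarrow> finite S \<Longrightarrow> card {l \<in> S. l \<le> pick S i} = Suc i"
proof -
  assume i: "i < card S" "finite S"
  have "{l \<in> S. l \<le> pick S i} = insert (pick S i) {l \<in> S. l < pick S i}"
    using pick_in_set_le[OF i(1)] by auto
  then show ?thesis using card_pick_le[OF i(1)] i by simp
qed

lemma m_poly_eq:
  assumes \<Theta>: "\<Theta> \<subseteq> {1..n + r}" "card \<Theta> = r - 1" and r: "1 \<le> r"
  shows "m_poly n r u \<Theta> = (\<Sum>k\<in>{1..n + r} - \<Theta>.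
    Const (m_coeff n r u \<Theta> k) * (\<Prod>l\<in>{1..n + r} - \<Theta> - {k}. Var l))"
proof -
  define D where "D = {1..n + r} - \<Theta>"
  have D: "finite D" "card D = n + 1"
    using \<Theta> r finite_subset[OF \<Theta>(1)] by (auto simp: D_def card_Diff_subset)
  define k where "k = (\<lambda>i. sorted_list_of_set D ! (i - 1))"
  have k: "k i = pick D (i - 1)" if "i \<in> {1..n+1}" for i
    unfolding k_def using that D by (intro sorted_list_of_set_nth) auto
  have "bij_betw (\<lambda>i. i - 1) {1..n + 1} {..<n + 1}"
    by (rule bij_betwI[of _ _ _ Suc]) auto
  from bij_betw_trans[OF this] bij_betw_pick[OF D(1)] D(2)
  have "bij_betw (pick D \<circ> (\<lambda>i. i - 1)) {1..n + 1} D" by metis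
  then have bij: "bij_betw k {1..n + 1} D"
    by (rule bij_betw_cong[THEN iffD1, rotated]) (use k in auto)
  have "bij_betw k {i \<in> {1..n + 1}. k i \<le> n} {l \<in> D. l \<le> n}"
    using bij unfolding bij_betw_def by (auto simp: inj_on_def)
  then have h: "card {i \<in> {1..n + 1}. k i \<le> n} = card {l \<in> D. l \<le> n}"
    by (rule bij_betw_same_card)
  have idx: "card {l \<in> D. l \<le> k i} = i" if "i \<in> {1..n + 1}" for i
    using card_pick_le_Suc[of "i - 1" D] that D k[OF that] by auto
  have sgn: "Const ((- 1) ^ e * c) = (- 1) ^ e * Const c" for e and c :: 'a
    by (simp add: Const.hom_mult Const.hom_power Const.hom_uminus)
  have "m_poly n r u \<Theta> = (\<Sum>i=1..n + 1. (- 1) ^ sign_exp n (card {l \<in> D. l \<le> n}) i (k i) *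
      (\<Prod>l\<in>D - {k i}. Var l) * Const (U_minor n r u (\<Theta> \<union> {k i})))"
    unfolding m_poly_def Let_def D_def[symmetric] h[unfolded k_def] k_def ..
  also have "\<dots> = (\<Sum>i=1..n + 1. Const (m_coeff n r u \<Theta> (k i)) * (\<Prod>l\<in>D - {k i}. Var l))"
    unfolding m_coeff_def Let_def D_def[symmetric]
    by (intro sum.cong refl, simp only: idx sgn, simp only: mult_ac)
  also have "\<dots> = (\<Sum>k\<in>D. Const (m_coeff n r u \<Theta> k) * (\<Prod>l\<in>D - {k}. Var l))"
    by (rule sum.reindex_bij_betw[OF bij])
  finally show ?thesis by (simp add: D_def)
qed

text \<open>A term with nonzero coefficient omits only its own variable, hence contains all the
  variables that are divided out. What remains is the same expression over the support of the
  coefficients.\<close>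

lemma h_poly_eq:
  fixes u :: "nat \<Rightarrow> nat \<Rightarrow> 'a::field"
  assumes \<Theta>: "\<Theta> \<subseteq> {1..n + r}" "card \<Theta> = r - 1" and r: "1 \<le> r"
  defines "D' \<equiv> {k \<in> {1..n + r} - \<Theta>. m_coeff n r u \<Theta> k \<noteq> 0}"
  shows "h_poly n r u \<Theta> = (\<Sum>k\<in>D'. Const (m_coeff n r u \<Theta> k) * (\<Prod>l\<in>D' - {k}. Var l))"
proof (rule h_poly_eqI)
  define D where "D = {1..n + r} - \<Theta>"
  have D: "finite D" "D' \<subseteq> D" "finite D'" by (auto simp: D_def D'_def)
  have U0: "U_minor n r u (\<Theta> \<union> {k}) = 0 \<longleftrightarrow> m_coeff n r u \<Theta> k = 0" for k
    by (simp add: m_coeff_def Let_def)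
  have "{k. k \<in> {1..n + r} - \<Theta> \<and> U_minor n r u (\<Theta> \<union> {k}) = 0} = D - D'"
    unfolding U0 by (auto simp: D_def D'_def)
  moreover have "(\<Prod>l\<in>D' - {k}. Var l :: 'a mpol) * (\<Prod>l\<in>D - D'. Var l) = (\<Prod>l\<in>D - {k}. Var l)"
    if "k \<in> D'" for k
    using that D by (subst prod.union_disjoint[symmetric]) (auto intro!: prod.cong)
  moreover have "m_poly n r u \<Theta> = (\<Sum>k\<in>D'. Const (m_coeff n r u \<Theta> k) * (\<Prod>l\<in>D - {k}. Var l))"
    unfolding m_poly_eq[OF assms(1-3)] D_def[symmetric]
    using D by (intro sum.mono_neutral_right) (auto simp: D'_def D_def)
  ultimately show "(\<Sum>k\<in>D'. Const (m_coeff n r u \<Theta> k) * (\<Prod>l\<in>D' - {k}. Var l)) *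
      (\<Prod>k | k \<in> {1..n + r} - \<Theta> \<and> U_minor n r u (\<Theta> \<union> {k}) = 0. Var k) = m_poly n r u \<Theta>"
    by (simp add: sum_distrib_right mult.assoc)
qed

section \<open>Minors of \<open>U\<close> and linear relations among the forms\<close>

lemma U_minor_eq:
  "U_minor n r u \<chi> = det (mat (card {k. k < n \<and> Suc k \<in> \<chi>}) (card {i. i < r \<and> n + Suc i \<notin> \<chi>})
    (\<lambda>(a, b). u (Suc (pick {i. i < r \<and> n + Suc i \<notin> \<chi>} b)) (Suc (pick {k. k < n \<and> Suc k \<in> \<chi>} a))))"
proof -
  define A C where "A = {k. k < n \<and> Suc k \<in> \<chi>}" and "C = {i. i < r \<and> n + Suc i \<notin> \<chi>}"
  have "pick A a < n" if "a < card A" for a using pick_in_set_le[OF that] by (auto simp: A_def)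
  moreover have "pick C b < r" if "b < card C" for b using pick_in_set_le[OF that] by (auto simp: C_def)
  ultimately have "submatrix (U_mat n r u) A C =
      mat (card A) (card C) (\<lambda>(a, b). u (Suc (pick C b)) (Suc (pick A a)))"
    by (subst submatrix_eq_mat) (auto simp: U_mat_def A_def C_def intro!: cong_mat)
  then show ?thesis by (simp add: U_minor_def A_def C_def)
qed

text \<open>Each index above \<open>n\<close> is either an element of \<chi> or a column of the
  minor. Hence the minor is square if \<chi> has \<open>r\<close> elements, and a set with
  \<open>r - 1\<close> elements leaves one column more than rows.\<close>

lemma card_rows_cols:
  assumes "\<chi> \<subseteq> {1..n + r}"
  shows "card \<chi> + card {i. i < r \<and> n + Suc i \<notin> \<chi>} = card {k. k < n \<and> Suc k \<in> \<chi>} + r"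
proof -
  define A C where "A = {k. k < n \<and> Suc k \<in> \<chi>}" and "C = {i. i < r \<and> n + Suc i \<notin> \<chi>}"
  have "\<chi> = Suc ` A \<union> (\<lambda>i. n + Suc i) ` ({..<r} - C)"
  proof (rule Set.set_eqI)
    fix k
    show "k \<in> \<chi> \<longleftrightarrow> k \<in> Suc ` A \<union> (\<lambda>i. n + Suc i) ` ({..<r} - C)"
    proof
      assume k: "k \<in> \<chi>"
      then have "k = Suc (k - 1)" "k \<le> n + r" using assms by auto
      show "k \<in> Suc ` A \<union> (\<lambda>i. n + Suc i) ` ({..<r} - C)"
      proof (cases "k \<le> n")
        case True
        then have "k - 1 \<in> A" using k \<open>k = Suc (k - 1)\<close> by (auto simp: A_def)
        then show ?thesis using \<open>k = Suc (k - 1)\<close> by blast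
      next
        case False
        then have "k = n + Suc (k - n - 1)" by auto
        moreover have "k - n - 1 \<in> {..<r} - C" using False k \<open>k \<le> n + r\<close> by (auto simp: C_def)
        ultimately show ?thesis by blast
      qed
    qed (auto simp: A_def C_def)
  qed
  moreover have "finite A" "finite C" "C \<subseteq> {..<r}" by (auto simp: A_def C_def)
  moreover have "Suc ` A \<inter> (\<lambda>i. n + Suc i) ` ({..<r} - C) = {}" by (auto simp: A_def)
  ultimately have "card \<chi> = card (Suc ` A) + card ((\<lambda>i. n + Suc i) ` ({..<r} - C))"
    by (metis card_Un_disjoint finite_Diff finite_imageI finite_lessThan)
  also have "\<dots> = card A + (r - card C)"
    using \<open>finite C\<close> \<open>C \<subseteq> {..<r}\<close> by (simp add: card_image inj_on_def card_Diff_subset)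
  finally have "card \<chi> = card A + (r - card C)" .
  moreover have "card C \<le> r" using \<open>C \<subseteq> {..<r}\<close> by (metis card_lessThan card_mono finite_lessThan)
  ultimately show ?thesis by (simp add: A_def C_def)
qed

lemma sum_complement_split:
  fixes g :: "nat \<Rightarrow> 'b::comm_monoid_add"
  shows "(\<Sum>k\<in>{1..n + r} - \<chi>. g k) =
    (\<Sum>k\<in>{1..n} - \<chi>. g k) + (\<Sum>i | i < r \<and> n + Suc i \<notin> \<chi>. g (n + Suc i))"
proof -
  define C where "C = {i. i < r \<and> n + Suc i \<notin> \<chi>}"
  have "{1..n + r} - \<chi> = ({1..n} - \<chi>) \<union> (\<lambda>i. n + Suc i) ` C"
  proof
    show "{1..n + r} - \<chi> \<subseteq> ({1..n} - \<chi>) \<union> (\<lambda>i. n + Suc i) ` C"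
    proof
      fix k assume k: "k \<in> {1..n + r} - \<chi>"
      show "k \<in> ({1..n} - \<chi>) \<union> (\<lambda>i. n + Suc i) ` C"
      proof (cases "k \<le> n")
        case False
        then have "k = n + Suc (k - n - 1)" by auto
        moreover have "k - n - 1 \<in> C" using False k by (auto simp: C_def)
        ultimately show ?thesis by blast
      qed (use k in auto)
    qed
  qed (auto simp: C_def)
  moreover have "({1..n} - \<chi>) \<inter> (\<lambda>i. n + Suc i) ` C = {}" by auto
  moreover have "finite C" by (auto simp: C_def)
  ultimately have "sum g ({1..n + r} - \<chi>) = sum g ({1..n} - \<chi>) + sum g ((\<lambda>i. n + Suc i) ` C)"
    by (simp add: sum.union_disjoint)
  also have "sum g ((\<lambda>i. n + Suc i) ` C) = (\<Sum>i\<in>C. g (n + Suc i))"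
    by (subst sum.reindex) (auto simp: inj_on_def)
  finally show ?thesis by (simp add: C_def)
qed

lemma sum_F_coeff:
  assumes "\<kappa> \<in> {1..n}"
  shows "(\<Sum>k\<in>{1..n + r} - \<chi>. c k * F_coeff n u k \<kappa>) =
    (if \<kappa> \<in> \<chi> then 0 else c \<kappa>) + (\<Sum>i | i < r \<and> n + Suc i \<notin> \<chi>. c (n + Suc i) * u (Suc i) \<kappa>)"
proof -
  have "(\<Sum>k\<in>{1..n} - \<chi>. c k * F_coeff n u k \<kappa>) = (\<Sum>k\<in>{1..n} - \<chi>. if k = \<kappa> then c \<kappa> else 0)"
    using assms by (intro sum.cong) (auto simp: F_coeff_def)
  also have "\<dots> = (if \<kappa> \<in> \<chi> then 0 else c \<kappa>)" using assms by simp
  finally have *: "(\<Sum>k\<in>{1..n} - \<chi>. c k * F_coeff n u k \<kappa>) = (if \<kappa> \<in> \<chi> then 0 else c \<kappa>)" .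
  have "F_coeff n u (n + Suc i) \<kappa> = u (Suc i) \<kappa>" for i
    using assms by (simp add: F_coeff_def)
  then show ?thesis unfolding sum_complement_split * by simp
qed

text \<open>In the coordinates that belong to \<chi> the unit vectors of the complement are zero, so
  a relation restricts there to the forms \<open>L\<^sub>i\<close> alone, with the square matrix of
  \<open>U_minor\<close>. Once its invertibility has removed these coefficients, every other
  coordinate isolates the coefficient of one unit vector.\<close>

lemma U_minor_nonzero_independent:
  assumes \<chi>: "\<chi> \<subseteq> {1..n + r}" "card \<chi> = r" and U: "U_minor n r u \<chi> \<noteq> 0"
    and rel: "\<And>\<kappa>. \<kappa> \<in> {1..n} \<Longrightarrow> (\<Sum>k\<in>{1..n + r} - \<chi>. c k * F_coeff n u k \<kappa>) = 0"
    and k: "k \<in> {1..n + r} - \<chi>"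
  shows "c k = 0"
proof -
  define A C where "A = {k. k < n \<and> Suc k \<in> \<chi>}" and "C = {i. i < r \<and> n + Suc i \<notin> \<chi>}"
  have card: "card C = card A" using card_rows_cols[OF \<chi>(1)] \<chi>(2) by (simp add: A_def C_def)
  define q where "q = card A"
  define S where "S = mat q q (\<lambda>(a, b). u (Suc (pick C b)) (Suc (pick A a)))"
  define v where "v = vec q (\<lambda>b. c (n + Suc (pick C b)))"
  have "finite C" by (auto simp: C_def)
  then have bij: "bij_betw (pick C) {..<q} C" using bij_betw_pick[of C] card by (simp add: q_def)
  have S: "S \<in> carrier_mat q q" by (simp add: S_def)
  have "S *\<^sub>v v = 0\<^sub>v q"
  proof (rule eq_vecI)
    fix a assume "a < dim_vec (0\<^sub>v q :: 'a vec)"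
    then have a: "a < q" by simp
    then have "pick A a \<in> A" using pick_in_set_le[of a A] by (simp add: q_def)
    then have "Suc (pick A a) \<in> {1..n}" "Suc (pick A a) \<in> \<chi>" by (auto simp: A_def)
    then have "0 = (\<Sum>i\<in>C. c (n + Suc i) * u (Suc i) (Suc (pick A a)))"
      using rel[of "Suc (pick A a)"] sum_F_coeff[of "Suc (pick A a)" n c u r \<chi>] by (simp add: C_def)
    also have "\<dots> = (\<Sum>b<q. c (n + Suc (pick C b)) * u (Suc (pick C b)) (Suc (pick A a)))"
      by (rule sum.reindex_bij_betw[OF bij, symmetric])
    also have "\<dots> = (S *\<^sub>v v) $ a"
      using a by (simp add: S_def v_def scalar_prod_def lessThan_atLeast0 mult.commute)
    finally show "(S *\<^sub>v v) $ a = 0\<^sub>v q $ a" using a by simp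
  qed (simp add: S_def)
  moreover have "det S \<noteq> 0"
    using U card by (simp add: U_minor_eq S_def q_def A_def C_def)
  ultimately have "v = 0\<^sub>v q"
    using det_0_iff_vec_prod_zero_field[OF S] vec_carrier[of q] unfolding v_def by blast
  have cC: "c (n + Suc i) = 0" if "i \<in> C" for i
  proof -
    have "i \<in> pick C ` {..<q}" using that by (simp only: bij_betw_imp_surj_on[OF bij])
    then obtain b where b: "b \<in> {..<q}" "i = pick C b" by (rule imageE)
    have "v $ b = 0" using \<open>v = 0\<^sub>v q\<close> b by simp
    then show ?thesis using b by (simp add: v_def)
  qed
  show ?thesis
  proof (cases "k \<le> n")
    case True
    have "(\<Sum>i\<in>C. c (n + Suc i) * u (Suc i) k) = 0" using cC by simp
    then show ?thesis using rel[of k] True k sum_F_coeff[of k n c u r \<chi>] by (simp add: C_def)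
  next
    case False
    then have "k - n - 1 \<in> C" "n + Suc (k - n - 1) = k" using k by (auto simp: C_def)
    then show ?thesis using cC by metis
  qed
qed

lemma pick_less_iff:
  assumes "finite S" "a < card S"
  shows "pick S a < x \<longleftrightarrow> a < card {y \<in> S. y < x}"
proof
  assume "pick S a < x"
  then have "{y \<in> S. y \<le> pick S a} \<subseteq> {y \<in> S. y < x}" by auto
  then have "card {y \<in> S. y \<le> pick S a} \<le> card {y \<in> S. y < x}"
    using assms by (intro card_mono) auto
  then show "a < card {y \<in> S. y < x}" using assms by (simp add: card_pick_le_Suc)
next
  assume a: "a < card {y \<in> S. y < x}"
  show "pick S a < x"
  proof (rule ccontr)
    assume "\<not> pick S a < x"
    then have "{y \<in> S. y < x} \<subseteq> {y \<in> S. y < pick S a}" by auto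
    then have "card {y \<in> S. y < x} \<le> card {y \<in> S. y < pick S a}"
      using assms by (intro card_mono) auto
    then show False using assms a by (simp add: card_pick_le)
  qed
qed

lemma pick_remove:
  assumes "finite S" "j < card S" "b < card S - 1"
  shows "pick (S - {pick S j}) b = pick S (if b < j then b else Suc b)"
proof (rule pick_eqI)
  have bij: "bij_betw (pick S) {..<card S} S" using assms by (simp add: bij_betw_pick)
  have "(\<lambda>b. if b < j then b else Suc b) ` {..<card S - 1} = {..<card S} - {j}"
  proof
    show "{..<card S} - {j} \<subseteq> (\<lambda>b. if b < j then b else Suc b) ` {..<card S - 1}"
    proof
      fix x assume "x \<in> {..<card S} - {j}"
      then show "x \<in> (\<lambda>b. if b < j then b else Suc b) ` {..<card S - 1}"
        using assms by (intro image_eqI[of _ _ "if x < j then x else x - 1"]) auto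
    qed
  qed (use assms in auto)
  then have "(\<lambda>b. pick S (if b < j then b else Suc b)) ` {..<card S - 1} = pick S ` ({..<card S} - {j})"
    by (metis image_image)
  also have "\<dots> = S - {pick S j}"
  proof -
    have "pick S ` ({..<card S} - {j}) = pick S ` {..<card S} - pick S ` {j}"
      using bij_betw_imp_inj_on[OF bij] assms(2) by (intro inj_on_image_set_diff[of _ "{..<card S}"]) auto
    then show ?thesis by (simp only: bij_betw_imp_surj_on[OF bij] image_insert image_empty)
  qed
  finally show "(\<lambda>b. pick S (if b < j then b else Suc b)) ` {..<card S - 1} = S - {pick S j}" .
  show "pick S (if a < j then a else Suc a) < pick S (if b < j then b else Suc b)"
    if "a < b" "b < card S - 1" for a b
    by (rule pick_mono_le) (use that in auto)
qed fact

lemma pick_insert: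
  assumes "finite S" "x \<notin> S" "a \<le> card S"
  defines "s \<equiv> card {y \<in> S. y < x}"
  shows "pick (insert x S) a = (if a < s then pick S a else if a = s then x else pick S (a - 1))"
proof (rule pick_eqI)
  define f where "f = (\<lambda>a. if a < s then pick S a else if a = s then x else pick S (a - 1))"
  have s: "s \<le> card S" unfolding s_def using assms by (intro card_mono) auto
  have less: "pick S a < x \<longleftrightarrow> a < s" if "a < card S" for a
    unfolding s_def using pick_less_iff assms that by blast
  have neq: "pick S a \<noteq> x" if "a < card S" for a
    using pick_in_set_le[OF that] assms by auto
  show "f a < f b" if "a < b" "b < card S + 1" for a b
  proof -
    consider "b < s" | "b = s" | "s < b" by linarith
    then show ?thesis
    proof cases
      case 1
      then show ?thesis using that s pick_mono_le[of b S a] by (simp add: f_def)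
    next
      case 2
      then show ?thesis using that s less[of a] by (simp add: f_def)
    next
      case 3
      then have b: "b - 1 < card S" "f b = pick S (b - 1)" using that by (auto simp: f_def)
      consider "a < s" | "a = s" | "s < a" by linarith
      then show ?thesis
      proof cases
        case 1
        then have "pick S a < pick S (b - 1)" using 3 b by (intro pick_mono_le) auto
        then show ?thesis using 1 b by (simp add: f_def)
      next
        case 2
        have "\<not> pick S (b - 1) < x" using less[OF b(1)] 3 by auto
        then have "x < pick S (b - 1)" using neq[OF b(1)] by linarith
        then show ?thesis using 2 b by (simp add: f_def)
      next
        assume a: "s < a"
        then have "pick S (a - 1) < pick S (b - 1)" using that b by (intro pick_mono_le) auto
        then show ?thesis using a b by (simp add: f_def)
      qed
    qed
  qed
  have "f ` {..<card S + 1} = insert x (pick S ` {..<card S})"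
  proof
    show "insert x (pick S ` {..<card S}) \<subseteq> f ` {..<card S + 1}"
    proof
      fix y assume "y \<in> insert x (pick S ` {..<card S})"
      then consider "y = x" | a where "a < card S" "y = pick S a" by auto
      then show "y \<in> f ` {..<card S + 1}"
      proof cases
        case 1
        then show ?thesis using s by (intro image_eqI[of _ _ s]) (auto simp: f_def)
      next
        case 2
        then show ?thesis
          by (intro image_eqI[of _ _ "if a < s then a else a + 1"]) (auto simp: f_def)
      qed
    qed
    show "f ` {..<card S + 1} \<subseteq> insert x (pick S ` {..<card S})"
      using s by (auto simp: f_def)
  qed
  then show "f ` {..<card S + 1} = insert x S"
    using bij_betw_pick[OF assms(1)] by (simp add: bij_betw_def)
  show "a < card S + 1" using assms by simp
qed

text \<open>Cramer's rule. Take the rows \<open>A\<close> together with an extra row for \<kappa>,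
  and the columns \<open>C\<close>. Expanding the determinant along the extra row produces, up to a
  common sign, the contributions of the \<open>L\<^sub>i\<close> in coordinate \<kappa>. For
  \<kappa> in \<Theta> a row is repeated and the determinant is 0; otherwise it is the minor of
  \<kappa> itself, which enters the relation with the opposite sign.\<close>

lemma m_coeff_relation:
  assumes \<Theta>: "\<Theta> \<subseteq> {1..n + r}" "card \<Theta> = r - 1" and r: "1 \<le> r" and \<kappa>: "\<kappa> \<in> {1..n}"
  shows "(\<Sum>k\<in>{1..n + r} - \<Theta>. m_coeff n r u \<Theta> k * F_coeff n u k \<kappa>) = 0"
proof -
  define A C where "A = {k. k < n \<and> Suc k \<in> \<Theta>}" and "C = {i. i < r \<and> n + Suc i \<notin> \<Theta>}"
  define D where "D = {1..n + r} - \<Theta>"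
  define p where "p = card A"
  define h where "h = card {l \<in> D. l \<le> n}"
  define s where "s = card {y \<in> A. y < \<kappa> - 1}"
  have fin: "finite A" "finite C" "finite D" by (auto simp: A_def C_def D_def)
  have card_C: "card C = Suc p"
    using card_rows_cols[OF \<Theta>(1)] \<Theta>(2) r by (simp add: A_def C_def p_def)
  have s_le: "s \<le> p" unfolding s_def p_def using fin by (intro card_mono) auto
  have "card ({l \<in> D. l \<le> n} \<union> Suc ` A) = h + p"
    unfolding h_def p_def using fin
    by (subst card_Un_disjoint) (auto simp: card_image A_def D_def)
  also have "{l \<in> D. l \<le> n} \<union> Suc ` A = {1..n}"
  proof
    show "{1..n} \<subseteq> {l \<in> D. l \<le> n} \<union> Suc ` A"
    proof
      fix l assume "l \<in> {1..n}"
      then show "l \<in> {l \<in> D. l \<le> n} \<union> Suc ` A"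
        by (cases "l \<in> \<Theta>") (auto simp: D_def A_def intro!: image_eqI[of _ _ "l - 1"])
    qed
  qed (auto simp: D_def A_def)
  finally have hp: "h + p = n" by simp
  \<comment> \<open>The row \<open>\<kappa> - 1\<close> is inserted at its rank \<open>s\<close>. If
    it lies in \<open>A\<close> already, then positions \<open>s\<close> and \<open>s + 1\<close>
    both hold it, which is the repeated row used below.\<close>
  define ps where "ps = (\<lambda>a. if a < s then pick A a else if a = s then \<kappa> - 1 else pick A (a - 1))"
  define M where "M = mat (Suc p) (Suc p) (\<lambda>(a, b). u (Suc (pick C b)) (Suc (ps a)))"
  have M: "M \<in> carrier_mat (Suc p) (Suc p)" by (simp add: M_def)
  have coeff_L: "m_coeff n r u \<Theta> (n + Suc (pick C j)) = (- 1) ^ (p + j + 1) * det (mat_delete M s j)"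
    if j: "j < Suc p" for j
  proof -
    define i where "i = pick C j"
    have i: "i \<in> C" using pick_in_set_le[of j C] j card_C by (simp add: i_def)
    have "{l \<in> D. l \<le> n + Suc i} = {l \<in> D. l \<le> n} \<union> (\<lambda>i. n + Suc i) ` {a \<in> C. a \<le> i}"
    proof
      show "{l \<in> D. l \<le> n + Suc i} \<subseteq> {l \<in> D. l \<le> n} \<union> (\<lambda>i. n + Suc i) ` {a \<in> C. a \<le> i}"
      proof
        fix l assume l: "l \<in> {l \<in> D. l \<le> n + Suc i}"
        show "l \<in> {l \<in> D. l \<le> n} \<union> (\<lambda>i. n + Suc i) ` {a \<in> C. a \<le> i}"
        proof (cases "l \<le> n")
          case False
          then have "l = n + Suc (l - n - 1)" by auto
          moreover have "l - n - 1 \<in> {a \<in> C. a \<le> i}" using False l by (auto simp: C_def D_def)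
          ultimately show ?thesis by blast
        qed (use l in auto)
      qed
    qed (auto simp: D_def C_def)
    moreover have "card ({l \<in> D. l \<le> n} \<union> (\<lambda>i. n + Suc i) ` {a \<in> C. a \<le> i}) = h + card {a \<in> C. a \<le> i}"
      unfolding h_def using fin by (subst card_Un_disjoint) (auto simp: card_image inj_on_def)
    ultimately have "card {l \<in> D. l \<le> n + Suc i} = h + Suc j"
      using card_pick_le_Suc[of j C] j card_C fin by (simp add: i_def)
    then have "sign_exp n h (card {l \<in> D. l \<le> n + Suc i}) (n + Suc i) = p + j + 1 + 2 * h"
      using hp by (simp add: sign_exp_def)
    then have sgn: "(- 1) ^ sign_exp n h (card {l \<in> D. l \<le> n + Suc i}) (n + Suc i) = ((- 1) ^ (p + j + 1) :: 'a)"
      by (simp only: power_add power_mult) simp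
    have A': "{k. k < n \<and> Suc k \<in> \<Theta> \<union> {n + Suc i}} = A" by (auto simp: A_def)
    have C': "{l. l < r \<and> n + Suc l \<notin> \<Theta> \<union> {n + Suc i}} = C - {i}" by (auto simp: C_def)
    have "card (C - {i}) = p" using i card_C fin by simp
    moreover have "pick (C - {i}) b = pick C (if b < j then b else Suc b)" if "b < p" for b
      unfolding i_def using that j card_C fin by (intro pick_remove) auto
    moreover have "ps (if a < s then a else Suc a) = pick A a" for a by (simp add: ps_def)
    ultimately have "U_minor n r u (\<Theta> \<union> {n + Suc i}) = det (mat_delete M s j)"
      unfolding U_minor_eq A' C' using s_le j
      by (intro arg_cong[of _ _ det]) (auto simp: mat_delete_def M_def p_def intro!: cong_mat)
    then show ?thesis unfolding m_coeff_def Let_def D_def[symmetric] h_def[symmetric] i_def[symmetric] sgn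
      by simp
  qed
  have "(\<Sum>i\<in>C. m_coeff n r u \<Theta> (n + Suc i) * u (Suc i) \<kappa>) =
      (\<Sum>j<Suc p. m_coeff n r u \<Theta> (n + Suc (pick C j)) * u (Suc (pick C j)) \<kappa>)"
    by (rule sum.reindex_bij_betw[symmetric]) (use bij_betw_pick[OF fin(2)] card_C in simp)
  also have "\<dots> = (\<Sum>j<Suc p. (- 1) ^ (p + 1 + s) * (M $$ (s, j) * cofactor M s j))"
  proof (rule sum.cong[OF refl])
    fix j assume j: "j \<in> {..<Suc p}"
    have "M $$ (s, j) = u (Suc (pick C j)) \<kappa>" using s_le j \<kappa> by (simp add: M_def ps_def)
    moreover have "(- 1) ^ (p + j + 1) = ((- 1) ^ (p + 1 + s) * (- 1) ^ (s + j) :: 'a)"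
      by (simp add: power_add)
    ultimately show "m_coeff n r u \<Theta> (n + Suc (pick C j)) * u (Suc (pick C j)) \<kappa> =
        (- 1) ^ (p + 1 + s) * (M $$ (s, j) * cofactor M s j)"
      using coeff_L[of j] j by (simp add: cofactor_def mult_ac)
  qed
  also have "\<dots> = (- 1) ^ (p + 1 + s) * det M"
    unfolding sum_distrib_left[symmetric] using laplace_expansion_row[OF M, of s] s_le by simp
  finally have sum_L: "(\<Sum>i\<in>C. m_coeff n r u \<Theta> (n + Suc i) * u (Suc i) \<kappa>) = (- 1) ^ (p + 1 + s) * det M" .
  show ?thesis
  proof (cases "\<kappa> \<in> \<Theta>")
    case True
    then have \<kappa>A: "\<kappa> - 1 \<in> A" using \<kappa> by (auto simp: A_def)
    then have "pick A s = \<kappa> - 1" unfolding s_def by (rule pick_card_in_set)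
    moreover have "s < p"
      unfolding s_def p_def using \<kappa>A fin by (intro psubset_card_mono) auto
    ultimately have "det M = 0"
      by (intro det_identical_rows[OF M, of s "Suc s"]) (auto simp: M_def ps_def)
    then show ?thesis using sum_L True sum_F_coeff[OF \<kappa>, of "m_coeff n r u \<Theta>" u r \<Theta>] by (simp add: C_def)
  next
    case False
    then have \<kappa>A: "\<kappa> - 1 \<notin> A" using \<kappa> by (auto simp: A_def)
    \<comment> \<open>The numbers up to \<kappa> split into those outside \<Theta> and the shifted
      elements of \<open>A\<close> below \<open>\<kappa> - 1\<close>. So \<kappa> has position
      \<open>\<kappa> - s\<close> in \<open>D\<close>, and the exponent of its sign becomes
      \<open>p - s\<close>.\<close>
    have "card ({l \<in> D. l \<le> \<kappa>} \<union> Suc ` {y \<in> A. y < \<kappa> - 1}) = card {l \<in> D. l \<le> \<kappa>} + s"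
      unfolding s_def using fin by (subst card_Un_disjoint) (auto simp: card_image A_def D_def)
    also have "{l \<in> D. l \<le> \<kappa>} \<union> Suc ` {y \<in> A. y < \<kappa> - 1} = {1..\<kappa>}"
    proof
      show "{1..\<kappa>} \<subseteq> {l \<in> D. l \<le> \<kappa>} \<union> Suc ` {y \<in> A. y < \<kappa> - 1}"
      proof
        fix l assume l: "l \<in> {1..\<kappa>}"
        show "l \<in> {l \<in> D. l \<le> \<kappa>} \<union> Suc ` {y \<in> A. y < \<kappa> - 1}"
        proof (cases "l \<in> \<Theta>")
          case True
          then have "l \<noteq> \<kappa>" using False by auto
          then have "l - 1 \<in> {y \<in> A. y < \<kappa> - 1}" "l = Suc (l - 1)" using l True \<kappa> by (auto simp: A_def)
          then show ?thesis by blast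
        qed (use l \<kappa> in \<open>auto simp: D_def\<close>)
      qed
    qed (use \<kappa> in \<open>auto simp: D_def A_def\<close>)
    finally have i: "card {l \<in> D. l \<le> \<kappa>} + s = \<kappa>" by simp
    have "card {l \<in> D. l \<le> \<kappa>} \<le> h"
      unfolding h_def using fin \<kappa> by (intro card_mono) auto
    then have "sign_exp n h (card {l \<in> D. l \<le> \<kappa>}) \<kappa> = p - s"
      using hp i s_le by (simp add: sign_exp_def)
    moreover have "(- 1) ^ (p - s) = ((- 1) ^ (p + s) :: 'a)"
      using s_le by (metis (no_types, lifting) le_add_diff_inverse2 power_add minus_one_mult_self mult.assoc mult.right_neutral)
    moreover have "U_minor n r u (\<Theta> \<union> {\<kappa>}) = det M"
    proof -
      have A': "{k. k < n \<and> Suc k \<in> \<Theta> \<union> {\<kappa>}} = insert (\<kappa> - 1) A" using \<kappa> by (auto simp: A_def)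
      have C': "{l. l < r \<and> n + Suc l \<notin> \<Theta> \<union> {\<kappa>}} = C" using \<kappa> by (auto simp: C_def)
      have "pick (insert (\<kappa> - 1) A) a = ps a" if "a < Suc p" for a
        unfolding ps_def s_def using fin \<kappa>A that by (intro pick_insert) (auto simp: p_def)
      then show ?thesis unfolding U_minor_eq A' C' M_def using fin \<kappa>A card_C
        by (intro arg_cong[of _ _ det]) (auto simp: p_def intro!: cong_mat)
    qed
    ultimately have "m_coeff n r u \<Theta> \<kappa> = (- 1) ^ (p + s) * det M"
      unfolding m_coeff_def Let_def D_def[symmetric] h_def[symmetric] by simp
    then show ?thesis using sum_L False sum_F_coeff[OF \<kappa>, of "m_coeff n r u \<Theta>" u r \<Theta>] by (simp add: C_def)
  qed
qed

section \<open>Vanishing ideals and leading monomials\<close>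

lemma meval_mpol_ring:
  assumes "finite V" "p \<in> carrier (mpol_ring V)"
  shows "meval z p = (\<Sum>e\<in>Poly_Mapping.keys p. Poly_Mapping.lookup p e * (\<Prod>i\<in>V. z i ^ Poly_Mapping.lookup e i))"
  unfolding meval_def using assms
  by (intro sum.cong refl) (auto simp: carrier_mpol_ring mon_eval_superset)

lemma keys_zero_if_lookup_zero: "(\<And>e. e \<in> Poly_Mapping.keys p \<Longrightarrow> Poly_Mapping.lookup p e = 0) \<Longrightarrow> p = 0"
  by (intro poly_mapping_eqI) (metis in_keys_iff lookup_zero)

lemma keys_lookup_pos:
  fixes e :: "nat \<Rightarrow>\<^sub>0 nat"
  shows "Poly_Mapping.keys e \<subseteq> V \<Longrightarrow> {i \<in> V. Poly_Mapping.lookup e i > 0} = Poly_Mapping.keys e"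
  by (auto simp: in_keys_iff)

lemma lookup_eq_on_imp_eq:
  assumes "Poly_Mapping.keys a \<subseteq> V" "Poly_Mapping.keys b \<subseteq> V"
    and "\<And>i. i \<in> V \<Longrightarrow> Poly_Mapping.lookup a i = Poly_Mapping.lookup b i"
  shows "a = b"
  using assms by (intro poly_mapping_eqI) (metis in_keys_iff subsetD)

text \<open>For \<open>L\<close> the space of value vectors of the forms, the Zariski closure of
  these points is the reciprocal plane of the hyperplane arrangement.\<close>

definition inverse_points :: "nat set \<Rightarrow> (nat \<Rightarrow> 'a::field) set \<Rightarrow> (nat \<Rightarrow> 'a) set" where
  "inverse_points V L = {\<lambda>i. inverse (y i) | y. y \<in> L \<and> (\<forall>i\<in>V. y i \<noteq> 0)}"

lemma eq_0_if_not_broken: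
  fixes p :: "'a::field mpol"
  assumes inf: "infinite (UNIV :: 'a set)" and "finite V" "lin_sub L"
    and p: "p \<in> vanishing_ideal V (inverse_points V L)"
    and nb: "\<And>e. e \<in> Poly_Mapping.keys p \<Longrightarrow> \<not> broken V L (Poly_Mapping.keys e)"
  shows "p = 0"
proof (rule keys_zero_if_lookup_zero)
  have car: "p \<in> carrier (mpol_ring V)" using p by (simp add: vanishing_ideal_def)
  then have kV: "Poly_Mapping.keys e \<subseteq> V" if "e \<in> Poly_Mapping.keys p" for e
    using that by (auto simp: carrier_mpol_ring)
  fix e assume e: "e \<in> Poly_Mapping.keys p"
  show "Poly_Mapping.lookup p e = 0"
  proof (rule nbc_independent[OF inf assms(2,3), of "Poly_Mapping.keys p" Poly_Mapping.lookup "Poly_Mapping.lookup p"])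
    show "(\<Sum>a\<in>Poly_Mapping.keys p. Poly_Mapping.lookup p a * (\<Prod>i\<in>V. inverse (y i) ^ Poly_Mapping.lookup a i)) = 0"
      if "y \<in> L" "\<And>i. i \<in> V \<Longrightarrow> y i \<noteq> 0" for y
    proof -
      have "(\<lambda>i. inverse (y i)) \<in> inverse_points V L" unfolding inverse_points_def using that by blast
      then show ?thesis
        using p meval_mpol_ring[OF assms(2) car, of "\<lambda>i. inverse (y i)"] by (simp add: vanishing_ideal_def)
    qed
  next
    fix a b assume "a \<in> Poly_Mapping.keys p" "b \<in> Poly_Mapping.keys p"
      "\<And>i. i \<in> V \<Longrightarrow> Poly_Mapping.lookup a i = Poly_Mapping.lookup b i"
    then show "a = b" using kV lookup_eq_on_imp_eq by metis
  next
    fix a assume "a \<in> Poly_Mapping.keys p"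
    then show "\<not> broken V L {i \<in> V. 0 < Poly_Mapping.lookup a i}" using kV nb keys_lookup_pos by metis
  qed (use e in auto)
qed

text \<open>Along a line in \<open>y\<close>, the value of \<open>p\<close> at the inverse
  coordinates is a rational function, to which \<open>line_poly\<close> does not apply. Its
  numerator has the same zeros among the points considered.\<close>

lemma clear_denominators_mpol:
  fixes p :: "'a::field mpol"
  assumes "finite V" "p \<in> carrier (mpol_ring V)"
  shows "\<exists>G. line_poly G \<and>
    (\<forall>y. (\<forall>i\<in>V. y i \<noteq> 0) \<longrightarrow> (G y = 0 \<longleftrightarrow> meval (\<lambda>i. inverse (y i)) p = 0))"
proof -
  define M where "M = (\<lambda>i. Max ((\<lambda>a. Poly_Mapping.lookup a i) ` Poly_Mapping.keys p))"
  define G where "G = (\<lambda>y. \<Sum>a\<in>Poly_Mapping.keys p. Poly_Mapping.lookup p a *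
    (\<Prod>i\<in>V. y i ^ (M i - Poly_Mapping.lookup a i)))"
  have "line_poly G" unfolding G_def
    by (intro line_poly_sum line_poly_mult line_poly_prod line_poly_power line_poly_coord line_poly_const)
  moreover have "G y = 0 \<longleftrightarrow> meval (\<lambda>i. inverse (y i)) p = 0" if "\<forall>i\<in>V. y i \<noteq> 0" for y
  proof -
    have "G y = (\<Prod>i\<in>V. y i ^ M i) * meval (\<lambda>i. inverse (y i)) p"
      unfolding G_def meval_mpol_ring[OF assms] using assms that
      by (intro clear_denominators) (auto simp: M_def)
    then show ?thesis using that assms(1) by simp
  qed
  ultimately show ?thesis by blast
qed

lemma primeideal_inverse_points:
  fixes L :: "(nat \<Rightarrow> 'a::field) set"
  assumes inf: "infinite (UNIV :: 'a set)" and V: "finite V" and L: "lin_sub L"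
    and nz: "\<And>i. i \<in> V \<Longrightarrow> \<exists>y\<in>L. y i \<noteq> 0"
  shows "primeideal (vanishing_ideal V (inverse_points V L)) (mpol_ring V)"
proof (rule primeideal_vanishing_ideal)
  have "(\<lambda>_. 0) \<in> L" using L by (simp add: lin_sub_def)
  from coords_nonzero[OF inf L line_poly_const this _ V nz, of 1]
  show "inverse_points V L \<noteq> {}" by (auto simp: inverse_points_def)
next
  fix p q :: "'a mpol"
  assume p: "p \<in> carrier (mpol_ring V)" and q: "q \<in> carrier (mpol_ring V)"
    and pz: "\<exists>z\<in>inverse_points V L. meval z p \<noteq> 0" and qz: "\<exists>z\<in>inverse_points V L. meval z q \<noteq> 0"
  obtain G where G: "line_poly G" "\<And>y. (\<forall>i\<in>V. y i \<noteq> 0) \<Longrightarrow> (G y = 0 \<longleftrightarrow> meval (\<lambda>i. inverse (y i)) p = 0)"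
    using clear_denominators_mpol[OF V p] by blast
  obtain H where H: "line_poly H" "\<And>y. (\<forall>i\<in>V. y i \<noteq> 0) \<Longrightarrow> (H y = 0 \<longleftrightarrow> meval (\<lambda>i. inverse (y i)) q = 0)"
    using clear_denominators_mpol[OF V q] by blast
  obtain x where x: "x \<in> L" "G x \<noteq> 0" using pz G(2) unfolding inverse_points_def by blast
  obtain y where y: "y \<in> L" "H y \<noteq> 0" using qz H(2) unfolding inverse_points_def by blast
  obtain w where w: "w \<in> L" "G w \<noteq> 0" "H w \<noteq> 0"
    using line_poly_mult_nonzero[OF inf L G(1) H(1) x y] by blast
  obtain z where z: "z \<in> L" "G z * H z \<noteq> 0" "\<forall>i\<in>V. z i \<noteq> 0"
    using coords_nonzero[OF inf L line_poly_mult[OF G(1) H(1)] w(1) _ V nz] w by auto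
  then have "(\<lambda>i. inverse (z i)) \<in> inverse_points V L" by (auto simp: inverse_points_def)
  then show "\<exists>z\<in>inverse_points V L. meval z p \<noteq> 0 \<and> meval z q \<noteq> 0"
    using z G(2)[OF z(3)] H(2)[OF z(3)] by (intro bexI[of _ "\<lambda>i. inverse (z i)"]) auto
qed

section \<open>Monomial primes as vanishing ideals of coordinate subspaces\<close>

definition coord_space :: "nat set \<Rightarrow> (nat \<Rightarrow> 'a::field) set" where
  "coord_space \<chi> = {z. \<forall>i\<in>\<chi>. z i = 0}"

lemma line_poly_meval: "line_poly (\<lambda>z. meval z p)"
  unfolding meval_def mon_eval_def
  by (intro line_poly_sum line_poly_mult line_poly_prod line_poly_power line_poly_coord line_poly_const)

lemma lin_sub_coord_space: "lin_sub (coord_space \<chi>)"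
  by (simp add: lin_sub_def coord_space_def)

lemma primeideal_coord_space:
  assumes "infinite (UNIV :: 'a::field set)"
  shows "primeideal (vanishing_ideal V (coord_space \<chi> :: (nat \<Rightarrow> 'a) set)) (mpol_ring V)"
proof (rule primeideal_vanishing_ideal)
  have "(\<lambda>_. 0) \<in> coord_space \<chi>" by (simp add: coord_space_def)
  then show "coord_space \<chi> \<noteq> ({} :: (nat \<Rightarrow> 'a) set)" by blast
  show "\<exists>z\<in>coord_space \<chi>. meval z p \<noteq> 0 \<and> meval z q \<noteq> 0"
    if "\<exists>z\<in>coord_space \<chi>. meval z p \<noteq> 0" "\<exists>z\<in>coord_space \<chi>. meval z q \<noteq> 0" for p q :: "'a mpol"
    using line_poly_mult_nonzero[OF assms lin_sub_coord_space line_poly_meval line_poly_meval] that by blast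
qed

lemma not_broken_UNIV: "finite E \<Longrightarrow> \<not> broken N (UNIV :: (nat \<Rightarrow> 'a::field) set) E"
proof
  assume "broken N (UNIV :: (nat \<Rightarrow> 'a) set) E"
  then obtain i and c :: "nat \<Rightarrow> 'a" where
    *: "\<And>y :: nat \<Rightarrow> 'a. y i = (\<Sum>j | j \<in> E \<and> i < j. c j * y j)"
    unfolding broken_def by auto
  have "(\<Sum>j | j \<in> E \<and> i < j. c j * (if j = i then 1 else 0)) = 0" by (rule sum.neutral) auto
  with *[of "\<lambda>j. if j = i then 1 else 0"] show False by simp
qed

text \<open>Setting the variables of \<chi> to 0 leaves exactly the monomials that avoid \<chi>. On
  the full space no set is broken, so \<open>nbc_independent\<close> says that all monomials in the
  remaining variables are independent, and none of them can occur in \<open>p\<close>.\<close>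

lemma vanishing_ideal_coord_space_keys:
  fixes p :: "'a::field mpol"
  assumes inf: "infinite (UNIV :: 'a set)" and V: "finite V" and p: "p \<in> vanishing_ideal V (coord_space \<chi>)"
    and e: "e \<in> Poly_Mapping.keys p"
  shows "Poly_Mapping.keys e \<inter> \<chi> \<noteq> {}"
proof
  assume e\<chi>: "Poly_Mapping.keys e \<inter> \<chi> = {}"
  define A where "A = {e \<in> Poly_Mapping.keys p. Poly_Mapping.keys e \<inter> \<chi> = {}}"
  have car: "p \<in> carrier (mpol_ring V)" using p by (simp add: vanishing_ideal_def)
  then have kV: "Poly_Mapping.keys e \<subseteq> V" if "e \<in> Poly_Mapping.keys p" for e
    using that by (auto simp: carrier_mpol_ring)
  have kA: "Poly_Mapping.keys e \<subseteq> V - \<chi>" if "e \<in> A" for e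
    using that kV by (auto simp: A_def)
  have "Poly_Mapping.lookup p e = 0"
  proof (rule nbc_independent[OF inf, of "V - \<chi>" UNIV A Poly_Mapping.lookup "Poly_Mapping.lookup p"])
    show "\<not> broken (V - \<chi>) (UNIV :: (nat \<Rightarrow> 'a) set) {i \<in> V - \<chi>. 0 < Poly_Mapping.lookup a i}" for a :: "nat \<Rightarrow>\<^sub>0 nat"
      using V by (intro not_broken_UNIV) auto
  next
    fix y :: "nat \<Rightarrow> 'a"
    define z where "z = (\<lambda>i. if i \<in> \<chi> then 0 else inverse (y i))"
    have "0 = meval z p"
      using p by (simp add: vanishing_ideal_def coord_space_def z_def)
    also have "\<dots> = (\<Sum>a\<in>A. Poly_Mapping.lookup p a * mon_eval z a)"
      unfolding meval_def
    proof (rule sum.mono_neutral_right, goal_cases)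
      case 3
      show ?case
      proof
        fix a assume "a \<in> Poly_Mapping.keys p - A"
        then obtain i where "i \<in> Poly_Mapping.keys a" "i \<in> \<chi>" by (auto simp: A_def)
        then have "mon_eval z a = 0"
          unfolding mon_eval_def z_def by (intro prod_zero) (auto simp: in_keys_iff intro!: bexI[of _ i])
        then show "Poly_Mapping.lookup p a * mon_eval z a = 0" by simp
      qed
    qed (auto simp: A_def)
    also have "\<dots> = (\<Sum>a\<in>A. Poly_Mapping.lookup p a * (\<Prod>i\<in>V - \<chi>. inverse (y i) ^ Poly_Mapping.lookup a i))"
    proof (rule sum.cong[OF refl])
      fix a assume "a \<in> A"
      have "mon_eval z a = (\<Prod>i\<in>V - \<chi>. z i ^ Poly_Mapping.lookup a i)"
        using V kA[OF \<open>a \<in> A\<close>] by (intro mon_eval_superset) auto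
      also have "\<dots> = (\<Prod>i\<in>V - \<chi>. inverse (y i) ^ Poly_Mapping.lookup a i)"
        by (rule prod.cong) (auto simp: z_def)
      finally show "Poly_Mapping.lookup p a * mon_eval z a =
        Poly_Mapping.lookup p a * (\<Prod>i\<in>V - \<chi>. inverse (y i) ^ Poly_Mapping.lookup a i)" by simp
    qed
    finally show "(\<Sum>a\<in>A. Poly_Mapping.lookup p a * (\<Prod>i\<in>V - \<chi>. inverse (y i) ^ Poly_Mapping.lookup a i)) = 0" ..
  next
    fix a b assume "a \<in> A" "b \<in> A"
      "\<And>i. i \<in> V - \<chi> \<Longrightarrow> Poly_Mapping.lookup a i = Poly_Mapping.lookup b i"
    then show "a = b" using kA lookup_eq_on_imp_eq by metis
  qed (use V e e\<chi> in \<open>auto simp: A_def lin_sub_def\<close>)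
  then show False using e by (simp add: in_keys_iff)
qed

text \<open>This description gives primality from the irreducibility of a linear space, and allows
  membership to be tested at points or monomial by monomial.\<close>

lemma genideal_Var_eq:
  assumes inf: "infinite (UNIV :: 'a::field set)" and V: "finite V" and \<chi>: "\<chi> \<subseteq> V"
  shows "Idl\<^bsub>mpol_ring V\<^esub> (Var ` \<chi>) = (vanishing_ideal V (coord_space \<chi>) :: 'a mpol set)"
proof
  have Var: "(Var ` \<chi> :: 'a mpol set) \<subseteq> carrier (mpol_ring V)" using \<chi> by (auto intro: mpol_closed_Var)
  show "Idl\<^bsub>mpol_ring V\<^esub> (Var ` \<chi>) \<subseteq> (vanishing_ideal V (coord_space \<chi>) :: 'a mpol set)"
    using Var by (intro mpol_genideal_subset ideal_vanishing_ideal) (auto simp: vanishing_ideal_def coord_space_def)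
  note I = mpol_genideal_ideal[OF Var]
  show "(vanishing_ideal V (coord_space \<chi>) :: 'a mpol set) \<subseteq> Idl\<^bsub>mpol_ring V\<^esub> (Var ` \<chi>)"
  proof
    fix p :: "'a mpol" assume p: "p \<in> vanishing_ideal V (coord_space \<chi>)"
    have "Poly_Mapping.single e c \<in> Idl\<^bsub>mpol_ring V\<^esub> (Var ` \<chi>)" if e: "e \<in> Poly_Mapping.keys p" for e and c :: 'a
    proof -
      obtain i where i: "i \<in> Poly_Mapping.keys e" "i \<in> \<chi>"
        using vanishing_ideal_coord_space_keys[OF inf V p e] by blast
      have keV: "Poly_Mapping.keys e \<subseteq> V" using p e by (auto simp: vanishing_ideal_def carrier_mpol_ring)
      have "e = (e - Poly_Mapping.single i 1) + Poly_Mapping.single i 1"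
        using i by (intro poly_mapping_eqI) (auto simp: lookup_add lookup_minus lookup_single in_keys_iff when_def)
      then have "Poly_Mapping.single e c = Poly_Mapping.single (e - Poly_Mapping.single i 1) c * Var i"
        unfolding Var_def mult_single by simp
      moreover have "Poly_Mapping.keys (e - Poly_Mapping.single i 1) \<subseteq> V"
        using keV by (auto simp: in_keys_iff lookup_minus)
      moreover have "Var i \<in> Idl\<^bsub>mpol_ring V\<^esub> (Var ` \<chi> :: 'a mpol set)"
        using mpol_genideal_self[OF Var] i by auto
      ultimately show ?thesis by (simp add: mpol_ideal_mult[OF I] mpol_closed_single)
    qed
    then show "p \<in> Idl\<^bsub>mpol_ring V\<^esub> (Var ` \<chi>)"
      by (subst mpol_sum_singles[of p]) (intro mpol_ideal_sum[OF I])
  qed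
qed

section \<open>Leading monomials of circuit relations\<close>

definition ind_exp :: "nat set \<Rightarrow> nat \<Rightarrow>\<^sub>0 nat" where
  "ind_exp X = (\<Sum>l\<in>X. Poly_Mapping.single l 1)"

lemma lookup_ind_exp: "finite X \<Longrightarrow> Poly_Mapping.lookup (ind_exp X) i = (if i \<in> X then 1 else 0)"
  unfolding ind_exp_def lookup_sum lookup_single by (simp add: when_def)

lemma prod_Var: "finite X \<Longrightarrow> (\<Prod>l\<in>X. Var l :: 'a::field mpol) = Poly_Mapping.single (ind_exp X) 1"
  by (induction X rule: finite_induct) (auto simp: ind_exp_def Var_def mult_single)

lemma wt_ind_exp: "finite X \<Longrightarrow> wt (ind_exp X) = \<Sum>X"
proof (induction X rule: finite_induct)
  case empty
  then show ?case by (simp add: ind_exp_def wt_def)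
next
  case (insert x X)
  then have "ind_exp (insert x X) = Poly_Mapping.single x 1 + ind_exp X" by (simp add: ind_exp_def)
  then show ?case using insert by (simp add: wt_add)
qed

lemma leading_monomial:
  fixes d :: "nat \<Rightarrow> 'a::field"
  assumes X: "finite X" "X \<subseteq> Poly_Mapping.keys a" and i: "i \<notin> X" and d: "\<And>j. j \<in> X \<Longrightarrow> d j \<noteq> 0 \<Longrightarrow> i < j"
  defines "q \<equiv> Poly_Mapping.single (a - ind_exp X) 1 *
    ((\<Prod>l\<in>X. Var l) + (\<Sum>j\<in>X. Const (d j) * (\<Prod>l\<in>insert i X - {j}. Var l)))"
  shows "Poly_Mapping.lookup q a = 1" and "e \<in> Poly_Mapping.keys q \<Longrightarrow> e \<noteq> a \<Longrightarrow> wt e < wt a"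
proof -
  define a' where "a' = a - ind_exp X"
  \<comment> \<open>Subtraction of exponents is truncated; it is exact here because \<open>X\<close>
    lies in the support of \<open>a\<close>.\<close>
  have a: "a = a' + ind_exp X"
    using X by (intro poly_mapping_eqI) (auto simp: a'_def lookup_add lookup_minus lookup_ind_exp in_keys_iff)
  define b where "b = (\<lambda>j. a' + ind_exp (insert i X - {j}))"
  have q: "q = Poly_Mapping.single a 1 + (\<Sum>j\<in>X. Poly_Mapping.single (b j) (d j))"
    unfolding q_def a'_def[symmetric] b_def Const_def using X(1)
    by (simp add: prod_Var distrib_left mult_single sum_distrib_left a)
  have lt: "wt (b j) < wt a" if j: "j \<in> X" "d j \<noteq> 0" for j
  proof -
    have "i + \<Sum>X = \<Sum>(insert i X)" using X i by simp
    also have "\<dots> = j + \<Sum>(insert i X - {j})" using X j by (intro sum.remove) auto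
    finally have "\<Sum>(insert i X - {j}) < \<Sum>X" using d[OF j] by linarith
    then show ?thesis using X by (simp add: b_def a wt_add wt_ind_exp)
  qed
  have look: "Poly_Mapping.lookup q e = (1 when a = e) + (\<Sum>j\<in>X. (d j when b j = e))" for e
    by (simp add: q lookup_add lookup_sum lookup_single)
  have "(\<Sum>j\<in>X. (d j when b j = a)) = 0"
  proof (rule sum.neutral, rule ballI)
    fix j assume "j \<in> X"
    then show "(d j when b j = a) = 0" using lt[of j] by (cases "d j = 0") (auto simp: when_def)
  qed
  then show "Poly_Mapping.lookup q a = 1" by (simp add: look)
  show "wt e < wt a" if "e \<in> Poly_Mapping.keys q" "e \<noteq> a"
  proof -
    have "(\<Sum>j\<in>X. (d j when b j = e)) \<noteq> 0"
      using that by (simp add: in_keys_iff look when_def)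
    then obtain j where "j \<in> X" "(d j when b j = e) \<noteq> 0" by (rule sum.not_neutral_contains_not_neutral)
    then show ?thesis using lt[of j] by (auto simp: when_def split: if_splits)
  qed
qed

section \<open>The ideal of maximal minors\<close>

text \<open>The entry of \<open>v\<^sub>j\<close> in row \<open>k\<close>; rows are counted from 0,
  hence the \<open>Suc k\<close>.\<close>

definition v_entry :: "nat \<Rightarrow> (nat \<Rightarrow> nat \<Rightarrow> 'a::field) \<Rightarrow> nat \<Rightarrow> nat \<Rightarrow> 'a mpol" where
  "v_entry n u j k = Const (F_coeff n u j (Suc k)) * Var j"

lemma B_mat_carrier: "1 \<le> n \<Longrightarrow> B_mat n r u \<in> carrier_mat n (n + r - 1)"
  by (auto simp: B_mat_def)

text \<open>The spanning tree is the path from 1 to \<open>n\<close> with the leaves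
  \<open>n + 1\<close> to \<open>n + r\<close> attached to \<open>n\<close>. Columns are counted
  from 0, so column \<open>c\<close> is \<open>A_col n (c + 1)\<close> on the path, and otherwise it
  belongs to the leaf \<open>c + 2\<close>.\<close>

lemma B_mat_entry:
  assumes "k < n" "c < n + r - 1"
  shows "B_mat n r u $$ (k, c) =
    (if c < n - 1 then v_entry n u (c + 1) k - v_entry n u (c + 2) k
     else v_entry n u (c + 2) k - v_entry n u n k)"
proof (cases "c < n - 1")
  case True
  then have "(map (A_col n) [1..<n] @ map (C_col n u) [1..<r + 1]) ! c = A_col n (Suc c)"
    by (simp add: nth_append)
  then have "B_mat n r u $$ (k, c) = A_col n (Suc c) $ k"
    unfolding B_mat_def using assms by (subst mat_of_cols_index) auto
  then show ?thesis using True assms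
    by (auto simp: A_col_def v_entry_def F_coeff_def Const.hom_one Const.hom_zero)
next
  case False
  then have "(map (A_col n) [1..<n] @ map (C_col n u) [1..<r + 1]) ! c = C_col n u (Suc (c - (n - 1)))"
    using assms by (simp add: nth_append del: upt_Suc)
  then have "B_mat n r u $$ (k, c) = C_col n u (Suc (c - (n - 1))) $ k"
    unfolding B_mat_def using assms by (subst mat_of_cols_index) auto
  moreover have "n + Suc (c - (n - 1)) = c + 2" "c + 2 - n = Suc (c - (n - 1))" "\<not> c + 2 \<le> n"
    using False assms by auto
  moreover have "Suc k < n \<or> Suc k = n" using assms by linarith
  ultimately show ?thesis using False assms
    by (auto simp: C_col_def v_entry_def F_coeff_def Const.hom_one Const.hom_zero)
qed

lemma B_mat_entry_closed:
  assumes "k < n" "c < n + r - 1"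
  shows "B_mat n r u $$ (k, c) \<in> carrier (T_ring n r)"
proof -
  have "v_entry n u j k \<in> carrier (T_ring n r)" if "j \<in> {1..n + r}" for j
    unfolding v_entry_def using that by (intro mpol_closed_mult mpol_closed_Const mpol_closed_Var)
  then show ?thesis using assms by (auto simp: B_mat_entry intro!: mpol_closed_diff)
qed

lemma submatrix_B_mat:
  assumes "1 \<le> n" "J \<subseteq> {..<n + r - 1}" "card J = n"
  shows "submatrix (B_mat n r u) {..<n} J = mat n n (\<lambda>(a, b). B_mat n r u $$ (a, pick J b))"
  using assms B_mat_carrier[OF assms(1), of r u]
  by (subst submatrix_eq_mat) (auto simp: pick_lessThan intro!: cong_mat)

lemma pick_less_bound:
  assumes "J \<subseteq> {..<m}" "b < card J"
  shows "pick J b < m"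
  using pick_in_set_le[OF assms(2)] assms(1) by auto

lemma I_n_B_eq:
  assumes "1 \<le> n"
  shows "I_n_B n r u = Idl\<^bsub>T_ring n r\<^esub>
     {det (submatrix (B_mat n r u) {..<n} J) | J. J \<subseteq> {..<n + r - 1} \<and> card J = n}"
  using B_mat_carrier[OF assms, of r u] by (simp add: I_n_B_def)

lemma minors_closed:
  assumes "1 \<le> n"
  shows "{det (submatrix (B_mat n r u) {..<n} J) | J. J \<subseteq> {..<n + r - 1} \<and> card J = n} \<subseteq> carrier (T_ring n r)"
proof
  fix p assume "p \<in> {det (submatrix (B_mat n r u) {..<n} J) | J. J \<subseteq> {..<n + r - 1} \<and> card J = n}"
  then obtain J where J: "J \<subseteq> {..<n + r - 1}" "card J = n" and p: "p = det (submatrix (B_mat n r u) {..<n} J)"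
    by blast
  show "p \<in> carrier (T_ring n r)"
    unfolding p submatrix_B_mat[OF assms J]
  proof (rule mpol_closed_det)
    fix i j assume "i < dim_row (mat n n (\<lambda>(a, b). B_mat n r u $$ (a, pick J b)))"
      "j < dim_col (mat n n (\<lambda>(a, b). B_mat n r u $$ (a, pick J b)))"
    then have ij: "i < n" "j < n" by auto
    have "B_mat n r u $$ (i, pick J j) \<in> carrier (T_ring n r)"
      using ij J by (intro B_mat_entry_closed pick_less_bound) auto
    then show "mat n n (\<lambda>(a, b). B_mat n r u $$ (a, pick J b)) $$ (i, j) \<in> carrier (T_ring n r)"
      using ij by simp
  qed
qed

lemma ideal_I_n_B:
  assumes "1 \<le> n"
  shows "ideal (I_n_B n r u) (T_ring n r)"
  unfolding I_n_B_eq[OF assms] by (rule mpol_genideal_ideal[OF minors_closed[OF assms]])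

lemma I_n_B_minors:
  assumes "1 \<le> n" "J \<subseteq> {..<n + r - 1}" "card J = n"
  shows "det (submatrix (B_mat n r u) {..<n} J) \<in> I_n_B n r u"
  unfolding I_n_B_eq[OF assms(1)]
  by (rule subsetD[OF mpol_genideal_self[OF minors_closed[OF assms(1)]]]) (use assms in blast)

definition F_form :: "nat \<Rightarrow> (nat \<Rightarrow> nat \<Rightarrow> 'a::field) \<Rightarrow> (nat \<Rightarrow> 'a) \<Rightarrow> nat \<Rightarrow> 'a" where
  "F_form n u x j = (\<Sum>k=1..n. F_coeff n u j k * x k)"

text \<open>If \<open>x\<close> pairs with all \<open>v\<^sub>j\<close>, evaluated at
  \<open>z\<close>, to the same value \<open>c\<close>, it annihilates their differences and is a
  nonzero left kernel vector of every maximal submatrix. The application with \<open>c = 1\<close>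
  concerns \<P>, the one with \<open>c = 0\<close> the primes of \<open>Q\<close>.\<close>

lemma I_n_B_vanish:
  assumes n: "1 \<le> n" and x: "k \<in> {1..n}" "x k \<noteq> 0"
    and F: "\<And>j. j \<in> {1..n + r} \<Longrightarrow> F_form n u x j * z j = c"
    and p: "p \<in> I_n_B n r u"
  shows "meval z p = 0"
proof -
  have v: "(\<Sum>a<n. x (Suc a) * meval z (v_entry n u j a)) = c" if "j \<in> {1..n + r}" for j
  proof -
    have "(\<Sum>a<n. x (Suc a) * meval z (v_entry n u j a)) =
        (\<Sum>a<n. F_coeff n u j (Suc a) * x (Suc a)) * z j"
      by (simp add: v_entry_def meval_mult sum_distrib_left sum_distrib_right mult_ac)
    also have "(\<Sum>a<n. F_coeff n u j (Suc a) * x (Suc a)) = F_form n u x j"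
      unfolding F_form_def by (rule sum.reindex_bij_witness[of _ "\<lambda>k. k - 1" Suc]) auto
    finally show ?thesis using F[OF that] by simp
  qed
  have "meval z (det (submatrix (B_mat n r u) {..<n} J)) = 0"
    if J: "J \<subseteq> {..<n + r - 1}" "card J = n" for J
  proof -
    define M where "M = map_mat (meval z) (submatrix (B_mat n r u) {..<n} J)"
    have sub: "submatrix (B_mat n r u) {..<n} J \<in> carrier_mat n n"
      using J n by (simp add: submatrix_B_mat)
    have M: "M \<in> carrier_mat n n" "M\<^sup>T \<in> carrier_mat n n" using sub by (auto simp: M_def)
    define w where "w = vec n (\<lambda>a. x (Suc a))"
    have "M\<^sup>T *\<^sub>v w = 0\<^sub>v n"
    proof (rule eq_vecI)
      fix b assume "b < dim_vec (0\<^sub>v n :: 'a vec)"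
      then have b: "b < n" by simp
      define c' where "c' = pick J b"
      have c': "c' < n + r - 1" unfolding c'_def using J b by (intro pick_less_bound) auto
      have "(M\<^sup>T *\<^sub>v w) $ b = (\<Sum>a<n. M $$ (a, b) * x (Suc a))"
        using M b by (auto simp: scalar_prod_def w_def lessThan_atLeast0 intro!: sum.cong)
      also have "\<dots> = (\<Sum>a<n. x (Suc a) * meval z (B_mat n r u $$ (a, c')))"
        using b J n by (intro sum.cong refl) (simp add: M_def submatrix_B_mat c'_def)
      also have "\<dots> = 0"
      proof (cases "c' < n - 1")
        case True
        then show ?thesis using v[of "c' + 1"] v[of "c' + 2"] c'
          by (simp add: B_mat_entry meval.hom_minus right_diff_distrib sum_subtractf)
      next
        case False
        then show ?thesis using v[of n] v[of "c' + 2"] c' n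
          by (simp add: B_mat_entry meval.hom_minus right_diff_distrib sum_subtractf)
      qed
      finally show "(M\<^sup>T *\<^sub>v w) $ b = 0\<^sub>v n $ b" using b by simp
    qed (use M in auto)
    moreover have "w \<noteq> 0\<^sub>v n"
    proof
      assume "w = 0\<^sub>v n"
      moreover have "k - 1 < n" "Suc (k - 1) = k" using x by auto
      ultimately have "x k = 0" unfolding w_def by (metis index_vec index_zero_vec(1))
      then show False using x by simp
    qed
    moreover have "w \<in> carrier_vec n" by (simp add: w_def)
    ultimately have "det (M\<^sup>T) = 0" using det_0_iff_vec_prod_zero_field[OF M(2)] by blast
    then have "det M = 0" using det_transpose[OF M(1)] by simp
    then show ?thesis unfolding M_def by simp
  qed
  then have "{det (submatrix (B_mat n r u) {..<n} J) | J. J \<subseteq> {..<n + r - 1} \<and> card J = n}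
      \<subseteq> vanishing_ideal {1..n + r} {z}"
    using minors_closed[OF n, of r u] by (auto simp: vanishing_ideal_def)
  then have "I_n_B n r u \<subseteq> vanishing_ideal {1..n + r} {z}"
    unfolding I_n_B_eq[OF n] by (intro mpol_genideal_subset ideal_vanishing_ideal)
  then show ?thesis using p by (auto simp: vanishing_ideal_def)
qed

text \<open>Independence of the indexed family of the \<open>f\<^sub>k\<close>: two equal vectors
  with different indices count as dependent.\<close>

definition F_indep :: "nat \<Rightarrow> (nat \<Rightarrow> nat \<Rightarrow> 'a::field) \<Rightarrow> nat set \<Rightarrow> bool" where
  "F_indep n u X \<longleftrightarrow> (\<forall>c. (\<forall>\<kappa>\<in>{1..n}. (\<Sum>k\<in>X. c k * F_coeff n u k \<kappa>) = 0) \<longrightarrow> (\<forall>k\<in>X. c k = 0))"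

lemma F_indepD:
  "F_indep n u X \<Longrightarrow> (\<And>\<kappa>. \<kappa> \<in> {1..n} \<Longrightarrow> (\<Sum>k\<in>X. c k * F_coeff n u k \<kappa>) = 0) \<Longrightarrow> k \<in> X \<Longrightarrow> c k = 0"
  unfolding F_indep_def by blast

definition F_mat :: "nat \<Rightarrow> (nat \<Rightarrow> nat \<Rightarrow> 'a::field) \<Rightarrow> nat set \<Rightarrow> 'a mat" where
  "F_mat n u X = mat n n (\<lambda>(\<kappa>, q). F_coeff n u (pick X q) (Suc \<kappa>))"

lemma F_mat_carrier [simp]: "F_mat n u X \<in> carrier_mat n n"
  by (simp add: F_mat_def)

lemma F_mat_mult_vec:
  assumes "finite X" "card X = n" "\<kappa> < n"
  shows "(F_mat n u X *\<^sub>v vec n (\<lambda>q. c (pick X q))) $ \<kappa> = (\<Sum>k\<in>X. c k * F_coeff n u k (Suc \<kappa>))"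
proof -
  have "bij_betw (pick X) {..<n} X" using bij_betw_pick[OF assms(1)] assms(2) by simp
  then have "(\<Sum>k\<in>X. c k * F_coeff n u k (Suc \<kappa>)) = (\<Sum>q<n. c (pick X q) * F_coeff n u (pick X q) (Suc \<kappa>))"
    by (rule sum.reindex_bij_betw[symmetric])
  then show ?thesis using assms
    by (simp add: F_mat_def scalar_prod_def lessThan_atLeast0 mult.commute)
qed

lemma F_indep_iff_det:
  assumes X: "finite X" "card X = n"
  shows "F_indep n u X \<longleftrightarrow> det (F_mat n u X) \<noteq> 0"
proof
  assume ind: "F_indep n u X"
  show "det (F_mat n u X) \<noteq> 0"
  proof
    assume "det (F_mat n u X) = 0"
    then obtain w where w: "w \<in> carrier_vec n" "w \<noteq> 0\<^sub>v n" "F_mat n u X *\<^sub>v w = 0\<^sub>v n"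
      using det_0_iff_vec_prod_zero_field[OF F_mat_carrier] by blast
    \<comment> \<open>\<open>w\<close> is indexed by positions and \<open>c\<close> by elements; the
      rank of \<open>k\<close> inverts \<open>pick X\<close>.\<close>
    define c where "c = (\<lambda>k. w $ card {y \<in> X. y < k})"
    have cp: "c (pick X q) = w $ q" if "q < n" for q
      unfolding c_def using card_pick_le[of q X] that X by simp
    then have w_eq: "vec n (\<lambda>q. c (pick X q)) = w" using w(1) by (intro eq_vecI) auto
    have "(\<Sum>k\<in>X. c k * F_coeff n u k \<kappa>) = 0" if "\<kappa> \<in> {1..n}" for \<kappa>
      using F_mat_mult_vec[OF X, of "\<kappa> - 1" u c] w(3) that unfolding w_eq by auto
    then have "\<forall>k\<in>X. c k = 0" using ind unfolding F_indep_def by blast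
    then have "w $ q = 0" if "q < n" for q
      using cp[OF that] pick_in_set_le[of q X] that X by auto
    then have "w = 0\<^sub>v n" using w(1) by (intro eq_vecI) auto
    then show False using w(2) by simp
  qed
next
  assume det: "det (F_mat n u X) \<noteq> 0"
  show "F_indep n u X"
    unfolding F_indep_def
  proof (intro allI impI ballI)
    fix c k assume c: "\<forall>\<kappa>\<in>{1..n}. (\<Sum>k\<in>X. c k * F_coeff n u k \<kappa>) = 0" and k: "k \<in> X"
    define w where "w = vec n (\<lambda>q. c (pick X q))"
    have "F_mat n u X *\<^sub>v w = 0\<^sub>v n"
    proof (rule eq_vecI)
      fix a assume "a < dim_vec (0\<^sub>v n :: 'a vec)"
      then show "(F_mat n u X *\<^sub>v w) $ a = 0\<^sub>v n $ a"
        unfolding w_def using c F_mat_mult_vec[OF X, of a u c] by simp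
    qed (simp add: F_mat_def)
    then have w0: "w = 0\<^sub>v n"
      using det det_0_iff_vec_prod_zero_field[OF F_mat_carrier] vec_carrier[of n] unfolding w_def by blast
    have "k \<in> pick X ` {..<n}" using bij_betw_pick[OF X(1)] k X(2) by (simp add: bij_betw_def)
    then obtain q where q: "q \<in> {..<n}" "k = pick X q" by (rule imageE)
    have "w $ q = 0" using w0 q by simp
    then show "c k = 0" using q by (simp add: w_def)
  qed
qed

text \<open>A singular square matrix also has a left kernel vector; read as a point, it is a common
  zero of the forms that make up the columns.\<close>

lemma dependent_imp_zero:
  assumes X: "finite X" "card X = n" and "\<not> F_indep n u X"
  shows "\<exists>x. (\<exists>k\<in>{1..n}. x k \<noteq> 0) \<and> (\<forall>j\<in>X. F_form n u x j = 0)"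
proof -
  have T: "(F_mat n u X)\<^sup>T \<in> carrier_mat n n" by simp
  have "det ((F_mat n u X)\<^sup>T) = 0"
    using assms F_indep_iff_det[OF X] det_transpose[OF F_mat_carrier] by metis
  then obtain w where w: "w \<in> carrier_vec n" "w \<noteq> 0\<^sub>v n" "(F_mat n u X)\<^sup>T *\<^sub>v w = 0\<^sub>v n"
    using det_0_iff_vec_prod_zero_field[OF T] by blast
  define x where "x = (\<lambda>k. w $ (k - 1))"
  have "F_form n u x j = 0" if j: "j \<in> X" for j
  proof -
    have "j \<in> pick X ` {..<n}" using bij_betw_pick[OF X(1)] j X(2) by (simp add: bij_betw_def)
    then obtain q where q: "q \<in> {..<n}" "j = pick X q" by (rule imageE)
    have "F_form n u x j = (\<Sum>a<n. F_coeff n u j (Suc a) * x (Suc a))"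
      unfolding F_form_def by (rule sum.reindex_bij_witness[of _ Suc "\<lambda>k. k - 1"]) auto
    also have "\<dots> = ((F_mat n u X)\<^sup>T *\<^sub>v w) $ q"
      using q w(1) by (auto simp: F_mat_def scalar_prod_def x_def lessThan_atLeast0 intro!: sum.cong)
    finally show ?thesis using w(3) q by simp
  qed
  moreover have "\<exists>k\<in>{1..n}. x k \<noteq> 0"
  proof (rule ccontr)
    assume *: "\<not> ?thesis"
    have "w = 0\<^sub>v n"
    proof (rule eq_vecI)
      fix a assume "a < dim_vec (0\<^sub>v n :: 'a vec)"
      then show "w $ a = 0\<^sub>v n $ a" using * by (auto simp: x_def dest: bspec[of _ _ "Suc a"])
    qed (use w in auto)
    then show False using w(2) by simp
  qed
  ultimately show ?thesis by blast
qed

text \<open>The columns of \<open>B\<close> are differences of the vectors with entries \<open>v_entry n u j\<close>, and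
  they form a spanning tree on \<open>{1,\<dots>,n + r}\<close>; so every difference is a sum of columns.\<close>

definition path_coeff :: "nat \<Rightarrow> nat \<Rightarrow> nat \<Rightarrow> 'a::field mpol" where
  "path_coeff n j c = (if j \<le> n then if j - 1 \<le> c \<and> c < n - 1 then 1 else 0 else if c = j - 2 then 1 else 0)"

lemma sum_path_coeff:
  assumes "k < n" "j \<in> {1..n + r}"
  shows "(\<Sum>c<n + r - 1. B_mat n r u $$ (k, c) * path_coeff n j c) = v_entry n u j k - v_entry n u n k"
proof (cases "j \<le> n")
  case True
  have "(\<Sum>c<n + r - 1. B_mat n r u $$ (k, c) * path_coeff n j c) =
      (\<Sum>c\<in>{j - 1..<n - 1}. B_mat n r u $$ (k, c))"
    using True by (intro sum.mono_neutral_cong_right) (auto simp: path_coeff_def)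
  \<comment> \<open>The columns along the path from \<open>j\<close> to \<open>n\<close> telescope;
    the signs are arranged so that each summand is a forward difference.\<close>
  also have "\<dots> = (\<Sum>c\<in>{j - 1..<n - 1}. (- v_entry n u (Suc c + 1) k) - (- v_entry n u (c + 1) k))"
    using assms(1) by (intro sum.cong) (auto simp: B_mat_entry)
  also have "\<dots> = (- v_entry n u (n - 1 + 1) k) - (- v_entry n u (j - 1 + 1) k)"
    using True by (intro sum_Suc_diff') auto
  finally show ?thesis using assms by simp
next
  case False
  have "(\<Sum>c<n + r - 1. B_mat n r u $$ (k, c) * path_coeff n j c) = (\<Sum>c\<in>{j - 2}. B_mat n r u $$ (k, c))"
    using False assms by (intro sum.mono_neutral_cong_right) (auto simp: path_coeff_def)
  moreover have "j - 2 + 2 = j" "\<not> j - 2 < n - 1" "j - 2 < n + r - 1" using False assms by auto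
  ultimately show ?thesis using assms(1) by (simp add: B_mat_entry)
qed

text \<open>The matrix with columns \<open>v\<^sub>j - v\<^sub>i\<close> for \<open>j\<close> in
  \<open>X\<close> is the constant matrix of the basis \<open>X\<close> times a diagonal matrix
  minus one of rank one, because \<open>v\<^sub>i\<close> is \<open>T\<^sub>i\<close> times a
  combination of the basis. The determinant of the basis is a nonzero constant and can be divided
  out.\<close>

lemma circuit_in_I_n_B:
  assumes n: "1 \<le> n" and X: "X \<subseteq> {1..n + r}" "card X = n" "F_indep n u X" and i: "i \<in> {1..n + r} - X"
    and rel: "\<And>\<kappa>. \<kappa> \<in> {1..n} \<Longrightarrow> F_coeff n u i \<kappa> = (\<Sum>j\<in>X. c j * F_coeff n u j \<kappa>)"
  shows "(\<Prod>l\<in>X. Var l) + (\<Sum>j\<in>X. Const (- c j) * (\<Prod>l\<in>insert i X - {j}. Var l)) \<in> I_n_B n r u"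
proof -
  have fX: "finite X" using X(1) finite_subset by blast
  define m where "m = n + r - 1"
  have bij: "bij_betw (pick X) {..<n} X" using bij_betw_pick[OF fX] X(2) by simp
  have pX: "pick X q \<in> X" if "q < n" for q using pick_in_set_le[of q X] that X(2) by simp
  \<comment> \<open>\<open>path_coeff\<close> leads from each index to the common vertex
    \<open>n\<close>; in the difference of two such paths \<open>v\<^sub>n\<close> cancels.\<close>
  define Y where "Y = mat m n (\<lambda>(c, q). path_coeff n (pick X q) c - path_coeff n i c :: 'a mpol)"
  define W where "W = mat n n (\<lambda>(p, q). (if p = q then Var (pick X p) else 0) - Var i * Const (c (pick X p)))"
  have pc: "path_coeff n j c \<in> carrier (T_ring n r)" for j c by (simp add: path_coeff_def)
  have dY: "det (B_mat n r u * Y) \<in> I_n_B n r u"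
  proof (rule det_column_combination_in_ideal[OF ideal_I_n_B[OF n]])
    show "B_mat n r u \<in> carrier_mat n m" unfolding m_def by (rule B_mat_carrier[OF n])
    show "det (submatrix (B_mat n r u) {..<n} J) \<in> I_n_B n r u" if "J \<subseteq> {..<m}" "card J = n" for J
      using I_n_B_minors[OF n, of J r u] that by (simp add: m_def)
    show "Y $$ (a, b) \<in> carrier (T_ring n r)" if "a < m" "b < n" for a b
      using mpol_closed_diff[OF pc pc] that by (simp add: Y_def)
  qed (simp add: Y_def)
  have "B_mat n r u * Y = map_mat Const (F_mat n u X) * W"
  proof (rule eq_matI)
    fix k q assume "k < dim_row (map_mat Const (F_mat n u X) * W)" "q < dim_col (map_mat Const (F_mat n u X) * W)"
    then have kq: "k < n" "q < n" by (auto simp: F_mat_def W_def)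
    have "(B_mat n r u * Y) $$ (k, q) = (\<Sum>c<m. B_mat n r u $$ (k, c) * (path_coeff n (pick X q) c - path_coeff n i c))"
      using kq B_mat_carrier[OF n, of r u]
      by (auto simp: Y_def scalar_prod_def m_def lessThan_atLeast0 intro!: sum.cong)
    also have "\<dots> = v_entry n u (pick X q) k - v_entry n u i k"
      using sum_path_coeff[OF kq(1), of "pick X q" r u] sum_path_coeff[OF kq(1), of i r u] pX[OF kq(2)] X(1) i
      by (auto simp: right_diff_distrib sum_subtractf m_def)
    also have "\<dots> = (\<Sum>p<n. Const (F_coeff n u (pick X p) (Suc k)) *
        ((if p = q then Var (pick X p) else 0) - Var i * Const (c (pick X p))))"
    proof -
      have "F_coeff n u i (Suc k) = (\<Sum>p<n. c (pick X p) * F_coeff n u (pick X p) (Suc k))"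
        using rel[of "Suc k"] kq sum.reindex_bij_betw[OF bij, of "\<lambda>j. c j * F_coeff n u j (Suc k)"] by simp
      then have "v_entry n u i k = (\<Sum>p<n. Const (F_coeff n u (pick X p) (Suc k)) * (Var i * Const (c (pick X p))))"
        by (simp add: v_entry_def Const.hom_sum Const.hom_mult sum_distrib_left mult_ac)
      moreover have "v_entry n u (pick X q) k =
          (\<Sum>p<n. Const (F_coeff n u (pick X p) (Suc k)) * (if p = q then Var (pick X p) else 0))"
      proof -
        have "(\<Sum>p<n. Const (F_coeff n u (pick X p) (Suc k)) * (if p = q then Var (pick X p) else 0)) =
          (\<Sum>p<n. if p = q then v_entry n u (pick X q) k else 0)"
          by (intro sum.cong) (auto simp: v_entry_def)
        then show ?thesis using kq by simp
      qed
      ultimately show ?thesis by (simp add: right_diff_distrib sum_subtractf)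
    qed
    also have "\<dots> = (map_mat Const (F_mat n u X) * W) $$ (k, q)"
      using kq by (auto simp: F_mat_def W_def scalar_prod_def lessThan_atLeast0 intro!: sum.cong)
    finally show "(B_mat n r u * Y) $$ (k, q) = (map_mat Const (F_mat n u X) * W) $$ (k, q)" .
  qed (use B_mat_carrier[OF n, of r u] in \<open>auto simp: F_mat_def W_def Y_def\<close>)
  then have "det (B_mat n r u * Y) = det (map_mat Const (F_mat n u X)) * det W"
    by (simp add: det_mult[of _ n] W_def)
  also have "det (map_mat Const (F_mat n u X)) = Const (det (F_mat n u X))" by simp
  finally have "Const (det (F_mat n u X)) * det W \<in> I_n_B n r u" using dY by simp
  from mpol_ideal_mult[OF ideal_I_n_B[OF n] this mpol_closed_Const[of "inverse (det (F_mat n u X))"]]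
  have "(Const (inverse (det (F_mat n u X)) * det (F_mat n u X))) * det W \<in> I_n_B n r u"
    by (simp add: Const.hom_mult mult.assoc)
  moreover have "det (F_mat n u X) \<noteq> 0" using F_indep_iff_det[OF fX X(2)] X(3) by blast
  ultimately have "det W \<in> I_n_B n r u" by (simp add: Const.hom_one)
  also have "det W = (\<Prod>p<n. Var (pick X p)) -
      Var i * (\<Sum>p<n. Const (c (pick X p)) * (\<Prod>k\<in>{..<n} - {p}. Var (pick X k)))"
  proof -
    have "(Var k :: 'a mpol) \<noteq> 0" for k
      unfolding Var_def by (metis lookup_single_eq lookup_zero one_neq_zero)
    then show ?thesis unfolding W_def by (intro det_diag_minus_rank_one) auto
  qed
  also have "(\<Prod>p<n. Var (pick X p)) = (\<Prod>l\<in>X. Var l :: 'a mpol)"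
    by (rule prod.reindex_bij_betw[OF bij])
  also have "Var i * (\<Sum>p<n. Const (c (pick X p)) * (\<Prod>k\<in>{..<n} - {p}. Var (pick X k))) =
      (\<Sum>p<n. Const (c (pick X p)) * (\<Prod>l\<in>insert i X - {pick X p}. Var l))"
    unfolding sum_distrib_left
  proof (rule sum.cong[OF refl])
    fix p assume p: "p \<in> {..<n}"
    have "bij_betw (pick X) ({..<n} - {p}) (X - {pick X p})"
      using bij p by (intro bij_betw_DiffI) (auto simp: bij_betw_def)
    then have "(\<Prod>k\<in>{..<n} - {p}. Var (pick X k)) = (\<Prod>l\<in>X - {pick X p}. Var l :: 'a mpol)"
      by (rule prod.reindex_bij_betw)
    moreover have "insert i X - {pick X p} = insert i (X - {pick X p})" using i pX[of p] p by auto
    ultimately show "Var i * (Const (c (pick X p)) * (\<Prod>k\<in>{..<n} - {p}. Var (pick X k))) =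
        Const (c (pick X p)) * (\<Prod>l\<in>insert i X - {pick X p}. Var l)"
      using fX i by (simp add: mult_ac)
  qed
  also have "\<dots> = (\<Sum>j\<in>X. Const (c j) * (\<Prod>l\<in>insert i X - {j}. Var l))"
    by (rule sum.reindex_bij_betw[OF bij])
  finally show ?thesis by (simp add: Const.hom_uminus sum_negf)
qed

section \<open>The decomposition\<close>

interpretation fun_vs: vector_space "\<lambda>(c::'a::field) (f::nat \<Rightarrow> 'a) k. c * f k"
  by unfold_locales (auto simp: fun_eq_iff algebra_simps)

lemma sum_fun_apply: "(\<Sum>v\<in>S. f v) k = (\<Sum>v\<in>S. f v k :: 'b::comm_monoid_add)"
  by (induction S rule: infinite_finite_induct) auto

text \<open>Bridges indexed families and sets of vectors: the image set forgets repetitions, and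
  injectivity rules them out.\<close>

lemma F_indep_iff_independent:
  assumes inj: "inj_on (F_coeff n u) X" and X: "finite X"
  shows "F_indep n u X \<longleftrightarrow> fun_vs.independent (F_coeff n u ` X)"
proof
  assume ind: "F_indep n u X"
  show "fun_vs.independent (F_coeff n u ` X)"
  proof
    assume "fun_vs.dependent (F_coeff n u ` X)"
    then obtain w v where w: "(\<Sum>v\<in>F_coeff n u ` X. (\<lambda>k. w v * v k)) = 0" and v: "v \<in> F_coeff n u ` X" "w v \<noteq> 0"
      using fun_vs.dependent_finite[of "F_coeff n u ` X"] X by auto
    have "(\<Sum>k\<in>X. w (F_coeff n u k) * F_coeff n u k \<kappa>) = 0" for \<kappa>
      using fun_cong[OF w, of \<kappa>] by (simp add: sum_fun_apply sum.reindex[OF inj])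
    then have "w (F_coeff n u k) = 0" if "k \<in> X" for k
      using F_indepD[OF ind, of "\<lambda>k. w (F_coeff n u k)"] that by simp
    then show False using v by auto
  qed
next
  assume ind: "fun_vs.independent (F_coeff n u ` X)"
  show "F_indep n u X"
    unfolding F_indep_def
  proof (intro allI impI)
    fix c assume c: "\<forall>\<kappa>\<in>{1..n}. (\<Sum>k\<in>X. c k * F_coeff n u k \<kappa>) = 0"
    define w where "w = (\<lambda>v. c (the_inv_into X (F_coeff n u) v))"
    have w: "w (F_coeff n u k) = c k" if "k \<in> X" for k
      unfolding w_def using that by (simp add: the_inv_into_f_f[OF inj])
    have sum0: "(\<Sum>v\<in>F_coeff n u ` X. (\<lambda>k. w v * v k)) = 0"
    proof
      fix \<kappa>
      have "(\<Sum>v\<in>F_coeff n u ` X. (\<lambda>k. w v * v k)) \<kappa> = (\<Sum>k\<in>X. c k * F_coeff n u k \<kappa>)"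
        by (simp add: sum_fun_apply sum.reindex[OF inj] w)
      also have "\<dots> = 0"
      proof (cases "\<kappa> \<in> {1..n}")
        case False
        then have "F_coeff n u k \<kappa> = 0" for k by (simp only: F_coeff_def if_False)
        then show ?thesis by simp
      qed (use c in blast)
      finally show "(\<Sum>v\<in>F_coeff n u ` X. (\<lambda>k. w v * v k)) \<kappa> = 0 \<kappa>" by simp
    qed
    show "\<forall>k\<in>X. c k = 0"
    proof (rule ballI, rule ccontr)
      fix k assume k: "k \<in> X" "c k \<noteq> 0"
      then have "\<exists>v\<in>F_coeff n u ` X. w v \<noteq> 0" by (intro bexI[of _ "F_coeff n u k"]) (auto simp: w)
      then have "fun_vs.dependent (F_coeff n u ` X)"
        using sum0 fun_vs.dependent_finite[OF finite_imageI[OF X]] by blast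
      then show False using ind by blast
    qed
  qed
qed

lemma F_coeff_span: "F_coeff n u j \<in> fun_vs.span (F_coeff n u ` {1..n})"
proof -
  have "F_coeff n u j = (\<Sum>\<kappa>\<in>{1..n}. (\<lambda>k. F_coeff n u j \<kappa> * F_coeff n u \<kappa> k))"
  proof
    fix k
    have "(\<Sum>\<kappa>\<in>{1..n}. F_coeff n u j \<kappa> * F_coeff n u \<kappa> k) = (\<Sum>\<kappa>\<in>{1..n}. if \<kappa> = k then F_coeff n u j k else 0)"
      by (intro sum.cong) (auto simp: F_coeff_def)
    also have "\<dots> = F_coeff n u j k" by (auto simp: F_coeff_def)
    finally show "F_coeff n u j k = (\<Sum>\<kappa>\<in>{1..n}. (\<lambda>k. F_coeff n u j \<kappa> * F_coeff n u \<kappa> k)) k"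
      by (simp add: sum_fun_apply)
  qed
  also have "\<dots> \<in> fun_vs.span (F_coeff n u ` {1..n})"
    by (intro fun_vs.span_sum fun_vs.span_scale fun_vs.span_base imageI)
  finally show ?thesis .
qed

text \<open>A maximal independent set of forms from \<open>E\<close> that contains those of
  \<open>b\<close> spans all of them. So it is at least as large as \<open>G\<close>, and the
  \<open>n\<close> unit vectors bound it from above.\<close>

lemma F_indep_augment:
  assumes inj: "inj_on (F_coeff n u) E" and E: "finite E" and b: "b \<subseteq> E" "F_indep n u b"
    and G: "G \<subseteq> E" "F_indep n u G" "card G = n"
  obtains X where "b \<subseteq> X" "X \<subseteq> E" "card X = n" "F_indep n u X"
proof -
  let ?F = "F_coeff n u"
  have sub: "F_indep n u Y \<longleftrightarrow> fun_vs.independent (?F ` Y)" if "Y \<subseteq> E" for Y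
    using that inj E by (intro F_indep_iff_independent) (auto intro: inj_on_subset finite_subset)
  have "?F ` b \<subseteq> ?F ` E" "fun_vs.independent (?F ` b)" using b sub by auto
  then obtain B where B: "?F ` b \<subseteq> B" "B \<subseteq> ?F ` E" "fun_vs.independent B" "?F ` E \<subseteq> fun_vs.span B"
    by (rule fun_vs.maximal_independent_subset_extend)
  define X where "X = {k \<in> E. ?F k \<in> B}"
  have XE: "X \<subseteq> E" "b \<subseteq> X" using b B(1) by (auto simp: X_def)
  have FX: "?F ` X = B" using B(2) by (auto simp: X_def)
  have card: "card X = card B"
    using card_image[of ?F X] inj_on_subset[OF inj XE(1)] FX by simp
  have finB: "finite B" using B(2) E finite_subset by blast
  have "card (?F ` G) \<le> card B"
    using fun_vs.independent_span_bound[OF finB, of "?F ` G"] sub[OF G(1)] G B(4) by blast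
  then have "n \<le> card B" using card_image[of ?F G] inj_on_subset[OF inj G(1)] G(3) by simp
  moreover have "card B \<le> card (?F ` {1..n})"
    using fun_vs.independent_span_bound[of "?F ` {1..n}" B] B(2,3) F_coeff_span by blast
  moreover have "card (?F ` {1..n}) \<le> n" using card_image_le[of "{1..n}" ?F] by simp
  ultimately have "card X = n" using card by linarith
  moreover have "F_indep n u X" using sub[OF XE(1)] B(3) FX by simp
  ultimately show ?thesis using that XE by blast
qed

lemma F_indep_units: "F_indep n u {1..n}"
  unfolding F_indep_def
proof (intro allI impI ballI)
  fix c k assume c: "\<forall>\<kappa>\<in>{1..n}. (\<Sum>k\<in>{1..n}. c k * F_coeff n u k \<kappa>) = 0" and k: "k \<in> {1..n}"
  have "(\<Sum>j\<in>{1..n}. c j * F_coeff n u j k) = (\<Sum>j\<in>{1..n}. if j = k then c k else 0)"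
    using k by (intro sum.cong) (auto simp: F_coeff_def)
  then show "c k = 0" using c k by simp
qed

text \<open>A representation of \<open>f\<^sub>i\<close> with the fewest terms has independent
  support, since a relation on the support could be used to remove a term. Evaluation at unit
  vectors turns the identity on the value space into one between coefficient vectors.\<close>

lemma broken_imp_circuit:
  assumes "broken N (range (F_form n u)) E" and "finite E"
  obtains i b c where "i \<in> N" "b \<subseteq> E" "\<And>j. j \<in> b \<Longrightarrow> i < j" "F_indep n u b"
    "\<And>\<kappa>. \<kappa> \<in> {1..n} \<Longrightarrow> F_coeff n u i \<kappa> = (\<Sum>j\<in>b. c j * F_coeff n u j \<kappa>)"
proof -
  obtain i c where i: "i \<in> N"
    and c: "\<And>y. y \<in> range (F_form n u) \<Longrightarrow> y i = (\<Sum>j | j \<in> E \<and> i < j. c j * y j)"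
    using assms(1) unfolding broken_def by auto
  define P where "P = (\<lambda>b. b \<subseteq> {j. j \<in> E \<and> i < j} \<and>
    (\<exists>c. \<forall>\<kappa>\<in>{1..n}. F_coeff n u i \<kappa> = (\<Sum>j\<in>b. c j * F_coeff n u j \<kappa>)))"
  have "F_coeff n u i \<kappa> = (\<Sum>j | j \<in> E \<and> i < j. c j * F_coeff n u j \<kappa>)" if "\<kappa> \<in> {1..n}" for \<kappa>
  proof -
    have "F_form n u (\<lambda>k. if k = \<kappa> then 1 else 0) j = F_coeff n u j \<kappa>" for j
    proof -
      have "F_form n u (\<lambda>k. if k = \<kappa> then 1 else 0) j = (\<Sum>k=1..n. if k = \<kappa> then F_coeff n u j \<kappa> else 0)"
        unfolding F_form_def by (intro sum.cong) auto
      then show ?thesis using that by simp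
    qed
    then show ?thesis using c[of "F_form n u (\<lambda>k. if k = \<kappa> then 1 else 0)"] by simp
  qed
  then have "P {j. j \<in> E \<and> i < j}" unfolding P_def by blast
  from exists_least_iff[of "\<lambda>m. \<exists>b. P b \<and> card b = m"] this
  obtain b where b: "P b" and min: "\<And>b'. P b' \<Longrightarrow> \<not> card b' < card b" by metis
  have fb: "finite b" using b assms(2) finite_subset[of b E] by (auto simp: P_def)
  obtain c where c: "\<And>\<kappa>. \<kappa> \<in> {1..n} \<Longrightarrow> F_coeff n u i \<kappa> = (\<Sum>j\<in>b. c j * F_coeff n u j \<kappa>)"
    using b by (auto simp: P_def)
  have "F_indep n u b"
    unfolding F_indep_def
  proof (intro allI impI ballI, rule ccontr)
    fix d k assume d: "\<forall>\<kappa>\<in>{1..n}. (\<Sum>j\<in>b. d j * F_coeff n u j \<kappa>) = 0" and k: "k \<in> b" "d k \<noteq> 0"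
    \<comment> \<open>The multiple of the relation \<open>d\<close> is chosen so that the
      coefficient at \<open>k\<close> cancels.\<close>
    define c' where "c' = (\<lambda>j. c j - c k / d k * d j)"
    have "F_coeff n u i \<kappa> = (\<Sum>j\<in>b - {k}. c' j * F_coeff n u j \<kappa>)" if "\<kappa> \<in> {1..n}" for \<kappa>
    proof -
      have "c' k = 0" using k by (simp add: c'_def)
      then have "(\<Sum>j\<in>b - {k}. c' j * F_coeff n u j \<kappa>) = (\<Sum>j\<in>b. c' j * F_coeff n u j \<kappa>)"
        using fb k by (simp add: sum.remove[of b k])
      also have "\<dots> = (\<Sum>j\<in>b. c j * F_coeff n u j \<kappa>) - c k / d k * (\<Sum>j\<in>b. d j * F_coeff n u j \<kappa>)"
        by (simp add: c'_def left_diff_distrib sum_subtractf sum_distrib_left mult.assoc)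
      finally show ?thesis using c[OF that] d that by simp
    qed
    then have "P (b - {k})" using b unfolding P_def by blast
    moreover have "card (b - {k}) < card b" using fb k by (intro card_Diff1_less)
    ultimately show False using min by blast
  qed
  then show ?thesis using that[of i b c] i b c by (auto simp: P_def)
qed

lemma lin_sub_F_form: "lin_sub (range (F_form n u))"
  unfolding lin_sub_def
proof (intro conjI ballI allI)
  have "F_form n u (\<lambda>_. 0) = (\<lambda>_. 0)" by (rule ext) (simp add: F_form_def)
  then show "(\<lambda>_. 0) \<in> range (F_form n u)" by (metis rangeI)
next
  fix y z s assume "y \<in> range (F_form n u)" "z \<in> range (F_form n u)"
  then obtain a b where "y = F_form n u a" "z = F_form n u b" by auto
  then have "(\<lambda>i. y i + s * z i) = F_form n u (\<lambda>k. a k + s * b k)"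
    by (intro ext) (simp add: F_form_def distrib_left sum.distrib sum_distrib_left mult.left_commute)
  then show "(\<lambda>i. y i + s * z i) \<in> range (F_form n u)" by simp
qed

text \<open>The regular sequences are represented by two of their consequences: the forms are
  nonzero, so that all their values can be inverted at a common point, and they are distinct, so
  that exchange in the space of coefficient vectors applies to indices.\<close>

locale star_configuration =
  fixes n r :: nat and u :: "nat \<Rightarrow> nat \<Rightarrow> 'a::field"
  assumes inf: "infinite (UNIV :: 'a set)" and n: "1 \<le> n" and r: "1 \<le> r"
    and F_nonzero: "\<And>j. j \<in> {1..n + r} \<Longrightarrow> \<exists>\<kappa>\<in>{1..n}. F_coeff n u j \<kappa> \<noteq> 0"
    and F_inj: "inj_on (F_coeff n u) {1..n + r}"
    and m_nonzero: "\<And>\<Theta>. \<Theta> \<subseteq> {1..n + r} \<Longrightarrow> card \<Theta> = r - 1 \<Longrightarrow> m_poly n r u \<Theta> \<noteq> 0"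
begin

abbreviation "V \<equiv> {1..n + r}"
abbreviation "L \<equiv> range (F_form n u)"

lemma m_coeff_nonzero:
  assumes "\<Theta> \<subseteq> V" "card \<Theta> = r - 1"
  obtains k where "k \<in> V - \<Theta>" "m_coeff n r u \<Theta> k \<noteq> 0"
proof (rule ccontr)
  assume "\<not> thesis"
  then have "\<And>k. k \<in> V - \<Theta> \<Longrightarrow> m_coeff n r u \<Theta> k = 0" using that by blast
  then have "m_poly n r u \<Theta> = 0" unfolding m_poly_eq[OF assms r] by (intro sum.neutral) (simp add: Const.hom_zero)
  then show False using m_nonzero[OF assms] by blast
qed

text \<open>For \<Theta> the complement of \<open>D\<close>, some coefficient of
  \<open>m\<^sub>\<Theta>\<close> is nonzero. The element \<open>k\<close> it belongs to is the one
  to drop, since its minor certifies the independence of the rest.\<close>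

lemma ex_indep_subset:
  assumes D: "D \<subseteq> V" "card D = n + 1"
  obtains G where "G \<subseteq> D" "card G = n" "F_indep n u G"
proof -
  have fD: "finite D" using D(1) finite_subset by blast
  have \<Theta>: "V - D \<subseteq> V" "card (V - D) = r - 1" using D fD by (auto simp: card_Diff_subset)
  obtain k where k: "k \<in> V - (V - D)" "m_coeff n r u (V - D) k \<noteq> 0" by (rule m_coeff_nonzero[OF \<Theta>])
  have kD: "k \<in> D" using k by auto
  have \<chi>: "V - D \<union> {k} \<subseteq> V" "card (V - D \<union> {k}) = r"
    using \<Theta> kD D(1) r finite_subset[OF \<Theta>(1)] by auto
  have U: "U_minor n r u (V - D \<union> {k}) \<noteq> 0" using k(2) by (auto simp: m_coeff_def Let_def)
  have eq: "V - (V - D \<union> {k}) = D - {k}" using D by auto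
  have "F_indep n u (D - {k})"
    unfolding F_indep_def using U_minor_nonzero_independent[OF \<chi> U] unfolding eq by blast
  moreover have "card (D - {k}) = n" using D fD kD by simp
  ultimately show ?thesis using that[of "D - {k}"] by blast
qed

text \<open>At the inverse point, the monomial without \<open>k\<close> equals \<open>y k\<close>
  times a product common to all terms. So the value of \<open>h_poly\<close> is this product times
  the linear relation of \<open>m_coeff_relation\<close>.\<close>

lemma h_poly_in_vanishing_ideal:
  assumes \<Theta>: "\<Theta> \<subseteq> V" "card \<Theta> = r - 1"
  shows "h_poly n r u \<Theta> \<in> vanishing_ideal V (inverse_points V L)"
proof -
  define D' where "D' = {k \<in> V - \<Theta>. m_coeff n r u \<Theta> k \<noteq> 0}"
  have h: "h_poly n r u \<Theta> = (\<Sum>k\<in>D'. Const (m_coeff n r u \<Theta> k) * (\<Prod>l\<in>D' - {k}. Var l))"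
    unfolding D'_def by (rule h_poly_eq[OF \<Theta> r])
  have D': "finite D'" "D' \<subseteq> V" by (auto simp: D'_def)
  have "h_poly n r u \<Theta> \<in> carrier (mpol_ring V)"
    unfolding h using D' by (intro mpol_closed_sum mpol_closed_mult mpol_closed_Const mpol_closed_prod mpol_closed_Var) auto
  moreover have "meval (\<lambda>i. inverse (y i)) (h_poly n r u \<Theta>) = 0"
    if y: "y \<in> L" "\<forall>i\<in>V. y i \<noteq> 0" for y
  proof -
    obtain x where x: "y = F_form n u x" using y by auto
    have "(\<Prod>l\<in>D' - {k}. inverse (y l)) = y k * (\<Prod>l\<in>D'. inverse (y l))" if "k \<in> D'" for k
      using that D' y(2) by (simp add: prod.remove[of D' k] subset_iff)
    then have "meval (\<lambda>i. inverse (y i)) (h_poly n r u \<Theta>) =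
        (\<Sum>k\<in>D'. m_coeff n r u \<Theta> k * (y k * (\<Prod>l\<in>D'. inverse (y l))))"
      unfolding h by (simp add: meval_sum meval_mult meval.hom_prod)
    also have "\<dots> = (\<Sum>k\<in>D'. m_coeff n r u \<Theta> k * y k) * (\<Prod>l\<in>D'. inverse (y l))"
      by (simp add: sum_distrib_right mult.assoc)
    also have "(\<Sum>k\<in>D'. m_coeff n r u \<Theta> k * y k) = (\<Sum>k\<in>V - \<Theta>. m_coeff n r u \<Theta> k * y k)"
      by (rule sum.mono_neutral_left) (auto simp: D'_def)
    also have "\<dots> = (\<Sum>\<kappa>=1..n. x \<kappa> * (\<Sum>k\<in>V - \<Theta>. m_coeff n r u \<Theta> k * F_coeff n u k \<kappa>))"
      unfolding x F_form_def sum_distrib_left by (subst sum.swap) (simp add: mult_ac)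
    also have "\<dots> = 0"
      by (intro sum.neutral ballI) (simp only: m_coeff_relation[OF \<Theta> r] mult_zero_right)
    finally show ?thesis by simp
  qed
  ultimately show ?thesis by (auto simp: vanishing_ideal_def inverse_points_def)
qed

lemma P_ideal_gens:
  "{h_poly n r u \<Theta> | \<Theta>. \<Theta> \<subseteq> V \<and> card \<Theta> = r - 1 \<and> m_poly n r u \<Theta> \<noteq> 0}
    \<subseteq> vanishing_ideal V (inverse_points V L)"
  using h_poly_in_vanishing_ideal by blast

lemma P_ideal_gens_carrier:
  "{h_poly n r u \<Theta> | \<Theta>. \<Theta> \<subseteq> V \<and> card \<Theta> = r - 1 \<and> m_poly n r u \<Theta> \<noteq> 0} \<subseteq> carrier (mpol_ring V)"
  using P_ideal_gens by (auto simp: vanishing_ideal_def)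

lemma ideal_P_ideal: "ideal (P_ideal n r u) (mpol_ring V)"
  unfolding P_ideal_def by (rule mpol_genideal_ideal[OF P_ideal_gens_carrier])

lemma h_poly_in_P_ideal: "\<Theta> \<subseteq> V \<Longrightarrow> card \<Theta> = r - 1 \<Longrightarrow> h_poly n r u \<Theta> \<in> P_ideal n r u"
  unfolding P_ideal_def using m_nonzero by (intro subsetD[OF mpol_genideal_self[OF P_ideal_gens_carrier]]) blast

lemma notin_indep_superset:
  assumes X: "F_indep n u X" "finite X" "b \<subseteq> X" and i: "i \<notin> b"
    and c: "\<And>\<kappa>. \<kappa> \<in> {1..n} \<Longrightarrow> F_coeff n u i \<kappa> = (\<Sum>j\<in>b. c j * F_coeff n u j \<kappa>)"
  shows "i \<notin> X"
proof
  assume iX: "i \<in> X"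
  define d where "d = (\<lambda>j. if j \<in> b then c j else if j = i then - 1 else 0)"
  have fb: "finite b" using X(2,3) finite_subset by blast
  have "(\<Sum>j\<in>X. d j * F_coeff n u j \<kappa>) = 0" if "\<kappa> \<in> {1..n}" for \<kappa>
  proof -
    have "(\<Sum>j\<in>X. d j * F_coeff n u j \<kappa>) = (\<Sum>j\<in>insert i b. d j * F_coeff n u j \<kappa>)"
      using X iX by (intro sum.mono_neutral_right) (auto simp: d_def)
    also have "\<dots> = - F_coeff n u i \<kappa> + (\<Sum>j\<in>b. c j * F_coeff n u j \<kappa>)"
      using fb i by (simp add: d_def)
    finally show ?thesis using c[OF that] by simp
  qed
  from F_indepD[OF X(1) this iX] have "d i = 0" .
  then show False using i by (simp add: d_def)
qed

text \<open>The broken circuit is completed to a basis \<open>X\<close> chosen anywhere in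
  \<open>V\<close>, not only inside the support. Adding \<open>i\<close> gives \<open>n + 1\<close>
  vectors with a single relation up to scalars, so \<open>m_coeff\<close> is proportional to the
  relation found, and \<open>h_poly\<close> involves only \<open>i\<close> and elements of the
  broken circuit.\<close>

lemma P_ideal_leading:
  assumes "broken V L (Poly_Mapping.keys a)" and a: "Poly_Mapping.keys a \<subseteq> V"
  shows "\<exists>p\<in>P_ideal n r u. Poly_Mapping.lookup p a = 1 \<and> (\<forall>e\<in>Poly_Mapping.keys p. e \<noteq> a \<longrightarrow> wt e < wt a)"
proof -
  obtain i b c where i: "i \<in> V" and b: "b \<subseteq> Poly_Mapping.keys a" and ib: "\<And>j. j \<in> b \<Longrightarrow> i < j"
    and ind: "F_indep n u b"
    and c: "\<And>\<kappa>. \<kappa> \<in> {1..n} \<Longrightarrow> F_coeff n u i \<kappa> = (\<Sum>j\<in>b. c j * F_coeff n u j \<kappa>)"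
    by (rule broken_imp_circuit[OF assms(1)]) auto
  have bV: "b \<subseteq> V" using a b by blast
  obtain X where X: "b \<subseteq> X" "X \<subseteq> V" "card X = n" "F_indep n u X"
    by (rule F_indep_augment[OF F_inj _ bV ind _ F_indep_units]) auto
  have fX: "finite X" using X(2) finite_subset by blast
  have ib': "i \<notin> b" using ib by blast
  have iX: "i \<notin> X" by (rule notin_indep_superset[OF X(4) fX X(1) ib' c])
  define \<Theta> where "\<Theta> = V - insert i X"
  have "card (insert i X) = n + 1" using fX iX X(3) by simp
  then have \<Theta>: "\<Theta> \<subseteq> V" "card \<Theta> = r - 1" using i X(2) fX by (auto simp: \<Theta>_def card_Diff_subset)
  have V\<Theta>: "V - \<Theta> = insert i X" using i X(2) by (auto simp: \<Theta>_def)
  define mc where "mc = m_coeff n r u \<Theta>"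
  have rel: "mc i * F_coeff n u i \<kappa> + (\<Sum>k\<in>X. mc k * F_coeff n u k \<kappa>) = 0" if "\<kappa> \<in> {1..n}" for \<kappa>
    using m_coeff_relation[OF \<Theta> r that, of u] fX iX unfolding V\<Theta> mc_def by simp
  \<comment> \<open>Substituting the expression for \<open>f\<^sub>i\<close> leaves a relation on
    the basis \<open>X\<close>, so each of its coefficients is zero.\<close>
  have mc_X: "mc k + mc i * (if k \<in> b then c k else 0) = 0" if "k \<in> X" for k
  proof -
    have "(\<Sum>k\<in>X. (mc k + mc i * (if k \<in> b then c k else 0)) * F_coeff n u k \<kappa>) = 0" if \<kappa>: "\<kappa> \<in> {1..n}" for \<kappa>
    proof -
      have "(\<Sum>k\<in>X. (if k \<in> b then c k else 0) * F_coeff n u k \<kappa>) = (\<Sum>k\<in>b. c k * F_coeff n u k \<kappa>)"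
        using X(1) fX by (intro sum.mono_neutral_cong_right) auto
      then show ?thesis using rel[OF \<kappa>] c[OF \<kappa>]
        by (simp add: distrib_right sum.distrib mult.assoc sum_distrib_left[symmetric] add.commute)
    qed
    from F_indepD[OF X(4) this that] show ?thesis .
  qed
  have mc_i: "mc i \<noteq> 0"
  proof
    assume "mc i = 0"
    then have "mc k = 0" if "k \<in> insert i X" for k using mc_X that by auto
    then show False using m_coeff_nonzero[OF \<Theta>] unfolding V\<Theta> mc_def by blast
  qed
  define Y where "Y = {k \<in> X. mc k \<noteq> 0}"
  have "k \<in> b" if "k \<in> Y" for k
    using mc_X[of k] that by (cases "k \<in> b") (auto simp: Y_def)
  then have Y: "finite Y" "i \<notin> Y" "Y \<subseteq> b" "Y \<subseteq> Poly_Mapping.keys a"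
    using fX iX b unfolding Y_def by auto
  have D': "{k \<in> V - \<Theta>. m_coeff n r u \<Theta> k \<noteq> 0} = insert i Y"
    unfolding V\<Theta> using mc_i by (auto simp: Y_def mc_def)
  define d where "d = (\<lambda>j. mc j / mc i)"
  define q where "q = (\<Prod>l\<in>Y. Var l) + (\<Sum>j\<in>Y. Const (d j) * (\<Prod>l\<in>insert i Y - {j}. Var l))"
  have "q = Const (inverse (mc i)) * h_poly n r u \<Theta>"
  proof -
    have "h_poly n r u \<Theta> = (\<Sum>k\<in>insert i Y. Const (mc k) * (\<Prod>l\<in>insert i Y - {k}. Var l))"
      unfolding h_poly_eq[OF \<Theta> r] D' mc_def ..
    also have "\<dots> = Const (mc i) * (\<Prod>l\<in>Y. Var l) + (\<Sum>k\<in>Y. Const (mc k) * (\<Prod>l\<in>insert i Y - {k}. Var l))"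
      using Y by simp
    finally have "Const (inverse (mc i)) * h_poly n r u \<Theta> = Const (inverse (mc i) * mc i) * (\<Prod>l\<in>Y. Var l) +
        (\<Sum>k\<in>Y. Const (inverse (mc i) * mc k) * (\<Prod>l\<in>insert i Y - {k}. Var l))"
      by (simp add: distrib_left sum_distrib_left Const.hom_mult mult.assoc)
    then show ?thesis using mc_i by (simp add: q_def d_def divide_inverse mult.commute Const.hom_one)
  qed
  then have q: "q \<in> P_ideal n r u"
    using mpol_ideal_mult[OF ideal_P_ideal h_poly_in_P_ideal[OF \<Theta>]] by simp
  have "Poly_Mapping.keys (a - ind_exp Y) \<subseteq> V"
    using a by (auto simp: in_keys_iff lookup_minus)
  then have "Poly_Mapping.single (a - ind_exp Y) 1 * q \<in> P_ideal n r u"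
    by (intro mpol_ideal_mult[OF ideal_P_ideal q] mpol_closed_single)
  moreover have "j \<in> Y \<Longrightarrow> i < j" for j using Y(3) ib by blast
  ultimately show ?thesis
    using leading_monomial[OF Y(1) Y(4) Y(2), of d] unfolding q_def by blast
qed

lemma P_ideal_eq: "P_ideal n r u = vanishing_ideal V (inverse_points V L)"
proof
  show sub: "P_ideal n r u \<subseteq> vanishing_ideal V (inverse_points V L)"
    unfolding P_ideal_def by (rule mpol_genideal_subset[OF ideal_vanishing_ideal P_ideal_gens])
  show "vanishing_ideal V (inverse_points V L) \<subseteq> P_ideal n r u"
  proof
    fix f assume f: "f \<in> vanishing_ideal V (inverse_points V L)"
    then have "f \<in> carrier (mpol_ring V)" by (simp add: vanishing_ideal_def)
    have "\<exists>g\<in>carrier (mpol_ring V). f - g \<in> P_ideal n r u \<and>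
        (\<forall>e\<in>Poly_Mapping.keys g. \<not> broken V L (Poly_Mapping.keys e))"
    proof (rule reduce_mod_ideal[OF ideal_P_ideal])
      show "\<exists>p\<in>P_ideal n r u. Poly_Mapping.lookup p a = 1 \<and>
          (\<forall>e\<in>Poly_Mapping.keys p. e \<noteq> a \<longrightarrow> wt e < wt a)"
        if "broken V L (Poly_Mapping.keys a)" "Poly_Mapping.keys a \<subseteq> V" for a
        using P_ideal_leading[OF that] .
    qed fact
    then obtain g where g: "f - g \<in> P_ideal n r u" "\<forall>e\<in>Poly_Mapping.keys g. \<not> broken V L (Poly_Mapping.keys e)"
      by blast
    have "f - (f - g) \<in> vanishing_ideal V (inverse_points V L)"
      using mpol_ideal_diff[OF ideal_vanishing_ideal f subsetD[OF sub g(1)]] .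
    then have "g = 0" using g(2) by (intro eq_0_if_not_broken[OF inf _ lin_sub_F_form]) auto
    then show "f \<in> P_ideal n r u" using g(1) by simp
  qed
qed

lemma primeideal_P_ideal: "primeideal (P_ideal n r u) (mpol_ring V)"
  unfolding P_ideal_eq
proof (rule primeideal_inverse_points[OF inf _ lin_sub_F_form])
  fix j assume "j \<in> V"
  then obtain \<kappa> where \<kappa>: "\<kappa> \<in> {1..n}" "F_coeff n u j \<kappa> \<noteq> 0" using F_nonzero by blast
  have "F_form n u (\<lambda>k. if k = \<kappa> then 1 else 0) j = (\<Sum>k=1..n. if k = \<kappa> then F_coeff n u j \<kappa> else 0)"
    unfolding F_form_def by (intro sum.cong) auto
  also have "\<dots> = F_coeff n u j \<kappa>" using \<kappa> by simp
  finally show "\<exists>y\<in>L. y j \<noteq> 0" using \<kappa>(2) by (metis rangeI)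
qed simp

lemma I_n_B_subset_P_ideal: "I_n_B n r u \<subseteq> P_ideal n r u"
proof
  fix p assume p: "p \<in> I_n_B n r u"
  have "meval (\<lambda>i. inverse (y i)) p = 0" if y: "y \<in> L" "\<forall>i\<in>V. y i \<noteq> 0" for y
  proof -
    obtain x where x: "y = F_form n u x" using y by auto
    have "y 1 \<noteq> 0" using y n by auto
    then obtain k where "k \<in> {1..n}" "x k \<noteq> 0"
      unfolding x F_form_def by (metis (no_types, lifting) mult_zero_right sum.neutral)
    then show ?thesis using I_n_B_vanish[OF n _ _ _ p, of k x "\<lambda>i. inverse (y i)" 1] y x by simp
  qed
  then show "p \<in> P_ideal n r u"
    unfolding P_ideal_eq using mpol_ideal_carrier[OF ideal_I_n_B[OF n] p]
    by (auto simp: vanishing_ideal_def inverse_points_def)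
qed

text \<open>Take a nonzero common zero \<open>x\<close> of the forms outside \<chi>. On the
  coordinate subspace of \<chi>, for each \<open>j\<close> either \<open>F\<^sub>j(x)\<close> or the
  coordinate \<open>z j\<close> vanishes, so \<open>I_n_B_vanish\<close> applies with constant
  0.\<close>

lemma dependent_in_Lambda_set:
  assumes \<chi>: "\<chi> \<subseteq> V" "card \<chi> = r" and dep: "\<not> F_indep n u (V - \<chi>)"
  shows "Idl\<^bsub>mpol_ring V\<^esub> (Var ` \<chi>) \<in> Lambda_set n r u"
proof -
  have f: "finite \<chi>" using \<chi>(1) finite_subset by blast
  have "card (V - \<chi>) = n" using \<chi> f by (simp add: card_Diff_subset)
  from dependent_imp_zero[OF _ this dep] obtain x k where x: "k \<in> {1..n}" "x k \<noteq> 0"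
    "\<And>j. j \<in> V - \<chi> \<Longrightarrow> F_form n u x j = 0" by auto
  have "p \<in> Idl\<^bsub>mpol_ring V\<^esub> (Var ` \<chi>)" if p: "p \<in> I_n_B n r u" for p
  proof -
    have "meval z p = 0" if z: "z \<in> coord_space \<chi>" for z
    proof (rule I_n_B_vanish[where n = n and k = k and x = x and r = r and u = u and z = z and c = 0, OF n x(1,2) _ p])
      show "F_form n u x j * z j = 0" if "j \<in> V" for j
        using x(3)[of j] z that by (cases "j \<in> \<chi>") (auto simp: coord_space_def)
    qed
    then have "p \<in> vanishing_ideal V (coord_space \<chi>)"
      using mpol_ideal_carrier[OF ideal_I_n_B[OF n] p] by (simp add: vanishing_ideal_def)
    then show ?thesis using genideal_Var_eq[OF inf _ \<chi>(1)] by simp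
  qed
  then show ?thesis unfolding Lambda_set_def using \<chi> by blast
qed

text \<open>The second conjunct says that the monomial lies in every prime supplied by
  \<open>dependent_in_Lambda_set\<close>. These are the monomials that still have to be rewritten in
  an element of \<open>Q\<close>.\<close>

definition bad :: "(nat \<Rightarrow>\<^sub>0 nat) \<Rightarrow> bool" where
  "bad a \<longleftrightarrow> broken V L (Poly_Mapping.keys a) \<and>
    (\<forall>\<chi>. \<chi> \<subseteq> V \<longrightarrow> card \<chi> = r \<longrightarrow> \<not> F_indep n u (V - \<chi>) \<longrightarrow> Poly_Mapping.keys a \<inter> \<chi> \<noteq> {})"

text \<open>The point is to find a basis \<open>X\<close> with
  \<open>b \<subseteq> X \<subseteq> E\<close>. It suffices to have some basis \<open>G\<close>
  inside \<open>E\<close>, since \<open>b\<close> can then be extended by exchange.\<close>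

lemma I_n_B_leading:
  assumes bad: "bad a" and a: "Poly_Mapping.keys a \<subseteq> V"
  shows "\<exists>p\<in>I_n_B n r u. Poly_Mapping.lookup p a = 1 \<and> (\<forall>e\<in>Poly_Mapping.keys p. e \<noteq> a \<longrightarrow> wt e < wt a)"
proof -
  define E where "E = Poly_Mapping.keys a"
  have E: "finite E" "E \<subseteq> V" using a by (auto simp: E_def)
  obtain i b c where i: "i \<in> V" and b: "b \<subseteq> E" and ib: "\<And>j. j \<in> b \<Longrightarrow> i < j"
    and ind: "F_indep n u b"
    and c: "\<And>\<kappa>. \<kappa> \<in> {1..n} \<Longrightarrow> F_coeff n u i \<kappa> = (\<Sum>j\<in>b. c j * F_coeff n u j \<kappa>)"
    using bad unfolding bad_def E_def by (elim conjE broken_imp_circuit) auto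
  have ib': "i \<notin> b" using ib by blast
  \<comment> \<open>For a dependent \<open>Z\<close>, its complement would be one of the sets \<chi>
    in \<open>bad\<close>, yet it misses the support \<open>E\<close>.\<close>
  have indep_Z: "F_indep n u Z" if Z: "E \<subseteq> Z" "Z \<subseteq> V" "card Z = n" for Z
  proof -
    have fZ: "finite Z" using Z(2) finite_subset by blast
    have "card (V - Z) = r" using Z fZ by (simp add: card_Diff_subset)
    moreover have "V - (V - Z) = Z" using Z(2) by blast
    ultimately have "\<not> F_indep n u Z \<Longrightarrow> E \<inter> (V - Z) \<noteq> {}"
      using bad unfolding bad_def E_def by (metis Diff_subset)
    then show ?thesis using Z(1) by blast
  qed
  obtain G where G: "G \<subseteq> E" "F_indep n u G" "card G = n"
  proof -
    consider "card E < n" | "card E = n" | "card E \<ge> n + 1" by linarith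
    then show ?thesis
    proof cases
      \<comment> \<open>This case is contradictory: enlarging \<open>insert i E\<close> to
        \<open>n\<close> elements gives an independent set that contains \<open>b\<close> as well as
        \<open>i\<close>, although \<open>f\<^sub>i\<close> is a combination of
        \<open>b\<close>.\<close>
      case 1
      have "card (insert i E) \<le> n" using 1 E by (simp add: card_insert_if)
      moreover have "insert i E \<subseteq> V" "n \<le> card V" using i E by auto
      ultimately obtain Z where Z: "insert i E \<subseteq> Z" "Z \<subseteq> V" "card Z = n"
        using exists_subset_between[of "insert i E" n V] by auto
      have "finite Z" using Z(2) finite_subset by blast
      then have "i \<notin> Z"
        using notin_indep_superset[OF indep_Z _ _ ib' c] Z b by auto
      then show ?thesis using Z by blast
    next
      case 2
      then show ?thesis using that[of E] indep_Z[of E] E by blast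
    next
      case 3
      then obtain D where D: "D \<subseteq> E" "card D = n + 1" using obtain_subset_with_card_n by metis
      then obtain G where "G \<subseteq> D" "card G = n" "F_indep n u G"
        using ex_indep_subset[of D] E by blast
      then show ?thesis using that[of G] D by blast
    qed
  qed
  obtain X where X: "b \<subseteq> X" "X \<subseteq> E" "card X = n" "F_indep n u X"
    by (rule F_indep_augment[OF inj_on_subset[OF F_inj E(2)] E(1) b ind G])
  have fX: "finite X" using X(2) E finite_subset by blast
  have iX: "i \<notin> X" by (rule notin_indep_superset[OF X(4) fX X(1) ib' c])
  \<comment> \<open>The coefficients are extended by 0 from the broken circuit to the basis; the
    added indices may be smaller than \<open>i\<close>.\<close>
  define c' where "c' = (\<lambda>j. if j \<in> b then c j else 0)"
  have c': "F_coeff n u i \<kappa> = (\<Sum>j\<in>X. c' j * F_coeff n u j \<kappa>)" if "\<kappa> \<in> {1..n}" for \<kappa>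
  proof -
    have "(\<Sum>j\<in>X. c' j * F_coeff n u j \<kappa>) = (\<Sum>j\<in>b. c j * F_coeff n u j \<kappa>)"
      using X(1) fX by (intro sum.mono_neutral_cong_right) (auto simp: c'_def)
    then show ?thesis using c[OF that] by simp
  qed
  have XV: "X \<subseteq> V" "X \<subseteq> Poly_Mapping.keys a" using X(2) E by (auto simp: E_def)
  have "i \<in> V - X" using i iX by blast
  from circuit_in_I_n_B[OF n XV(1) X(3,4) this c']
  have q: "(\<Prod>l\<in>X. Var l) + (\<Sum>j\<in>X. Const (- c' j) * (\<Prod>l\<in>insert i X - {j}. Var l)) \<in> I_n_B n r u"
    by blast
  have "Poly_Mapping.keys (a - ind_exp X) \<subseteq> V"
    using a by (auto simp: in_keys_iff lookup_minus)
  then have "Poly_Mapping.single (a - ind_exp X) 1 *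
      ((\<Prod>l\<in>X. Var l) + (\<Sum>j\<in>X. Const (- c' j) * (\<Prod>l\<in>insert i X - {j}. Var l))) \<in> I_n_B n r u"
    by (intro mpol_ideal_mult[OF ideal_I_n_B[OF n] q] mpol_closed_single)
  moreover have "j \<in> X \<Longrightarrow> - c' j \<noteq> 0 \<Longrightarrow> i < j" for j
    using ib by (auto simp: c'_def split: if_splits)
  ultimately show ?thesis
    using leading_monomial[OF fX XV(2) iX, of "\<lambda>j. - c' j"] by blast
qed

lemma I_n_B_eq_Inter: "I_n_B n r u = Q_ideal n r u \<inter> P_ideal n r u"
proof
  have Q: "I_n_B n r u \<subseteq> Q_ideal n r u"
    using mpol_ideal_carrier[OF ideal_I_n_B[OF n]] by (auto simp: Q_ideal_def Lambda_set_def)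
  then show sub: "I_n_B n r u \<subseteq> Q_ideal n r u \<inter> P_ideal n r u"
    using I_n_B_subset_P_ideal by blast
  show "Q_ideal n r u \<inter> P_ideal n r u \<subseteq> I_n_B n r u"
  proof
    fix f assume f: "f \<in> Q_ideal n r u \<inter> P_ideal n r u"
    then have "f \<in> carrier (mpol_ring V)" by (simp add: Q_ideal_def)
    have "\<exists>g\<in>carrier (mpol_ring V). f - g \<in> I_n_B n r u \<and>
        (\<forall>e\<in>Poly_Mapping.keys g. \<not> bad e)"
    proof (rule reduce_mod_ideal[OF ideal_I_n_B[OF n]])
      show "\<exists>p\<in>I_n_B n r u. Poly_Mapping.lookup p a = 1 \<and>
          (\<forall>e\<in>Poly_Mapping.keys p. e \<noteq> a \<longrightarrow> wt e < wt a)"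
        if "bad a" "Poly_Mapping.keys a \<subseteq> V" for a
        using I_n_B_leading[OF that] .
    qed fact
    then obtain g where g: "f - g \<in> I_n_B n r u" "\<forall>e\<in>Poly_Mapping.keys g. \<not> bad e"
      by blast
    have "f - (f - g) \<in> P_ideal n r u"
      using mpol_ideal_diff[OF ideal_P_ideal, of f "f - g"] g(1) sub f by blast
    then have gP: "g \<in> P_ideal n r u" by simp
    \<comment> \<open>Like \<open>f\<close>, the remainder \<open>g\<close> lies in the primes of
      \<open>dependent_in_Lambda_set\<close>. As these are monomial ideals, each monomial of
      \<open>g\<close> satisfies the second condition of \<open>bad\<close>, so not being bad means
      that its support is unbroken.\<close>
    have "\<not> broken V L (Poly_Mapping.keys e)" if e: "e \<in> Poly_Mapping.keys g" for e
    proof -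
      have "Poly_Mapping.keys e \<inter> \<chi> \<noteq> {}"
        if \<chi>: "\<chi> \<subseteq> V" "card \<chi> = r" "\<not> F_indep n u (V - \<chi>)" for \<chi>
      proof -
        have eq: "Idl\<^bsub>mpol_ring V\<^esub> (Var ` \<chi>) = (vanishing_ideal V (coord_space \<chi>) :: 'a mpol set)"
          using \<chi>(1) by (intro genideal_Var_eq[OF inf]) auto
        have "vanishing_ideal V (coord_space \<chi>) \<in> Lambda_set n r u"
          using dependent_in_Lambda_set[OF \<chi>] unfolding eq .
        then have "f \<in> vanishing_ideal V (coord_space \<chi>)" "f - g \<in> vanishing_ideal V (coord_space \<chi>)"
          using f g(1) Q by (auto simp: Q_ideal_def)
        then have "f - (f - g) \<in> vanishing_ideal V (coord_space \<chi>)"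
          by (rule mpol_ideal_diff[OF ideal_vanishing_ideal])
        then have "g \<in> vanishing_ideal V (coord_space \<chi>)" by simp
        then show ?thesis using e by (intro vanishing_ideal_coord_space_keys[OF inf]) auto
      qed
      then show ?thesis using g(2) e unfolding bad_def by blast
    qed
    then have "g = 0" using gP unfolding P_ideal_eq
      by (intro eq_0_if_not_broken[OF inf _ lin_sub_F_form]) auto
    then show "f \<in> I_n_B n r u" using g(1) by simp
  qed
qed

lemma primeideal_Lambda_set: "J \<in> Lambda_set n r u \<Longrightarrow> primeideal J (mpol_ring V)"
  unfolding Lambda_set_def using genideal_Var_eq[OF inf] primeideal_coord_space[OF inf] by auto

lemma finite_Lambda_set: "finite (Lambda_set n r u)"
  by (rule finite_subset[of _ "(\<lambda>\<chi>. Idl\<^bsub>mpol_ring V\<^esub> (Var ` \<chi>)) ` Pow V"]) (auto simp: Lambda_set_def)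

lemma I_n_B_decomposition:
  "radical_ideal (T_ring n r) (I_n_B n r u)
    \<and> I_n_B n r u = Q_ideal n r u \<inter> P_ideal n r u
    \<and> primary_decomposition (T_ring n r) (I_n_B n r u) (insert (P_ideal n r u) (Lambda_set n r u))"
proof -
  have Inter: "I_n_B n r u = carrier (T_ring n r) \<inter> \<Inter>(insert (P_ideal n r u) (Lambda_set n r u))"
    using I_n_B_eq_Inter by (auto simp: Q_ideal_def)
  have prime: "primeideal J (T_ring n r)" if "J \<in> insert (P_ideal n r u) (Lambda_set n r u)" for J
    using that primeideal_P_ideal primeideal_Lambda_set by blast
  have "radical_ideal (T_ring n r) (I_n_B n r u)"
    by (rule radical_ideal_Inter[OF ideal_I_n_B[OF n] Inter prime])
  moreover have "primary_decomposition (T_ring n r) (I_n_B n r u) (insert (P_ideal n r u) (Lambda_set n r u))"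
    unfolding primary_decomposition_def
    using Inter prime finite_Lambda_set primary_ideal_if_primeideal by blast
  ultimately show ?thesis using I_n_B_eq_Inter by blast
qed

end

section \<open>From regular sequences to nonzero and distinct forms\<close>

lemma regular_sequence_not_in_prefix:
  fixes as :: "'a::field mpol list"
  assumes reg: "regular_sequence (mpol_ring W) as" and i: "i < length as"
  shows "as ! i \<notin> Idl\<^bsub>mpol_ring W\<^esub> (set (take i as))"
proof
  assume in_prefix: "as ! i \<in> Idl\<^bsub>mpol_ring W\<^esub> (set (take i as))"
  have set_as: "set as \<subseteq> carrier (mpol_ring W)" using reg by (simp add: regular_sequence_def)
  note I = mpol_genideal_ideal[OF set_as]
  \<comment> \<open>Regularity at position \<open>i\<close> is applied to the multiplier 1; the
    outcome contradicts properness of the ideal of the whole sequence.\<close>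
  have "1 \<in> Idl\<^bsub>mpol_ring W\<^esub> (set (take i as))"
    using reg i in_prefix mpol_closed_one[of W] unfolding regular_sequence_def by (metis mpol_ring_simps(1) mult_1_right)
  moreover have "Idl\<^bsub>mpol_ring W\<^esub> (set (take i as)) \<subseteq> Idl\<^bsub>mpol_ring W\<^esub> (set as)"
    using mpol_genideal_self[OF set_as] set_take_subset[of i as] by (intro mpol_genideal_subset[OF I]) blast
  ultimately have "1 \<in> Idl\<^bsub>mpol_ring W\<^esub> (set as)" by blast
  then have "Idl\<^bsub>mpol_ring W\<^esub> (set as) = carrier (mpol_ring W)"
    using ideal.one_imp_carrier[OF I] by simp
  then show False using reg by (simp add: regular_sequence_def)
qed

theorem theorem6p14:
  fixes u :: "nat \<Rightarrow> nat \<Rightarrow> 'a::field" and n r :: nat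
  assumes "infinite (UNIV :: 'a set)"
    and "2 \<le> n" and "1 \<le> r"
    and "\<And>i j k. \<lbrakk>i \<in> {1..n + r}; j \<in> {1..n + r}; k \<in> {1..n + r}; distinct [i, j, k]\<rbrakk>
           \<Longrightarrow> regular_sequence (mpol_ring {1..n}) [F_elt n u i, F_elt n u j, F_elt n u k]"
    and "\<And>\<Theta>. \<lbrakk>\<Theta> \<subseteq> {1..n + r}; card \<Theta> = r - 1\<rbrakk> \<Longrightarrow> m_poly n r u \<Theta> \<noteq> 0"
  shows "radical_ideal (T_ring n r) (I_n_B n r u)
    \<and> I_n_B n r u = Q_ideal n r u \<inter> P_ideal n r u
    \<and> primary_decomposition (T_ring n r) (I_n_B n r u) (insert (P_ideal n r u) (Lambda_set n r u))"
proof -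
  \<comment> \<open>The hypothesis speaks of triples, so statements about one or two forms need
    further indices; these exist because \<open>n + r\<close> is at least 3.\<close>
  have third: "\<exists>k\<in>{1..n + r}. distinct [i, j, k]" if "i \<noteq> j" for i j
  proof -
    have "card ({1..n + r} - {i, j}) \<ge> n + r - 2"
      using diff_card_le_card_Diff[of "{i, j}" "{1..n + r}"] that by simp
    then have "0 < card ({1..n + r} - {i, j})" using assms(2,3) by linarith
    then have "{1..n + r} - {i, j} \<noteq> {}" by (metis card.empty less_irrefl)
    then show ?thesis using that by auto
  qed
  have nz: "\<exists>\<kappa>\<in>{1..n}. F_coeff n u i \<kappa> \<noteq> 0" if i: "i \<in> {1..n + r}" for i
  proof (rule ccontr)
    assume *: "\<not> ?thesis"
    have "F_elt n u i = 0"
      unfolding F_elt_eq[OF i] using * by (intro sum.neutral) (simp add: Const.hom_zero)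
    have "\<exists>j\<in>{1..n + r}. i \<noteq> j" using assms(2,3) by (intro bexI[of _ "if i = 1 then 2 else 1"]) auto
    then obtain j k where "j \<in> {1..n + r}" "k \<in> {1..n + r}" "distinct [i, j, k]" using third by blast
    \<comment> \<open>At position 0 the prefix ideal is generated by the empty set, and it contains
      the zero form.\<close>
    from regular_sequence_not_in_prefix[OF assms(4)[OF i this], of 0]
    show False
      using \<open>F_elt n u i = 0\<close> mpol_ideal_zero[OF mpol_genideal_ideal[of "{} :: 'a mpol set" "{1..n}"]] by simp
  qed
  have inj: "inj_on (F_coeff n u) {1..n + r}"
  proof (rule inj_onI, rule ccontr)
    fix i j assume i: "i \<in> {1..n + r}" and j: "j \<in> {1..n + r}"
      and eq: "F_coeff n u i = F_coeff n u j" and "i \<noteq> j"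
    then obtain k where k: "k \<in> {1..n + r}" "distinct [i, j, k]" using third by blast
    have F: "F_elt n u i = F_elt n u j" unfolding F_elt_eq[OF i] F_elt_eq[OF j] eq ..
    have reg: "regular_sequence (mpol_ring {1..n}) [F_elt n u i, F_elt n u j, F_elt n u k]"
      by (rule assms(4)[OF i j k])
    then have "{F_elt n u i} \<subseteq> carrier (mpol_ring {1..n})" by (simp add: regular_sequence_def)
    \<comment> \<open>At position 1 the prefix ideal is generated by the first form, which equals
      the second.\<close>
    from mpol_genideal_self[OF this] show False
      using regular_sequence_not_in_prefix[OF reg, of 1] F by simp
  qed
  interpret star_configuration n r u
    using assms(1,2,3,5) nz inj by unfold_locales auto
  show ?thesis by (rule I_n_B_decomposition)
qed

end
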